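(* Let $F$ be a Borel set in $\mathbb{R}^n$ and $t>1$. Let $s\in(-\infty,1]$ and let $\mu$ be an $s$-concave probability measure on $\mathbb{R}^n$. Let $$F_t=\left\{x\in\mathbb{R}^n:\ \text{there exists an interval } I\ni x \text{ such that } |I|<\tfrac{t+1}{2}|F\cap I|\right\}.$$ If $\mu(F_t)<1$, then $$\mu(F^c)\ \ge\ \left(\frac{2}{t+1}\,\mu(F_t^c)^s+\frac{t-1}{t+1}\right)^{1/s},$$ where for $s=0$ the right-hand side is interpreted by continuity as $\mu(F_t^c)^{2/(t+1)}$.
   Context: An interval in $\mathbb{R}^n$ is an interval (segment) contained in an affine line of $\mathbb{R}^n$; for such an interval $I$ and a Borel set $F$, $|I|$ and $|F\cap I|$ denote one-dimensional Lebesgue measure. $A^c$ denotes the complement of $A$ in $\mathbb{R}^n$, and $F_t^c$ is the complement of $F_t$. If $F$ is Borel, $F_t$ is analytic, hence universally measurable; $\mu(F_t)$ is taken with respect to the completion of $\mu$. For $s\in(-\infty,1]$, a (Borel) measure $\mu$ on $\mathbb{R}^n$ is $s$-concave if $$\mu(\lambda A+(1-\lambda)B)\ge[\lambda\mu(A)^s+(1-\lambda)\mu(B)^s]^{1/s}$$ for all compact $A,B\subset\mathbb{R}^n$ with $\mu(A)\mu(B)>0$ and all $\lambda\in[0,1]$, where $\lambda A+(1-\lambda)B=\{\lambda x+(1-\lambda)y: x\in A,\ y\in B\}$; for $s=0$ the right-hand side is interpreted as $\mu(A)^\lambda\mu(B)^{1-\lambda}$.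
   Formalization: The measure μ is additionally assumed not to be a point mass: for μ the Dirac measure at a and F = {a}, the set F_t is empty, so the right-hand side is 1 while μ(F^c) = 0, and the inequality fails. *)

theory Defs
  imports "HOL-Analysis.Analysis" "HOL-Probability.Probability_Measure" "HOL-Probability.Giry_Monad"
begin

definition affine_line :: "real ^ 'n \<Rightarrow> real ^ 'n \<Rightarrow> (real ^ 'n) set" where
  "affine_line a v = range (\<lambda>r. a + r *\<^sub>R v)"

(* One-dimensional Lebesgue measure on the line through a with direction v. This is the
   correct normalization, independent of the parametrization of the line, when norm v = 1. *)
definition line_measure :: "real ^ 'n \<Rightarrow> real ^ 'n \<Rightarrow> (real ^ 'n) measure" where
  "line_measure a v = distr lborel borel (\<lambda>r. a + r *\<^sub>R v)"

(* The intervals of a line are its convex subsets (is_interval would mean boxes here).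
   Lengths are extended nonnegative reals, so unbounded intervals never qualify. *)
definition dilation :: "real \<Rightarrow> (real ^ 'n) set \<Rightarrow> (real ^ 'n) set" where
  "dilation t F = {x. \<exists>a v I. norm v = 1 \<and> I \<subseteq> affine_line a v \<and> convex I \<and> x \<in> I \<and>
     emeasure (line_measure a v) I
       < ennreal ((t + 1) / 2) * emeasure (line_measure a v) (F \<inter> I)}"

(* Meant for measures that are finite on compact sets, since "measure" is real-valued
   (and 0 on sets of infinite measure). *)
definition s_concave :: "real \<Rightarrow> (real ^ 'n) measure \<Rightarrow> bool" where
  "s_concave s M \<longleftrightarrow>
     (\<forall>A B. \<forall>l\<in>{0..1}. compact A \<longrightarrow> compact B \<longrightarrow> measure M A * measure M B > 0 \<longrightarrow>
        measure M {l *\<^sub>R x + (1 - l) *\<^sub>R y | x y. x \<in> A \<and> y \<in> B}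
          \<ge> (if s = 0 then measure M A powr l * measure M B powr (1 - l)
             else (l * measure M A powr s + (1 - l) * measure M B powr s) powr (1 / s)))"

end

theory Submission
  imports Defs "HOL-Probability.Distribution_Functions"
begin

text \<open>
  Put \<open>l = 2 / (t + 1)\<close> and \<open>C = - dilation t F\<close>: every interval meeting \<open>C\<close> carries at most the
  fraction \<open>l\<close> of its length in \<open>F\<close>. By inner regularity one may take \<open>F\<close> and \<open>C\<close> compact and
  disjoint, and by compactness the condition survives, for a slightly larger \<open>l\<close>, a small thickening of
  both sets. If the inequality failed, bisecting by half-spaces that split \<open>C\<close> in the same proportion as
  the measure would make it fail on a compact convex set so close to a line that everything can be
  projected to that line.

  On the line a smoothed density \<open>f\<close> is quasiconcave. A superlevel set of \<open>f\<close> that meets \<open>C\<close> satisfies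
  the sparseness condition gap by gap; the others lie in one gap \<open>{a<..<b}\<close> of \<open>C\<close>. Cut that gap at
  \<open>z\<close> so that the tails beyond \<open>a\<close> and \<open>b\<close> make up the same fraction of the two halves. On
  \<open>{z..b}\<close> the mass of \<open>F\<close> is then at most that of \<open>{x..l * b + (1 - l) * x}\<close> plus \<open>l\<close> times that of
  \<open>{z..x}\<close> for some \<open>x\<close>, and \<open>s\<close>-concavity of the tail function bounds the former from above.

  The part of \<open>F\<close> outside the dilation is null on every line. Applying the compact case to two
  disjoint pieces of it and letting \<open>l\<close> tend to 0 shows that it is null, unless the measure is a point mass.
\<close>

section \<open>Weighted power means\<close>

text \<open>The right-hand side of the theorem is \<open>pmean s (2 / (t + 1)) x 1\<close> with
  \<open>x\<close> the mass of the complement of the dilation, so everything is phrased with power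
  means.

  Why \<open>not_dirac\<close> is there: let \<open>M\<close> be the point mass at \<open>a\<close>
  and \<open>F = {a}\<close>. No interval carries positive length of \<open>F\<close>, so the
  dilation is empty and the right-hand side is 1, while \<open>- F\<close> has mass 0.

  Three obstacles shape the development. \<open>F\<close> and the complement of its dilation may
  overlap, for instance in isolated points of \<open>F\<close>, but the compactness argument needs
  disjoint sets; hence the separate proof that the overlap is null. The dilation is defined by an
  existential quantifier over directions and intervals, so it is reached as a projection of a Borel
  set, and its measurability for the completion rests on analytic sets. Finally, the projection of
  the measure to a needle is not known to have a density: averaging over short windows supplies a
  quasiconcave one, while the power mean inequality is used for the tails of the measure before
  averaging, at the cost of an error \<open>w\<close> that tends to 0.\<close>

definition pmean :: "real \<Rightarrow> real \<Rightarrow> real \<Rightarrow> real \<Rightarrow> real" where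
  "pmean s l a b = (if s = 0 then a powr l * b powr (1 - l)
     else (l * a powr s + (1 - l) * b powr s) powr (1 / s))"

lemma convex_comb_pos:
  fixes a b l :: real
  assumes "0 < a" "0 < b" "0 \<le> l" "l \<le> 1"
  shows "0 < l * a + (1 - l) * b"
  using assms by (cases "l = 0") (auto intro: add_pos_nonneg)

lemma pmean_commute: "pmean s l a b = pmean s (1 - l) b a"
  by (simp add: pmean_def ac_simps)

lemma pmean_pos: "0 < a \<Longrightarrow> 0 < b \<Longrightarrow> 0 \<le> l \<Longrightarrow> l \<le> 1 \<Longrightarrow> 0 < pmean s l a b"
  using convex_comb_pos[of "a powr s" "b powr s" l] by (auto simp: pmean_def)

lemma pmean_same: "0 < c \<Longrightarrow> pmean s l c c = c"
  by (auto simp: pmean_def powr_powr algebra_simps simp flip: powr_add)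

text \<open>Homogeneity lets the two halves of a gap, cut in proportion to their tails, share one
  factor; it also permits normalizing the measure on a needle.\<close>

lemma pmean_scale:
  assumes "0 < k" "0 < a" "0 < b" "0 \<le> l" "l \<le> 1"
  shows "pmean s l (k * a) (k * b) = k * pmean s l a b"
proof (cases "s = 0")
  case True
  have "k powr l * k powr (1 - l) = k"
    using assms by (simp flip: powr_add)
  then show ?thesis
    using True assms by (simp add: pmean_def powr_mult mult_ac)
next
  case False
  have "l * (k * a) powr s + (1 - l) * (k * b) powr s
      = k powr s * (l * a powr s + (1 - l) * b powr s)"
    using assms by (simp add: powr_mult algebra_simps)
  moreover have "(k powr s * (l * a powr s + (1 - l) * b powr s)) powr (1 / s)
      = (k powr s) powr (1 / s) * (l * a powr s + (1 - l) * b powr s) powr (1 / s)"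
    by (rule powr_mult)
  ultimately show ?thesis
    using False assms by (simp add: pmean_def powr_powr)
qed

lemma pmean_mono:
  assumes "0 < a" "a \<le> a'" "0 < b" "b \<le> b'" "0 \<le> l" "l \<le> 1"
  shows "pmean s l a b \<le> pmean s l a' b'"
proof -
  consider "s = 0" | "s > 0" | "s < 0" by linarith
  then show ?thesis
  proof cases
    case 1
    then show ?thesis
      using assms by (auto simp: pmean_def intro!: mult_mono powr_mono2)
  next
    case 2
    then show ?thesis
      using assms by (auto simp: pmean_def intro!: powr_mono2 add_mono mult_left_mono)
  next
    case 3
    have "l * a' powr s + (1 - l) * b' powr s \<le> l * a powr s + (1 - l) * b powr s"
      using assms 3 by (intro add_mono mult_left_mono powr_mono2') auto
    moreover have "0 < l * a' powr s + (1 - l) * b' powr s"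
      using assms by (intro convex_comb_pos) auto
    ultimately show ?thesis
      using 3 by (auto simp: pmean_def intro!: powr_mono2')
  qed
qed

lemma pmean_ge_min:
  assumes "0 < a" "0 < b" "0 \<le> l" "l \<le> 1"
  shows "min a b \<le> pmean s l a b"
  using pmean_mono[of "min a b" a "min a b" b l s] assms by (simp add: pmean_same)

lemma pmean_le_max:
  assumes "0 < a" "0 < b" "0 \<le> l" "l \<le> 1"
  shows "pmean s l a b \<le> max a b"
  using pmean_mono[of a "max a b" b "max a b" l s] assms by (simp add: pmean_same)

section \<open>Derivative and continuity of power means\<close>

lemma has_real_derivative_pmean:
  assumes "0 < a" "0 < b" "0 \<le> l" "l \<le> 1"
  shows "((\<lambda>x. pmean s l x b) has_real_derivative l * (pmean s l a b / a) powr (1 - s)) (at a)"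
proof (cases "s = 0")
  case True
  have eq: "pmean s l x b = x powr l * b powr (1 - l)" for x
    by (simp add: pmean_def True)
  have "((\<lambda>x. x powr l * b powr (1 - l)) has_real_derivative (l * a powr (l - 1)) * b powr (1 - l)) (at a)"
    using assms by (auto intro!: derivative_eq_intros)
  moreover have "(l * a powr (l - 1)) * b powr (1 - l) = l * (a powr l * b powr (1 - l) / a)"
    using assms by (simp add: powr_diff field_simps)
  ultimately show ?thesis
    using assms True pmean_pos[OF assms, of s] unfolding eq by simp
next
  case False
  define q where "q = l * a powr s + (1 - l) * b powr s"
  have q: "0 < q"
    unfolding q_def using assms by (intro convex_comb_pos) auto
  have "((\<lambda>x. (l * x powr s + (1 - l) * b powr s) powr (1 / s))
      has_real_derivative ((1 / s) * q powr (1 / s - 1)) * (l * (s * a powr (s - 1)))) (at a)"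
    using assms q False unfolding q_def by (auto intro!: derivative_eq_intros)
  moreover have "((1 / s) * q powr (1 / s - 1)) * (l * (s * a powr (s - 1)))
      = l * (q powr (1 / s - 1) * a powr (s - 1))"
    using False by simp
  moreover have "(q powr (1 / s) / a) powr (1 - s) = q powr (1 / s - 1) * a powr (s - 1)"
  proof -
    have "(1 / s) * (1 - s) = 1 / s - 1" using False by (simp add: field_simps)
    moreover have "1 / a powr (1 - s) = a powr (s - 1)"
      using powr_minus_divide[of a "1 - s"] by simp
    ultimately show ?thesis
      using assms q by (simp add: powr_divide powr_powr) (metis mult.commute times_divide_eq_right mult.right_neutral)
  qed
  ultimately show ?thesis
    using False by (simp add: pmean_def q_def mult_ac)
qed

text \<open>The derivative of the mean in its smaller argument is at least the weight of that argument,
  in its larger argument at most the weight, because the exponent \<open>1 - s\<close> is nonnegative.\<close>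

lemma pmean_slope_ge:
  assumes "0 < x" "x \<le> y" "y \<le> b" "0 \<le> l" "l \<le> 1" "s \<le> 1"
  shows "l * (y - x) \<le> pmean s l y b - pmean s l x b"
proof (cases "x = y")
  case False
  then have "x < y" using assms by simp
  then obtain c where c: "x < c" "c < y"
    and "pmean s l y b - pmean s l x b = (y - x) * (l * (pmean s l c b / c) powr (1 - s))"
    using MVT2[of x y "\<lambda>x. pmean s l x b" "\<lambda>c. l * (pmean s l c b / c) powr (1 - s)"]
      has_real_derivative_pmean assms by force
  moreover have "1 \<le> (pmean s l c b / c) powr (1 - s)"
    using pmean_ge_min[of c b l s] assms c by (intro ge_one_powr_ge_zero) auto
  then have "l \<le> l * (pmean s l c b / c) powr (1 - s)"
    using \<open>0 \<le> l\<close> by (simp add: mult_le_cancel_left1)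
  ultimately show ?thesis
    using \<open>x < y\<close> by (simp add: mult.commute[of l] mult_left_mono)
qed simp

lemma pmean_slope_le:
  assumes "0 < a" "a \<le> x" "x \<le> y" "0 \<le> l" "l \<le> 1" "s \<le> 1"
  shows "pmean s l a y - pmean s l a x \<le> (1 - l) * (y - x)"
proof (cases "x = y")
  case False
  then have "x < y" using assms by simp
  \<comment> \<open>The derivative is available in the first argument only; swapping the arguments
    exchanges \<open>l\<close> and \<open>1 - l\<close>.\<close>
  have comm: "pmean s l a = (\<lambda>y. pmean s (1 - l) y a)"
    using pmean_commute[of s l a] by auto
  have "\<And>c. x \<le> c \<Longrightarrow> ((\<lambda>x. pmean s (1 - l) x a) has_real_derivative
      (1 - l) * (pmean s (1 - l) c a / c) powr (1 - s)) (at c)"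
    using assms by (intro has_real_derivative_pmean) auto
  then obtain c where c: "x < c" "c < y"
    and eq: "pmean s l a y - pmean s l a x = (y - x) * ((1 - l) * (pmean s (1 - l) c a / c) powr (1 - s))"
    using MVT2[OF \<open>x < y\<close>, of "\<lambda>x. pmean s (1 - l) x a"
        "\<lambda>c. (1 - l) * (pmean s (1 - l) c a / c) powr (1 - s)"] comm by force
  have "pmean s (1 - l) c a / c \<le> 1"
    using pmean_le_max[of c a "1 - l" s] assms c by auto
  then have "(pmean s (1 - l) c a / c) powr (1 - s) \<le> 1"
    using assms c pmean_pos[of c a "1 - l" s] by (intro powr_le1) auto
  then have "(1 - l) * (pmean s (1 - l) c a / c) powr (1 - s) \<le> 1 - l"
    using \<open>l \<le> 1\<close> by (simp add: mult_left_le)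
  then show ?thesis
    unfolding eq using \<open>x < y\<close> by (simp add: mult.commute[of "1 - l"] mult_left_mono)
qed simp

lemma isCont_pmean_left:
  assumes "0 < a" "0 < b" "0 \<le> l" "l \<le> 1"
  shows "isCont (\<lambda>x. pmean s l x b) a"
  using has_real_derivative_pmean[OF assms] by (rule DERIV_isCont)

lemma isCont_pmean_weight:
  assumes "0 < a" "0 < b" "0 \<le> l" "l \<le> 1"
  shows "isCont (\<lambda>l. pmean s l a b) l"
  using convex_comb_pos[of "a powr s" "b powr s" l] assms
  by (cases "s = 0") (auto simp: pmean_def intro!: continuous_intros)

lemma pmean_weight_zero: "0 < a \<Longrightarrow> 0 < b \<Longrightarrow> pmean s 0 a b = b"
  by (auto simp: pmean_def powr_powr)

section \<open>Superlevel sets on the real line\<close>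

text \<open>Estimates on single components add up because an open subset of the line has only
  countably many of them.\<close>

lemma emeasure_open_le_components:
  fixes U S :: "real set"
  assumes "open U" "S \<in> sets borel"
    and le: "\<And>I. I \<in> components U \<Longrightarrow> emeasure lborel (S \<inter> I) \<le> ennreal l * emeasure lborel I"
  shows "emeasure lborel (S \<inter> U) \<le> ennreal l * emeasure lborel U"
proof -
  have cnt: "countable (components U)"
    using pairwise_disjoint_components[of U] open_components[OF \<open>open U\<close>]
    by (intro countable_disjoint_open_subsets) (auto simp: disjoint_def pairwise_def disjnt_def)
  have opn: "open I" if "I \<in> components U" for I
    using that \<open>open U\<close> open_components by blast
  have disj: "disjoint_family_on (\<lambda>I. I) (components U)"
    by (auto simp: disjoint_family_on_def dest: components_nonoverlap)
  have U: "U = (\<Union>I\<in>components U. I)"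
    using Union_components[of U] by simp
  have "S \<inter> (\<Union>I\<in>components U. I) = (\<Union>I\<in>components U. S \<inter> I)"
    by blast
  then have "emeasure lborel (S \<inter> U) = emeasure lborel (\<Union>I\<in>components U. S \<inter> I)"
    by (simp only: U[symmetric])
  also have "\<dots> = (\<integral>\<^sup>+I. emeasure lborel (S \<inter> I) \<partial>count_space (components U))"
    using cnt disj opn \<open>S \<in> sets borel\<close>
    by (intro emeasure_UN_countable) (auto simp: disjoint_family_on_def)
  also have "\<dots> \<le> (\<integral>\<^sup>+I. ennreal l * emeasure lborel I \<partial>count_space (components U))"
    using le by (intro nn_integral_mono) auto
  also have "\<dots> = ennreal l * (\<integral>\<^sup>+I. emeasure lborel I \<partial>count_space (components U))"
    by (intro nn_integral_cmult) auto
  also have "(\<integral>\<^sup>+I. emeasure lborel I \<partial>count_space (components U)) = emeasure lborel (\<Union>I\<in>components U. I)"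
    using cnt disj opn by (intro emeasure_UN_countable[symmetric]) auto
  finally show ?thesis by (simp only: U[symmetric])
qed

text \<open>Both sides compute the area of the region \<open>?D\<close> under the graph of
  \<open>f\<close> over \<open>S\<close>, sliced vertically and horizontally; the indicator of
  \<open>{0..}\<close> cuts off negative levels.\<close>

lemma emeasure_density_layer_cake:
  fixes f :: "real \<Rightarrow> real"
  assumes [measurable]: "f \<in> borel_measurable borel" "S \<in> sets borel" and nonneg: "\<And>x. 0 \<le> f x"
  shows "emeasure (density lborel f) S
    = (\<integral>\<^sup>+u. indicator {0..} u * emeasure lborel (S \<inter> {x. u < f x}) \<partial>lborel)"
proof -
  let ?D = "{p. fst p \<in> S \<and> 0 \<le> snd p \<and> snd p < f (fst p)}"
  have [measurable]: "?D \<in> sets (borel \<Otimes>\<^sub>M borel)"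
  proof -
    have "{p \<in> space (borel \<Otimes>\<^sub>M borel). fst p \<in> S \<and> 0 \<le> snd p \<and> snd p < f (fst p)} \<in> sets (borel \<Otimes>\<^sub>M borel)"
      by measurable
    then show ?thesis by (simp add: space_pair_measure)
  qed
  have "emeasure (density lborel f) S = (\<integral>\<^sup>+x. ennreal (f x) * indicator S x \<partial>lborel)"
    by (subst emeasure_density) auto
  also have "\<dots> = (\<integral>\<^sup>+x. (\<integral>\<^sup>+u. indicator ?D (x, u) \<partial>lborel) \<partial>lborel)"
  proof (rule nn_integral_cong)
    fix x :: real
    have "(\<integral>\<^sup>+u. indicator ?D (x, u) \<partial>lborel)
        = (\<integral>\<^sup>+u. indicator S x * indicator {0..<f x} u \<partial>lborel)"
      by (intro nn_integral_cong) (auto split: split_indicator)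
    also have "\<dots> = indicator S x * ennreal (f x)"
      using nonneg[of x] by (subst nn_integral_cmult) auto
    finally show "ennreal (f x) * indicator S x = (\<integral>\<^sup>+u. indicator ?D (x, u) \<partial>lborel)"
      by (simp add: mult.commute)
  qed
  also have "\<dots> = (\<integral>\<^sup>+u. (\<integral>\<^sup>+x. indicator ?D (x, u) \<partial>lborel) \<partial>lborel)"
    by (rule lborel_pair.Fubini'[symmetric]) measurable
  also have "\<dots> = (\<integral>\<^sup>+u. indicator {0..} u * emeasure lborel (S \<inter> {x. u < f x}) \<partial>lborel)"
  proof (rule nn_integral_cong)
    fix u :: real
    have "(\<integral>\<^sup>+x. indicator ?D (x, u) \<partial>lborel)
        = (\<integral>\<^sup>+x. indicator {0..} u * indicator (S \<inter> {x. u < f x}) x \<partial>lborel)"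
      by (intro nn_integral_cong) (auto split: split_indicator)
    also have "\<dots> = indicator {0..} u * emeasure lborel (S \<inter> {x. u < f x})"
      by (subst nn_integral_cmult_indicator) auto
    finally show "(\<integral>\<^sup>+x. indicator ?D (x, u) \<partial>lborel)
        = indicator {0..} u * emeasure lborel (S \<inter> {x. u < f x})" .
  qed
  finally show ?thesis .
qed

text \<open>Integrating over the levels reduces an inequality between \<open>f\<close>-masses to one
  between lengths inside each superlevel set. Both mass estimates for quasiconcave densities below
  are obtained in this way.\<close>

lemma emeasure_density_add_le:
  fixes f :: "real \<Rightarrow> real"
  assumes [measurable]: "f \<in> borel_measurable borel" "S \<in> sets borel" "A \<in> sets borel" "B \<in> sets borel"
    and nonneg: "\<And>x. 0 \<le> f x"
    and le: "\<And>u. 0 \<le> u \<Longrightarrow> emeasure lborel (S \<inter> {x. u < f x})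
      \<le> emeasure lborel (A \<inter> {x. u < f x}) + ennreal l * emeasure lborel (B \<inter> {x. u < f x})"
  shows "emeasure (density lborel f) S
    \<le> emeasure (density lborel f) A + ennreal l * emeasure (density lborel f) B"
proof -
  have [measurable]: "(\<lambda>u. emeasure lborel (D \<inter> {x. u < f x})) \<in> borel_measurable borel"
    if [measurable]: "D \<in> sets borel" for D
  proof -
    have "(\<lambda>u. emeasure lborel (Pair u -` {p. snd p \<in> D \<and> fst p < f (snd p)})) \<in> borel_measurable (borel :: real measure)"
    proof (rule lborel.measurable_emeasure_Pair)
      have "{p \<in> space (borel \<Otimes>\<^sub>M borel). snd p \<in> D \<and> fst p < f (snd p)} \<in> sets (borel \<Otimes>\<^sub>M (borel :: real measure))"
        by measurable
      then show "{p. snd p \<in> D \<and> fst p < f (snd p)} \<in> sets (borel \<Otimes>\<^sub>M lborel)"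
        by (simp add: space_pair_measure cong: sets_pair_measure_cong)
    qed
    moreover have "Pair u -` {p. snd p \<in> D \<and> fst p < f (snd p)} = D \<inter> {x. u < f x}" for u
      by auto
    ultimately show ?thesis by simp
  qed
  have "emeasure (density lborel f) S \<le> (\<integral>\<^sup>+u. indicator {0..} u * emeasure lborel (A \<inter> {x. u < f x})
      + ennreal l * (indicator {0..} u * emeasure lborel (B \<inter> {x. u < f x})) \<partial>lborel)"
    using le by (subst emeasure_density_layer_cake)
      (auto simp: nonneg intro!: nn_integral_mono split: split_indicator)
  also have "\<dots> = emeasure (density lborel f) A + ennreal l * emeasure (density lborel f) B"
    by (subst nn_integral_add; (subst nn_integral_cmult)?; simp add: emeasure_density_layer_cake nonneg)
  finally show ?thesis .
qed

section \<open>Rearrangement for quasiconcave densities\<close>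

definition quasiconcave :: "(real \<Rightarrow> real) \<Rightarrow> bool" where
  "quasiconcave f \<longleftrightarrow> (\<forall>x y z. x \<le> y \<longrightarrow> y \<le> z \<longrightarrow> min (f x) (f z) \<le> f y)"

lemma quasiconcave_superlevel:
  "quasiconcave f \<Longrightarrow> x \<le> y \<Longrightarrow> y \<le> z \<Longrightarrow> u < f x \<Longrightarrow> u < f z \<Longrightarrow> u < f y"
  unfolding quasiconcave_def by (drule spec[of _ x], drule spec[of _ y], drule spec[of _ z]) (simp add: min_def split: if_splits)

text \<open>Every superlevel set is either contained in \<open>{x..l * b + (1 - l) * x}\<close> or contains it,
  for a suitable \<open>x\<close> that does not depend on the level.\<close>

lemma quasiconcave_rearrange:
  fixes f :: "real \<Rightarrow> real"
  assumes [measurable]: "f \<in> borel_measurable borel" "F \<in> sets borel"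
    and nonneg: "\<And>x. 0 \<le> f x" and qc: "quasiconcave f" and "z \<le> b" "0 < l" "l < 1"
    and F: "\<And>w. z \<le> w \<Longrightarrow> w \<le> b \<Longrightarrow> emeasure lborel (F \<inter> {w..b}) \<le> ennreal (l * (b - w))"
  obtains x where "z \<le> x" "x \<le> b"
    "emeasure (density lborel f) (F \<inter> {z..b}) \<le> emeasure (density lborel f) {x..l * b + (1 - l) * x}
        + ennreal l * emeasure (density lborel f) {z..x}"
proof -
  define L where "L u = {v\<in>{z..b}. u < f v}" for u
  define X where "X u = Inf (L u)" for u
  define Y where "Y u = Sup (L u)" for u
  define y where "y x = l * b + (1 - l) * x" for x
  \<comment> \<open>\<open>yi\<close> inverts \<open>y\<close>, so comparing \<open>y x\<close> with
    the right end \<open>Y u\<close> of a superlevel set becomes a comparison for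
    \<open>x\<close>.\<close>
  define yi where "yi v = (v - l * b) / (1 - l)" for v
  have y_le: "y v \<le> w \<longleftrightarrow> v \<le> yi w" and le_y: "w \<le> y v \<longleftrightarrow> yi w \<le> v" for v w
    using \<open>l < 1\<close> by (auto simp: y_def yi_def field_simps)
  define N where "N = {u. L u \<noteq> {}}"
  have bdd: "bdd_below (L u)" "bdd_above (L u)" for u
    by (rule bdd_belowI[of _ z], simp add: L_def) (rule bdd_aboveI[of _ b], simp add: L_def)
  have XY: "z \<le> X u" "X u \<le> Y u" "Y u \<le> b" if u: "u \<in> N" for u
  proof -
    obtain v where v: "v \<in> L u" using u by (auto simp: N_def)
    show "z \<le> X u" unfolding X_def using u by (intro cInf_greatest) (auto simp: L_def N_def)
    show "Y u \<le> b" unfolding Y_def using u by (intro cSup_least) (auto simp: L_def N_def)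
    show "X u \<le> Y u" unfolding Y_def X_def
      using cInf_lower[OF v bdd(1)] cSup_upper[OF v bdd(2)] by simp
  qed
  have L_sub: "L u \<subseteq> {X u..Y u}" for u
  proof
    fix v assume "v \<in> L u"
    then show "v \<in> {X u..Y u}"
      using cInf_lower[OF _ bdd(1)] cSup_upper[OF _ bdd(2)] by (simp add: X_def Y_def)
  qed
  have L_sup: "v \<in> L u" if uv: "u \<in> N" "X u < v" "v < Y u" for u v
  proof -
    have ne: "L u \<noteq> {}" using uv(1) by (simp add: N_def)
    obtain v1 where v1: "v1 \<in> L u" "v1 < v"
      using cInf_lessD[OF ne uv(2)[unfolded X_def]] by blast
    obtain v2 where v2: "v2 \<in> L u" "v < v2"
      using less_cSupD[OF ne uv(3)[unfolded Y_def]] by blast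
    have "u < f v"
      using v1 v2 by (intro quasiconcave_superlevel[OF qc, of v1 v v2 u]) (simp_all add: L_def)
    then show ?thesis
      using v1 v2 by (simp add: L_def)
  qed
  have nest: "X u \<le> X u' \<and> Y u' \<le> Y u" if "u' \<in> N" "u \<le> u'" for u u'
  proof
    have sub: "L u' \<subseteq> L u" using that by (auto simp: L_def)
    show "X u \<le> X u'" unfolding X_def
      using that sub bdd by (intro cInf_superset_mono) (auto simp: N_def)
    show "Y u' \<le> Y u" unfolding Y_def
      using that sub bdd by (intro cSup_subset_mono) (auto simp: N_def)
  qed
  \<comment> \<open>If \<open>x\<close> lies between \<open>X u\<close> and \<open>yi (Y u)\<close>,
    the order of these two decides whether the superlevel set contains \<open>{x..y x}\<close> (up
    to end points) or is contained in it. The intervals \<open>{lo u..hi u}\<close> meet pairwise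
    because superlevel sets are nested, so they have a common point, and the supremum of their left
    ends is one.\<close>
  define lo where "lo u = min (X u) (yi (Y u))" for u
  define hi where "hi u = max (X u) (yi (Y u))" for u
  have yi_mono: "v \<le> w \<Longrightarrow> yi v \<le> yi w" for v w
    using \<open>l < 1\<close> by (auto simp: yi_def divide_right_mono)
  have lo_hi: "lo u \<le> hi u'" if "u \<in> N" "u' \<in> N" for u u'
    using nest[of u u'] nest[of u' u] that yi_mono[of "Y u'" "Y u"] yi_mono[of "Y u" "Y u'"]
    by (cases "u \<le> u'") (auto simp: lo_def hi_def min_le_iff_disj le_max_iff_disj)
  have yib: "yi b = b" using \<open>l < 1\<close> by (simp add: yi_def field_simps)
  have hi_b: "hi u \<le> b" if "u \<in> N" for u
    using XY[OF that] yi_mono[of "Y u" b] yib by (auto simp: hi_def)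
  define x where "x = Sup (insert z (lo ` N))"
  have bddlo: "bdd_above (insert z (lo ` N))"
  proof (rule bdd_aboveI[of _ b])
    fix v assume "v \<in> insert z (lo ` N)"
    then show "v \<le> b"
      using lo_hi hi_b \<open>z \<le> b\<close> by (metis imageE insertE order_trans)
  qed
  have zx: "z \<le> x" unfolding x_def by (intro cSup_upper bddlo) auto
  have lo_x: "lo u \<le> x" if "u \<in> N" for u
    unfolding x_def using that by (intro cSup_upper bddlo) auto
  have x_hi: "x \<le> hi u" if "u \<in> N" for u
    unfolding x_def
  proof (rule cSup_least)
    fix v assume "v \<in> insert z (lo ` N)"
    moreover have "z \<le> hi u" using XY(1)[OF that] by (simp add: hi_def le_max_iff_disj)
    ultimately show "v \<le> hi u" using lo_hi that by blast
  qed simp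
  have xb: "x \<le> b"
    unfolding x_def
  proof (rule cSup_least)
    fix v assume "v \<in> insert z (lo ` N)"
    then show "v \<le> b"
      using lo_hi hi_b \<open>z \<le> b\<close> by (metis imageE insertE order_trans)
  qed simp
  have yx: "x \<le> y x" "y x \<le> b"
  proof -
    have "y x = x + l * (b - x)" by (simp add: y_def algebra_simps)
    then show "x \<le> y x" using xb \<open>0 < l\<close> by simp
    show "y x \<le> b" unfolding y_le yib by (rule xb)
  qed
  have "emeasure (density lborel f) (F \<inter> {z..b}) \<le> emeasure (density lborel f) {x..y x}
        + ennreal l * emeasure (density lborel f) {z..x}"
  proof (rule emeasure_density_add_le)
    fix u :: real
    assume "0 \<le> u"
    show "emeasure lborel (F \<inter> {z..b} \<inter> {x. u < f x}) \<le> emeasure lborel ({x..y x} \<inter> {x. u < f x})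
        + ennreal l * emeasure lborel ({z..x} \<inter> {x. u < f x})"
    proof (cases "u \<in> N")
      case False
      then have "F \<inter> {z..b} \<inter> {x. u < f x} = {}" by (auto simp: N_def L_def)
      then show ?thesis by simp
    next
      case u: True
      show ?thesis
      proof (cases "X u \<le> x \<and> y x \<le> Y u")
        case True
        \<comment> \<open>The hypothesis on \<open>F\<close> speaks of intervals ending at
          \<open>b\<close>, so the superlevel set is enlarged to \<open>{X u..b}\<close>; the bound
          \<open>l * (b - X u)\<close> then splits exactly at \<open>x\<close>.\<close>
        have "emeasure lborel (F \<inter> {z..b} \<inter> {x. u < f x}) \<le> emeasure lborel (F \<inter> {X u..b})"
          using L_sub[of u] XY[OF u] by (intro emeasure_mono) (auto simp: L_def)
        also have "\<dots> \<le> ennreal (l * (b - X u))"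
          using XY[OF u] by (intro F) auto
        also have "l * (b - X u) = (y x - x) + l * (x - X u)"
          by (simp add: y_def algebra_simps)
        also have "ennreal \<dots> = ennreal (y x - x) + ennreal l * ennreal (x - X u)"
          using True yx \<open>0 < l\<close> by (simp add: ennreal_mult ennreal_plus)
        also have "\<dots> = emeasure lborel {x<..<y x} + ennreal l * emeasure lborel {X u<..<x}"
          using True yx by simp
        also have "\<dots> \<le> emeasure lborel ({x..y x} \<inter> {x. u < f x}) + ennreal l * emeasure lborel ({z..x} \<inter> {x. u < f x})"
        proof -
          have "u < f v" if "X u < v" "v < Y u" for v
            using L_sup[OF u that] by (simp add: L_def)
          then show ?thesis
            using True XY[OF u] yx by (intro add_mono mult_left_mono emeasure_mono) auto
        qed
        finally show ?thesis .
      next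
        case False
        then have "x \<le> X u" "Y u \<le> y x"
          using lo_x[OF u] x_hi[OF u] by (auto simp: lo_def hi_def y_le le_y min_def max_def split: if_splits)
        then have "F \<inter> {z..b} \<inter> {x. u < f x} \<subseteq> {x..y x} \<inter> {x. u < f x}"
          using L_sub[of u] by (fastforce simp: L_def)
        then have "emeasure lborel (F \<inter> {z..b} \<inter> {x. u < f x}) \<le> emeasure lborel ({x..y x} \<inter> {x. u < f x})"
          by (intro emeasure_mono) auto
        then show ?thesis by (simp add: add_increasing2)
      qed
    qed
  qed (use nonneg in auto)
  then show thesis using that zx xb by (simp add: y_def)
qed

text \<open>On a line this expresses that \<open>C\<close> avoids the dilation of \<open>F\<close>,
  with \<open>l\<close> in the role of \<open>2 / (t + 1)\<close>. Only compact intervals are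
  tested, and the point of \<open>C\<close> may be an end point, which is how the gap estimates use
  it.\<close>

definition sparse_near :: "real \<Rightarrow> real set \<Rightarrow> real set \<Rightarrow> bool" where
  "sparse_near l F C \<longleftrightarrow> (\<forall>c\<in>C. \<forall>p q. p \<le> c \<longrightarrow> c \<le> q \<longrightarrow>
     emeasure lborel (F \<inter> {p..q}) \<le> ennreal (l * (q - p)))"

lemma sparse_nearD:
  "sparse_near l F C \<Longrightarrow> p \<le> c \<Longrightarrow> c \<le> q \<Longrightarrow> c \<in> C \<Longrightarrow>
    emeasure lborel (F \<inter> {p..q}) \<le> ennreal (l * (q - p))"
  unfolding sparse_near_def by blast

text \<open>Maximality of a component keeps its end points outside \<open>U\<close>. When
  \<open>U\<close> arises by removing \<open>C\<close>, this is what puts end points into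
  \<open>C\<close>, where sparseness applies.\<close>

lemma component_interval:
  fixes U :: "real set"
  assumes "open U" "bounded U" "I \<in> components U"
  obtains u v where "u < v" "I = {u<..<v}" "u \<notin> U" "v \<notin> U"
proof -
  have I: "connected I" "I \<noteq> {}" "I \<subseteq> U" "open I" "bounded I"
    using in_components_connected[OF assms(3)] in_components_nonempty[OF assms(3)]
      in_components_subset[OF assms(3)] open_components[OF assms(1,3)]
      bounded_subset[OF assms(2)] by auto
  have bdd: "bdd_below I" "bdd_above I"
    using \<open>bounded I\<close> by (auto simp: bounded_imp_bdd_below bounded_imp_bdd_above)
  define u where "u = Inf I"
  define v where "v = Sup I"
  have ge: "u \<le> x" and le: "x \<le> v" if "x \<in> I" for x
    using that bdd by (auto simp: u_def v_def intro: cInf_lower cSup_upper)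
  have strict: "u < x \<and> x < v" if x: "x \<in> I" for x
  proof -
    obtain e where e: "e > 0" "ball x e \<subseteq> I"
      using \<open>open I\<close> x open_contains_ball by blast
    have "x - e / 2 \<in> ball x e" "x + e / 2 \<in> ball x e"
      using \<open>e > 0\<close> by (auto simp: dist_real_def)
    then have "u \<le> x - e / 2" "x + e / 2 \<le> v"
      using e ge le by blast+
    then show ?thesis using \<open>e > 0\<close> by simp
  qed
  have sup: "x \<in> I" if x: "u < x" "x < v" for x
  proof -
    obtain y where y: "y \<in> I" "y < x"
      using cInf_lessD[OF \<open>I \<noteq> {}\<close>] x unfolding u_def by blast
    obtain z where z: "z \<in> I" "x < z"
      using less_cSupD[OF \<open>I \<noteq> {}\<close>] x unfolding v_def by blast
    show ?thesis
      using connected_contains_Icc[OF \<open>connected I\<close> y(1) z(1)] y z by auto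
  qed
  have Iuv: "I = {u<..<v}" using strict sup by auto
  then have uv: "u < v" using \<open>I \<noteq> {}\<close> by auto
  have max: "T \<subseteq> I" if "connected T" "T \<subseteq> U" "T \<inter> I \<noteq> {}" for T
    using components_maximal[OF assms(3) that(1,2)] that(3) by blast
  have ins: "{u..<v} = insert u I" "{u<..v} = insert v I"
    using uv unfolding Iuv by auto
  have "u \<notin> U"
  proof
    assume "u \<in> U"
    moreover have "connected (insert u I)"
      using connected_Ico[of u v] by (simp only: ins(1))
    ultimately have "insert u I \<subseteq> I"
      using \<open>I \<subseteq> U\<close> \<open>I \<noteq> {}\<close> by (intro max) auto
    then show False using strict[of u] by auto
  qed
  moreover have "v \<notin> U"
  proof
    assume "v \<in> U"
    moreover have "connected (insert v I)"
      using connected_Ioc[of u v] by (simp only: ins(2))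
    ultimately have "insert v I \<subseteq> I"
      using \<open>I \<subseteq> U\<close> \<open>I \<noteq> {}\<close> by (intro max) auto
    then show False using strict[of v] by auto
  qed
  ultimately have "u \<notin> U" "v \<notin> U" by auto
  then show thesis using that uv Iuv by blast
qed

text \<open>Remove \<open>C\<close> and \<open>{a..b}\<close> from the interior of \<open>L\<close>.
  Every remaining component has an end point in \<open>C\<close>: an end outside \<open>C\<close>
  must be an end of \<open>L\<close>, and if both ends were of this kind, \<open>L\<close> would
  miss \<open>C\<close>. Sparseness at the end point in \<open>C\<close> bounds the
  component.\<close>

lemma sparse_interval:
  fixes L :: "real set"
  assumes "closed C" and [measurable]: "F \<in> sets borel" and "L \<in> sets borel" and FC: "F \<inter> C = {}"
    and sp: "sparse_near l F C" and ab: "a \<in> C" "b \<in> C" "a \<le> b"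
    and Lint: "\<And>x y z. x \<in> L \<Longrightarrow> z \<in> L \<Longrightarrow> x \<le> y \<Longrightarrow> y \<le> z \<Longrightarrow> y \<in> L"
    and "bounded L" "L \<inter> C \<noteq> {}" "0 \<le> l"
  shows "emeasure lborel (F \<inter> L) \<le> emeasure lborel (F \<inter> {a..b} \<inter> L) + ennreal l * emeasure lborel ((- C - {a..b}) \<inter> L)"
proof -
  note [measurable] = \<open>L \<in> sets borel\<close> borel_closed[OF \<open>closed C\<close>]
  obtain c where c: "c \<in> L" "c \<in> C" using \<open>L \<inter> C \<noteq> {}\<close> by auto
  then have ne: "L \<noteq> {}" by auto
  have bdd: "bdd_below L" "bdd_above L"
    using \<open>bounded L\<close> by (auto simp: bounded_imp_bdd_below bounded_imp_bdd_above)
  define p where "p = Inf L"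
  define q where "q = Sup L"
  have Lpq: "L \<subseteq> {p..q}"
    using cInf_lower[OF _ bdd(1)] cSup_upper[OF _ bdd(2)] by (auto simp: p_def q_def)
  have pqL: "x \<in> L" if x: "p < x" "x < q" for x
  proof -
    obtain y where y: "y \<in> L" "y < x"
      using cInf_lessD[OF ne] x unfolding p_def by blast
    obtain z where z: "z \<in> L" "x < z"
      using less_cSupD[OF ne] x unfolding q_def by blast
    show ?thesis using Lint[of y z x] y z by simp
  qed
  define U where "U = {p<..<q} - C - {a..b}"
  have "open U"
    unfolding U_def using \<open>closed C\<close> by (intro open_Diff) auto
  have "bounded U"
    by (rule bounded_subset[of "{p..q}"]) (auto simp: U_def)
  have "emeasure lborel (F \<inter> U) \<le> ennreal l * emeasure lborel U"
  proof (rule emeasure_open_le_components[OF \<open>open U\<close>])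
    fix I assume I: "I \<in> components U"
    obtain u v where uv: "u < v" "I = {u<..<v}" "u \<notin> U" "v \<notin> U"
      using component_interval[OF \<open>open U\<close> \<open>bounded U\<close> I] by blast
    have sub: "{u<..<v} \<subseteq> U" using in_components_subset[OF I] uv by simp
    have U: "p < x" "x < q" "x \<notin> C" "\<not> (a \<le> x \<and> x \<le> b)" if "u < x" "x < v" for x
      using subsetD[OF sub, of x] that by (auto simp: U_def)
    have pu: "p \<le> u" using U(1) uv(1) by (meson dense_ge_bounded less_imp_le)
    have vq: "v \<le> q" using U(2) uv(1) by (meson dense_le_bounded less_imp_le)
    \<comment> \<open>An end inside \<open>{p<..<q}\<close> but outside \<open>C\<close> would lie
      in \<open>{a..b}\<close> without being \<open>a\<close> or \<open>b\<close>, so the component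
      would enter \<open>{a..b}\<close>.\<close>
    have 1: "u = p" if "u \<notin> C"
    proof (rule ccontr)
      assume "u \<noteq> p"
      then have "a \<le> u \<and> u \<le> b" using uv(3) pu uv(1) vq that by (auto simp: U_def)
      moreover from this have "u < b" using that ab by (cases "u = b") auto
      ultimately show False using U(4)[of "(u + min b v) / 2"] uv(1) by (cases "b \<le> v") auto
    qed
    have 2: "v = q" if "v \<notin> C"
    proof (rule ccontr)
      assume "v \<noteq> q"
      then have "a \<le> v \<and> v \<le> b" using uv(4) pu uv(1) vq that by (auto simp: U_def)
      moreover from this have "a < v" using that ab by (cases "v = a") auto
      ultimately show False using U(4)[of "(v + max a u) / 2"] uv(1) by (cases "a \<le> u") auto
    qed
    have "u \<in> C \<or> v \<in> C"
    proof (rule ccontr)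
      assume "\<not> (u \<in> C \<or> v \<in> C)"
      then have "u = p" "v = q" "u \<notin> C" "v \<notin> C" using 1 2 by auto
      moreover have "c \<in> {p..q}" using c Lpq by auto
      ultimately show False using U(3)[of c] c by (cases "c = p"; cases "c = q") auto
    qed
    then have "emeasure lborel (F \<inter> {u..v}) \<le> ennreal (l * (v - u))"
      using sparse_nearD[OF sp, of u u v] sparse_nearD[OF sp, of u v v] uv(1) by auto
    moreover have "emeasure lborel (F \<inter> I) \<le> emeasure lborel (F \<inter> {u..v})"
      unfolding uv(2) by (intro emeasure_mono) auto
    ultimately show "emeasure lborel (F \<inter> I) \<le> ennreal l * emeasure lborel I"
      using uv(1) \<open>0 \<le> l\<close> unfolding uv(2) by (simp add: ennreal_mult order_trans)
  qed simp
  also have "\<dots> \<le> ennreal l * emeasure lborel ((- C - {a..b}) \<inter> L)"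
    using pqL by (intro mult_left_mono emeasure_mono) (auto simp: U_def)
  finally have FU: "emeasure lborel (F \<inter> U) \<le> ennreal l * emeasure lborel ((- C - {a..b}) \<inter> L)" .
  have [measurable]: "U \<in> sets borel" using \<open>open U\<close> by simp
  have "F \<inter> L \<subseteq> ((F \<inter> {a..b} \<inter> L) \<union> (F \<inter> U)) \<union> {p, q}"
    using Lpq FC by (auto simp: U_def)
  then have "emeasure lborel (F \<inter> L) \<le> emeasure lborel (((F \<inter> {a..b} \<inter> L) \<union> (F \<inter> U)) \<union> {p, q})"
    by (intro emeasure_mono) auto
  also have "\<dots> = emeasure lborel ((F \<inter> {a..b} \<inter> L) \<union> (F \<inter> U))"
    by (rule emeasure_Un_null_set) (auto intro!: finite_imp_null_set_lborel)
  also have "\<dots> \<le> emeasure lborel (F \<inter> {a..b} \<inter> L) + emeasure lborel (F \<inter> U)"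
    by (intro emeasure_subadditive) auto
  finally show ?thesis using FU by (meson add_left_mono order_trans)
qed

text \<open>Superlevel sets that avoid \<open>C\<close> form a chain and so lie in one gap \<open>{a<..<b}\<close> of \<open>C\<close>;
  all the others satisfy the previous estimate.\<close>

lemma sparse_density_gap:
  fixes f :: "real \<Rightarrow> real"
  assumes [measurable]: "f \<in> borel_measurable borel" "F \<in> sets borel" and nonneg: "\<And>x. 0 \<le> f x"
    and qc: "quasiconcave f" and "closed C" "F \<inter> C = {}" and sp: "sparse_near l F C" and "0 \<le> l"
    and R: "- R \<in> C" "R \<in> C" and out: "\<And>x. x \<le> - R \<or> R \<le> x \<Longrightarrow> f x = 0"
  obtains a b where "a \<in> C" "b \<in> C" "a \<le> b" "{a<..<b} \<inter> C = {}"
    "emeasure (density lborel f) F \<le> emeasure (density lborel f) (F \<inter> {a..b})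
      + ennreal l * emeasure (density lborel f) (- C - {a..b})"
proof -
  note [measurable] = borel_closed[OF \<open>closed C\<close>]
  define L where "L u = {x. u < f x}" for u
  have [measurable]: "L u \<in> sets borel" for u
  proof -
    have "{x \<in> space borel. u < f x} \<in> sets borel" by measurable
    then show ?thesis by (simp add: L_def)
  qed
  have Lint: "y \<in> L u" if "x \<in> L u" "z \<in> L u" "x \<le> y" "y \<le> z" for x y z u
    using quasiconcave_superlevel[OF qc that(3,4)] that by (simp add: L_def)
  have LR: "- R < x \<and> x < R" if "x \<in> L u" "0 \<le> u" for x u
    using that out[of x] by (force simp: L_def)
  have bddL: "bounded (L u)" if "0 \<le> u" for u
    by (rule bounded_subset[of "{- R..R}"]) (use LR[OF _ that] in force)+
  obtain a b where ab: "a \<in> C" "b \<in> C" "a \<le> b" "{a<..<b} \<inter> C = {}"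
    and gap: "\<And>u. 0 \<le> u \<Longrightarrow> L u \<inter> C = {} \<Longrightarrow> L u \<subseteq> {a..b}"
  proof (cases "\<exists>u w. 0 \<le> u \<and> w \<in> L u \<and> L u \<inter> C = {}")
    case False
    then have "L u = {}" if "0 \<le> u" "L u \<inter> C = {}" for u using that by auto
    \<comment> \<open>No nonempty superlevel set avoids \<open>C\<close>, so the degenerate gap
      \<open>{R..R}\<close> serves.\<close>
    then show ?thesis using that[of R R] R by auto
  next
    case True
    then obtain u0 w where w: "0 \<le> u0" "w \<in> L u0" "L u0 \<inter> C = {}" by blast
    then have wC: "w \<notin> C" by auto
    have wR: "- R < w" "w < R" using LR w by auto
    define a where "a = Sup (C \<inter> {..w})"
    define b where "b = Inf (C \<inter> {w..})"
    have a: "a \<in> C \<inter> {..w}" unfolding a_def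
      using R wR \<open>closed C\<close> by (intro closed_contains_Sup) (auto simp: intro: less_imp_le)
    have b: "b \<in> C \<inter> {w..}" unfolding b_def
      using R wR \<open>closed C\<close> by (intro closed_contains_Inf) (auto simp: intro: less_imp_le)
    have aw: "x \<le> a" if "x \<in> C" "x \<le> w" for x
      unfolding a_def using that by (intro cSup_upper) auto
    have bw: "b \<le> x" if "x \<in> C" "w \<le> x" for x
      unfolding b_def using that by (intro cInf_lower) auto
    show ?thesis
    proof (rule that[of a b])
      show "{a<..<b} \<inter> C = {}"
        using aw bw by (force simp: disjoint_iff not_less[symmetric])
      fix u assume u: "0 \<le> u" "L u \<inter> C = {}"
      \<comment> \<open>\<open>L m\<close> is the larger of the two superlevel sets: it avoids
        \<open>C\<close> and contains \<open>w\<close>, so as an interval it cannot reach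
        \<open>a\<close> or \<open>b\<close>.\<close>
      define m where "m = min u u0"
      have m: "L m \<inter> C = {}" "w \<in> L m" "L u \<subseteq> L m"
        using u w by (auto simp: m_def min_def L_def)
      show "L u \<subseteq> {a..b}"
      proof
        fix x assume "x \<in> L u"
        then have x: "x \<in> L m" using m by auto
        have "a \<notin> L m" "b \<notin> L m" using a b m by auto
        then have "\<not> x \<le> a" "\<not> b \<le> x"
          using Lint[OF x m(2), of a] Lint[OF m(2) x, of b] a b by auto
        then show "x \<in> {a..b}" by simp
      qed
    qed (use a b in auto)
  qed
  have "emeasure (density lborel f) F \<le> emeasure (density lborel f) (F \<inter> {a..b})
      + ennreal l * emeasure (density lborel f) (- C - {a..b})"
  proof (rule emeasure_density_add_le)
    fix u :: real assume u: "0 \<le> u"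
    have "emeasure lborel (F \<inter> L u) \<le> emeasure lborel (F \<inter> {a..b} \<inter> L u)
        + ennreal l * emeasure lborel ((- C - {a..b}) \<inter> L u)"
    proof (cases "L u \<inter> C = {}")
      case True
      then have "emeasure lborel (F \<inter> L u) \<le> emeasure lborel (F \<inter> {a..b} \<inter> L u)"
        using gap[OF u True] by (intro emeasure_mono) (blast, measurable)
      then show ?thesis by (intro add_increasing2 zero_le)
    next
      case False
      show ?thesis
        by (rule sparse_interval[OF \<open>closed C\<close> \<open>F \<in> sets borel\<close> _ \<open>F \<inter> C = {}\<close> sp ab(1-3) _ bddL[OF u] False \<open>0 \<le> l\<close>])
          (measurable, rule Lint)
    qed
    then show "emeasure lborel (F \<inter> {x. u < f x}) \<le> emeasure lborel (F \<inter> {a..b} \<inter> {x. u < f x})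
        + ennreal l * emeasure lborel ((- C - {a..b}) \<inter> {x. u < f x})"
      by (simp add: L_def)
  qed (use nonneg in auto)
  with ab show thesis by (intro that)
qed

text \<open>\<open>T\<close> stands for the tail of the measure before smoothing and
  \<open>N\<close> for the smoothed measure: quasiconcavity is known for the density of
  \<open>N\<close>, the power mean inequality for \<open>T\<close>. Rearrangement produces a bound
  that depends on an unknown \<open>x\<close>; by \<open>pmean_slope_le\<close> it is largest at
  \<open>x = z\<close>, and homogeneity extracts the factor \<open>T z\<close>.\<close>

lemma density_tail_bound:
  fixes f T :: "real \<Rightarrow> real"
  defines "N \<equiv> density lborel f"
  assumes fb[measurable]: "f \<in> borel_measurable borel" and Fb[measurable]: "F \<in> sets borel" and nonneg: "\<And>x. 0 \<le> f x"
    and qc: "quasiconcave f" and N: "finite_measure N" and T: "antimono T" and T0: "\<And>c. 0 \<le> T c"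
    and close: "\<And>c. \<bar>measure N {c..} - T c\<bar> \<le> w"
    and tail: "\<And>b x. x \<le> b \<Longrightarrow> 0 < T b \<Longrightarrow> pmean s l (T b) (T x) \<le> T (l * b + (1 - l) * x)"
    and zb: "z \<le> b" and l: "0 < l" "l < 1" and s: "s \<le> 1"
    and sp: "sparse_near l F C" and "b \<in> C" and th: "0 < th" "T b = th * T z"
  shows "measure N (F \<inter> {z..b}) \<le> T z * (1 - pmean s l th 1) + 4 * w"
proof -
  interpret finite_measure N by (rule N)
  have setsN: "sets N = sets borel" by (simp add: N_def)
  have w: "0 \<le> w" using close[of 0] by linarith
  have sng: "measure N {c} = 0" for c
  proof -
    have "emeasure N {c} = (\<integral>\<^sup>+x. ennreal (f x) * indicator {c} x \<partial>lborel)"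
      unfolding N_def by (subst emeasure_density) auto
    also have "\<dots> = 0" by (intro nn_integral_null_set) auto
    finally show ?thesis by (simp add: measure_def)
  qed
  \<comment> \<open>Each end of an interval costs \<open>w\<close>; two intervals are used, whence
    \<open>4 * w\<close>.\<close>
  have ivl: "measure N {c..d} \<le> T c - T d + 2 * w" if "c \<le> d" for c d
  proof -
    have "{c..d} = {c..<d} \<union> {d}" using that by auto
    then have "measure N {c..d} \<le> measure N {c..<d} + measure N {d}"
      using measure_Un_le[of "{c..<d}" N "{d}"] by (simp only: setsN) simp
    moreover have "measure N {c..<d} = measure N {c..} - measure N {d..}"
    proof -
      have "{c..<d} = {c..} - {d..}" by auto
      then show ?thesis using that by (simp add: finite_measure_Diff setsN)
    qed
    ultimately show ?thesis using close[of c] close[of d] sng[of d] by linarith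
  qed
  have Tle: "T y \<le> T x" if "x \<le> y" for x y using T that by (simp add: antimono_def)
  show ?thesis
  proof (cases "0 < T b")
    case False
    then have "T z = 0" using T0[of b] th by simp
    have "measure N (F \<inter> {z..b}) \<le> measure N {z..}"
      by (intro finite_measure_mono) (auto simp: setsN)
    then show ?thesis using close[of z] \<open>T z = 0\<close> w by simp
  next
    case True
    obtain x where x: "z \<le> x" "x \<le> b"
      and le: "emeasure N (F \<inter> {z..b}) \<le> emeasure N {x..l * b + (1 - l) * x} + ennreal l * emeasure N {z..x}"
      unfolding N_def using quasiconcave_rearrange[OF fb Fb nonneg qc zb l, of thesis]
        sparse_nearD[OF sp _ order_refl \<open>b \<in> C\<close>] by auto
    have "measure N (F \<inter> {z..b}) \<le> measure N {x..l * b + (1 - l) * x} + l * measure N {z..x}"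
      using le l by (simp add: emeasure_eq_measure ennreal_mult[symmetric] ennreal_plus[symmetric] del: ennreal_plus)
    also have "measure N {x..l * b + (1 - l) * x} \<le> T x - T (l * b + (1 - l) * x) + 2 * w"
    proof (rule ivl)
      have "l * b + (1 - l) * x = x + l * (b - x)" by (simp add: algebra_simps)
      then show "x \<le> l * b + (1 - l) * x" using x l by simp
    qed
    also have "T x - T (l * b + (1 - l) * x) + 2 * w \<le> T x - pmean s l (T b) (T x) + 2 * w"
      using tail[OF x(2) True] by simp
    also have "l * measure N {z..x} \<le> l * (T z - T x + 2 * w)"
      using ivl[OF x(1)] l by (intro mult_left_mono) auto
    also have "\<dots> \<le> l * (T z - T x) + 2 * w"
      using l w mult_right_mono[of l 1 w] by (simp add: algebra_simps)
    finally have 1: "measure N (F \<inter> {z..b}) \<le> T x - pmean s l (T b) (T x) + l * (T z - T x) + 4 * w"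
      by simp
    have 2: "pmean s l (T b) (T z) - pmean s l (T b) (T x) \<le> (1 - l) * (T z - T x)"
      using True x l s by (intro pmean_slope_le Tle) auto
    have "0 < T z" using True Tle[OF zb] by linarith
    then have "pmean s l (T b) (T z) = T z * pmean s l th 1"
      using pmean_scale[of "T z" th 1 l s] th l by (simp add: mult.commute)
    then show ?thesis using 1 2 by (simp add: algebra_simps)
  qed
qed

section \<open>Reflection, and the bound for both halves of a gap\<close>

lemma emeasure_lborel_uminus:
  fixes S :: "real set"
  assumes [measurable]: "S \<in> sets borel"
  shows "emeasure lborel (uminus -` S) = emeasure lborel S"
proof -
  have "emeasure lborel S = emeasure (distr lborel borel uminus) S"
    by (simp add: lborel_distr_uminus)
  also have "\<dots> = emeasure lborel (uminus -` S)"
    by (subst emeasure_distr) auto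
  finally show ?thesis by simp
qed

lemma emeasure_density_uminus:
  fixes f :: "real \<Rightarrow> real"
  assumes [measurable]: "f \<in> borel_measurable borel" "S \<in> sets borel"
  shows "emeasure (density lborel (\<lambda>x. f (- x))) S = emeasure (density lborel f) (uminus -` S)"
proof -
  have [measurable]: "uminus -` S \<in> sets borel"
    using measurable_sets[of uminus borel borel S] by simp
  have "emeasure (density lborel f) (uminus -` S) = (\<integral>\<^sup>+x. ennreal (f x) * indicator S (- x) \<partial>lborel)"
    by (subst emeasure_density) (auto intro!: nn_integral_cong split: split_indicator)
  also have "\<dots> = (\<integral>\<^sup>+x. ennreal (f x) * indicator S (- x) \<partial>distr lborel borel uminus)"
    by (simp add: lborel_distr_uminus)
  also have "\<dots> = (\<integral>\<^sup>+x. ennreal (f (- x)) * indicator S x \<partial>lborel)"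
    by (subst nn_integral_distr) auto
  also have "\<dots> = emeasure (density lborel (\<lambda>x. f (- x))) S"
    by (subst emeasure_density) auto
  finally show ?thesis by simp
qed

lemma sparse_near_uminus:
  assumes "sparse_near l F C" "F \<in> sets borel"
  shows "sparse_near l (uminus -` F) (uminus -` C)"
  unfolding sparse_near_def
proof (intro ballI allI impI)
  fix c p q :: real assume "c \<in> uminus -` C" "p \<le> c" "c \<le> q"
  then have "emeasure lborel (F \<inter> {-q..-p}) \<le> ennreal (l * (- p - - q))"
    by (intro sparse_nearD[OF assms(1), of _ "- c"]) auto
  moreover have "uminus -` (F \<inter> {-q..-p}) = uminus -` F \<inter> {p..q}" by auto
  moreover have "F \<inter> {-q..-p} \<in> sets borel" using assms by simp
  ultimately show "emeasure lborel (uminus -` F \<inter> {p..q}) \<le> ennreal (l * (q - p))"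
    using emeasure_lborel_uminus[of "F \<inter> {-q..-p}"] by (simp del: vimage_Int)
qed

text \<open>Let \<open>t\<close> be the mass outside the gap as measured by \<open>T\<close>, and
  \<open>K = pmean s l t 1\<close>. Inside the gap the two tail bounds add up to
  \<open>1 - K\<close>, with error \<open>8 * w\<close>. Outside, \<open>F\<close> gets at most the
  fraction \<open>l\<close> of the mass not in \<open>C\<close>, and \<open>pmean_slope_ge\<close>
  turns this into a difference of means in which \<open>K\<close> cancels.\<close>

lemma density_sparse_bound:
  fixes f T :: "real \<Rightarrow> real"
  defines "N \<equiv> density lborel f"
  assumes fb[measurable]: "f \<in> borel_measurable borel" and Fb[measurable]: "F \<in> sets borel" and nonneg: "\<And>x. 0 \<le> f x"
    and qc: "quasiconcave f" and N: "prob_space N" and T: "antimono T" "continuous_on UNIV T"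
    and T01: "\<And>c. 0 \<le> T c" "\<And>c. T c \<le> 1"
    and close: "\<And>c. \<bar>measure N {c..} - T c\<bar> \<le> w"
    and tail: "\<And>b x. x \<le> b \<Longrightarrow> 0 < T b \<Longrightarrow> pmean s l (T b) (T x) \<le> T (l * b + (1 - l) * x)"
    and tail': "\<And>a x. a \<le> x \<Longrightarrow> T a < 1 \<Longrightarrow> pmean s l (1 - T a) (1 - T x) \<le> 1 - T (l * a + (1 - l) * x)"
    and l: "0 < l" "l < 1" and s: "s \<le> 1"
    and C: "closed C" "F \<inter> C = {}" and sp: "sparse_near l F C"
    and R: "- R \<in> C" "R \<in> C" and out: "\<And>x. x \<le> - R \<or> R \<le> x \<Longrightarrow> f x = 0"
    and th: "th \<le> measure N C" "2 * w < th"
  shows "measure N F \<le> 1 - pmean s l (th - 2 * w) 1 + 8 * w"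
proof -
  interpret prob_space N by (rule N)
  have setsN: "sets N = sets borel" by (simp add: N_def)
  have spaceN: "space N = UNIV" by (simp add: N_def)
  have [measurable]: "C \<in> sets borel" using C by auto
  have w: "0 \<le> w" using close[of 0] by linarith
  have sng: "measure N {c} = 0" for c
  proof -
    have "emeasure N {c} = (\<integral>\<^sup>+x. ennreal (f x) * indicator {c} x \<partial>lborel)"
      unfolding N_def by (subst emeasure_density) auto
    also have "\<dots> = 0" by (intro nn_integral_null_set) auto
    finally show ?thesis by (simp add: measure_def)
  qed
  have Tle: "T y \<le> T x" if "x \<le> y" for x y using T that by (simp add: antimono_def)
  obtain a b where ab: "a \<in> C" "b \<in> C" "a \<le> b" "{a<..<b} \<inter> C = {}"
    and gap: "emeasure N F \<le> emeasure N (F \<inter> {a..b}) + ennreal l * emeasure N (- C - {a..b})"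
    unfolding N_def using sparse_density_gap[OF fb Fb nonneg qc C sp _ R out, of thesis] l by auto
  define t where "t = 1 - (T a - T b)"
  define K where "K = pmean s l t 1"
  have gapm: "measure N {a<..<b} \<ge> T a - T b - 2 * w"
  proof -
    have "{a..} = {a} \<union> {a<..<b} \<union> {b..}" using \<open>a \<le> b\<close> by auto
    then have "measure N {a..} \<le> measure N {a} + measure N {a<..<b} + measure N {b..}"
      using measure_Un_le[of "{a} \<union> {a<..<b}" N "{b..}"] measure_Un_le[of "{a}" N "{a<..<b}"]
      by (simp add: setsN)
    then show ?thesis using close[of a] close[of b] sng[of a] by linarith
  qed
  have CJ: "measure N C + measure N {a<..<b} + measure N (- C - {a..b}) \<le> 1"
  proof -
    have "measure N (C \<union> {a<..<b}) = measure N C + measure N {a<..<b}"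
      using ab(4) by (intro finite_measure_Union) (auto simp: setsN)
    moreover have "measure N ((C \<union> {a<..<b}) \<union> (- C - {a..b})) = measure N (C \<union> {a<..<b}) + measure N (- C - {a..b})"
      by (intro finite_measure_Union) (auto simp: setsN)
    ultimately show ?thesis using prob_le_1[of "(C \<union> {a<..<b}) \<union> (- C - {a..b})"] by linarith
  qed
  then have tw: "th - 2 * w \<le> t"
    using gapm th(1) measure_nonneg[of N "- C - {a..b}"] unfolding t_def by linarith
  then have t0: "0 < t" using th w by linarith
  have t1: "t \<le> 1" using Tle[OF \<open>a \<le> b\<close>] by (simp add: t_def)
  have "measure N F \<le> measure N (F \<inter> {a..b}) + l * measure N (- C - {a..b})"
    using gap l by (simp add: emeasure_eq_measure ennreal_mult[symmetric] ennreal_plus[symmetric] del: ennreal_plus)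
  also have "l * measure N (- C - {a..b}) \<le> l * (t - (th - 2 * w))"
    using CJ gapm th(1) l unfolding t_def by (intro mult_left_mono) auto
  also have "\<dots> \<le> K - pmean s l (th - 2 * w) 1"
    unfolding K_def using tw t1 th l s by (intro pmean_slope_ge) auto
  also have "measure N (F \<inter> {a..b}) \<le> 1 - K + 8 * w"
  proof -
    \<comment> \<open>If \<open>T b = t * T z\<close>, the definition of \<open>t\<close> gives
      \<open>1 - T a = t * (1 - T z)\<close>. Both halves then have the same factor
      \<open>1 - K\<close>, and their weights \<open>T z\<close> and \<open>1 - T z\<close> add up
      to 1.\<close>
    have "\<exists>z\<ge>a. z \<le> b \<and> t * T z = T b"
    proof (rule IVT2')
      \<comment> \<open>This product equals \<open>t * T a - T b\<close>.\<close>
      have "0 \<le> (1 - T a) * (T a - T b)" using T01 Tle[OF \<open>a \<le> b\<close>] by simp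
      then show "T b \<le> t * T a" by (simp add: t_def algebra_simps)
      show "t * T b \<le> T b" using t1 T01[of b] by (simp add: mult_left_le_one_le t0 less_imp_le)
      show "continuous_on {a..b} (\<lambda>x. t * T x)"
        using continuous_on_subset[OF T(2)] by (intro continuous_intros) auto
    qed fact
    then obtain z where z: "a \<le> z" "z \<le> b" "T b = t * T z" by auto
    have right: "measure N (F \<inter> {z..b}) \<le> T z * (1 - K) + 4 * w"
      unfolding K_def N_def
      by (rule density_tail_bound[OF fb Fb nonneg qc _ T(1) T01(1) _ tail z(2) l s sp ab(2) t0 z(3)])
        (use close in \<open>auto simp flip: N_def intro: finite_measure_axioms\<close>)
    \<comment> \<open>The left half becomes a right half after reflection, with
      \<open>1 - T (- c)\<close> as the tail.\<close>
    define N' where "N' = density lborel (\<lambda>x. f (- x))"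
    have N': "emeasure N' S = emeasure N (uminus -` S)" if "S \<in> sets borel" for S
      using emeasure_density_uminus[OF fb that] by (simp add: N'_def N_def)
    have left: "measure N' ((uminus -` F) \<inter> {- z..- a}) \<le> (1 - T (- (- z))) * (1 - K) + 4 * w"
      unfolding K_def N'_def
    proof (rule density_tail_bound[where T = "\<lambda>c. 1 - T (- c)" and C = "uminus -` C"])
      show "uminus -` F \<in> sets borel"
        using measurable_sets[of uminus borel borel F] by simp
      show "quasiconcave (\<lambda>x. f (- x))"
        unfolding quasiconcave_def
      proof (intro allI impI)
        fix x y z :: real assume "x \<le> y" "y \<le> z"
        then show "min (f (- x)) (f (- z)) \<le> f (- y)"
          using qc[unfolded quasiconcave_def, rule_format, of "- z" "- y" "- x"] by (simp add: min.commute)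
      qed
      show "finite_measure (density lborel (\<lambda>x. ennreal (f (- x))))"
        using N'[of UNIV] finite_emeasure_space unfolding N'_def
        by (intro finite_measureI) (simp add: spaceN)
      show "antimono (\<lambda>c. 1 - T (- c))"
        using Tle by (intro antimonoI) simp
      show "\<bar>measure (density lborel (\<lambda>x. ennreal (f (- x)))) {c..} - (1 - T (- c))\<bar> \<le> w" for c
      proof -
        have "measure N' {c..} = measure N {..- c}"
          using N'[of "{c..}"] by (auto simp: measure_def vimage_def intro!: arg_cong[where f = "\<lambda>S. enn2real (emeasure N S)"])
        moreover have "measure N {..- c} = 1 - measure N {- c<..}"
        proof -
          have "{..- c} = space N - {- c<..}" by (auto simp: spaceN)
          then show ?thesis using prob_compl[of "{- c<..}"] by (simp add: setsN)
        qed
        moreover have "measure N {- c..} = measure N {- c<..}"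
        proof -
          have "{- c..} = {- c} \<union> {- c<..}" by auto
          then have "measure N {- c..} = measure N {- c} + measure N {- c<..}"
            using finite_measure_Union[of "{- c}" "{- c<..}"] by (simp add: setsN)
          then show ?thesis using sng by simp
        qed
        ultimately show ?thesis using close[of "- c"] unfolding N'_def by linarith
      qed
      show "pmean s l (1 - T (- b')) (1 - T (- x)) \<le> 1 - T (- (l * b' + (1 - l) * x))"
        if "x \<le> b'" "0 < 1 - T (- b')" for b' x
        using tail'[of "- b'" "- x"] that by (simp add: algebra_simps)
      show "sparse_near l (uminus -` F) (uminus -` C)"
        using sp by (rule sparse_near_uminus) simp
      show "1 - T (- (- a)) = t * (1 - T (- (- z)))"
        using z(3) by (simp add: t_def algebra_simps)
    qed (use nonneg T01 z l s t0 ab in auto)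
    have "measure N' ((uminus -` F) \<inter> {- z..- a}) = measure N (F \<inter> {a..z})"
    proof -
      have "uminus -` F \<in> sets borel"
        using measurable_sets[of uminus borel borel F] by simp
      then have "emeasure N' ((uminus -` F) \<inter> {- z..- a}) = emeasure N (uminus -` ((uminus -` F) \<inter> {- z..- a}))"
        by (intro N') auto
      also have "uminus -` ((uminus -` F) \<inter> {- z..- a}) = F \<inter> {a..z}" by auto
      finally show ?thesis by (simp add: measure_def)
    qed
    moreover have "F \<inter> {a..b} = (F \<inter> {a..z}) \<union> (F \<inter> {z..b})" using z by auto
    then have "measure N (F \<inter> {a..b}) \<le> measure N (F \<inter> {a..z}) + measure N (F \<inter> {z..b})"
      using measure_Un_le[of "F \<inter> {a..z}" N "F \<inter> {z..b}"] by (simp add: setsN)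
    ultimately show ?thesis using left right by (simp add: algebra_simps)
  qed
  finally show ?thesis by simp
qed

section \<open>The one-dimensional inequality\<close>

text \<open>The density is the convolution of \<open>\<nu>\<close> with the uniform distribution on
  \<open>{- h..0}\<close>: mass at \<open>y\<close> is spread evenly over \<open>{y - h..y}\<close>.
  Tonelli exchanges the integrations.\<close>

lemma emeasure_smoothed:
  fixes \<nu> :: "real measure"
  assumes "finite_measure \<nu>" and sets: "sets \<nu> = sets borel" and "0 < h" and S[measurable]: "S \<in> sets borel"
  shows "emeasure (density lborel (\<lambda>x. measure \<nu> {x..x + h} / h)) S
    = (\<integral>\<^sup>+y. emeasure lborel (S \<inter> {y - h..y}) / ennreal h \<partial>\<nu>)"
proof -
  interpret nu: finite_measure \<nu> by fact
  interpret P: pair_sigma_finite lborel \<nu> ..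
  note [measurable_cong] = sets
  let ?D = "{p. fst p \<in> S \<and> fst p \<le> snd p \<and> snd p \<le> fst p + h}"
  have [simp]: "space \<nu> = UNIV" using sets_eq_imp_space_eq[OF sets] by simp
  have m: "?D \<in> sets (lborel \<Otimes>\<^sub>M \<nu>)"
  proof -
    have "{p \<in> space (lborel \<Otimes>\<^sub>M \<nu>). fst p \<in> S \<and> fst p \<le> snd p \<and> snd p \<le> fst p + h} \<in> sets (lborel \<Otimes>\<^sub>M \<nu>)"
      by measurable
    then show ?thesis by (simp add: space_pair_measure)
  qed
  have 1: "emeasure \<nu> (Pair x -` ?D)
      = indicator S x * emeasure \<nu> {x..x + h}" for x
  proof -
    have "Pair x -` ?D = (if x \<in> S then {x..x + h} else {})"
      by auto
    then show ?thesis by simp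
  qed
  have [measurable]: "(\<lambda>x. measure \<nu> {x..x + h}) \<in> borel_measurable borel"
  proof -
    have "{p. fst p \<le> snd p \<and> snd p \<le> fst p + h} \<in> sets (borel \<Otimes>\<^sub>M \<nu>)"
    proof -
      have "{p \<in> space (borel \<Otimes>\<^sub>M \<nu>). fst p \<le> snd p \<and> snd p \<le> fst p + h} \<in> sets (borel \<Otimes>\<^sub>M \<nu>)"
        by measurable
      then show ?thesis by (simp add: space_pair_measure)
    qed
    then have "(\<lambda>x. emeasure \<nu> (Pair x -` {p. fst p \<le> snd p \<and> snd p \<le> fst p + h})) \<in> borel_measurable borel"
      by (rule nu.measurable_emeasure_Pair)
    moreover have "Pair x -` {p. fst p \<le> snd p \<and> snd p \<le> fst p + h} = {x..x + h}" for x :: real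
      by auto
    ultimately have "(\<lambda>x. emeasure \<nu> {x..x + h}) \<in> borel_measurable borel" by (simp only:)
    then show ?thesis by (simp add: measure_def)
  qed
  have "emeasure (density lborel (\<lambda>x. measure \<nu> {x..x + h} / h)) S
      = (\<integral>\<^sup>+x. inverse (ennreal h) * (indicator S x * emeasure \<nu> {x..x + h}) \<partial>lborel)"
    using \<open>0 < h\<close>
    by (subst emeasure_density) (auto intro!: nn_integral_cong split: split_indicator
      simp: nu.emeasure_eq_measure divide_ennreal[symmetric] divide_ennreal_def mult.commute)
  also have "\<dots> = inverse (ennreal h) * (\<integral>\<^sup>+x. (\<integral>\<^sup>+y. indicator ?D (x, y) \<partial>\<nu>) \<partial>lborel)"
  proof -
    have "(\<integral>\<^sup>+y. indicator ?D (x, y) \<partial>\<nu>)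
       = indicator S x * emeasure \<nu> {x..x + h}" for x
    proof -
      have "(\<integral>\<^sup>+y. indicator ?D (x, y) \<partial>\<nu>)
          = (\<integral>\<^sup>+y. indicator (Pair x -` ?D) y \<partial>\<nu>)"
        by (intro nn_integral_cong) (auto split: split_indicator)
      also have "\<dots> = emeasure \<nu> (Pair x -` ?D)"
        by (rule nn_integral_indicator[OF sets_Pair1[OF m]])
      finally show ?thesis using 1 by simp
    qed
    then show ?thesis by (subst nn_integral_cmult) (auto simp: nu.emeasure_eq_measure)
  qed
  also have "(\<integral>\<^sup>+x. (\<integral>\<^sup>+y. indicator ?D (x, y) \<partial>\<nu>) \<partial>lborel)
      = (\<integral>\<^sup>+y. (\<integral>\<^sup>+x. indicator ?D (x, y) \<partial>lborel) \<partial>\<nu>)"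
    by (rule P.Fubini'[symmetric]) (use m in \<open>simp add: case_prod_unfold\<close>)
  also have "\<dots> = (\<integral>\<^sup>+y. emeasure lborel (S \<inter> {y - h..y}) \<partial>\<nu>)"
  proof (rule nn_integral_cong)
    fix y
    have "(\<integral>\<^sup>+x. indicator ?D (x, y) \<partial>lborel)
        = (\<integral>\<^sup>+x. indicator (S \<inter> {y - h..y}) x \<partial>lborel)"
      by (intro nn_integral_cong) (auto split: split_indicator)
    also have "\<dots> = emeasure lborel (S \<inter> {y - h..y})"
      by (intro nn_integral_indicator) auto
    finally show "(\<integral>\<^sup>+x. indicator ?D (x, y) \<partial>lborel)
        = emeasure lborel (S \<inter> {y - h..y})" .
  qed
  also have "inverse (ennreal h) * \<dots> = (\<integral>\<^sup>+y. emeasure lborel (S \<inter> {y - h..y}) / ennreal h \<partial>\<nu>)"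
  proof -
    have "{p. snd p \<in> S \<and> fst p - h \<le> snd p \<and> snd p \<le> fst p} \<in> sets (\<nu> \<Otimes>\<^sub>M lborel)"
    proof -
      have "{p \<in> space (\<nu> \<Otimes>\<^sub>M lborel). snd p \<in> S \<and> fst p - h \<le> snd p \<and> snd p \<le> fst p} \<in> sets (\<nu> \<Otimes>\<^sub>M lborel)"
        by measurable
      then show ?thesis by (simp add: space_pair_measure)
    qed
    then have "(\<lambda>y. emeasure lborel (Pair y -` {p. snd p \<in> S \<and> fst p - h \<le> snd p \<and> snd p \<le> fst p})) \<in> borel_measurable \<nu>"
      by (rule lborel.measurable_emeasure_Pair)
    moreover have "Pair y -` {p. snd p \<in> S \<and> fst p - h \<le> snd p \<and> snd p \<le> fst p} = S \<inter> {y - h..y}" for y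
      by auto
    ultimately have "(\<lambda>y. emeasure lborel (S \<inter> {y - h..y})) \<in> borel_measurable \<nu>" by (simp only:)
    then show ?thesis
      by (subst nn_integral_cmult[symmetric]) (auto simp: divide_ennreal_def mult.commute)
  qed
  finally show ?thesis .
qed

lemma compact_shift:
  fixes F :: "real set"
  assumes "compact F"
  shows "compact {x. \<exists>y\<in>F. y - h \<le> x \<and> x \<le> y}"
proof -
  have "{x. \<exists>y\<in>F. y - h \<le> x \<and> x \<le> y} = (\<lambda>p. fst p - snd p) ` (F \<times> {0..h})"
  proof (intro set_eqI iffI)
    fix x assume "x \<in> {x. \<exists>y\<in>F. y - h \<le> x \<and> x \<le> y}"
    then obtain y where "y \<in> F" "y - h \<le> x" "x \<le> y" by auto
    then show "x \<in> (\<lambda>p. fst p - snd p) ` (F \<times> {0..h})"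
      by (intro image_eqI[of _ _ "(y, y - x)"]) auto
  next
    fix x assume "x \<in> (\<lambda>p. fst p - snd p) ` (F \<times> {0..h})"
    then obtain y v where "y \<in> F" "0 \<le> v" "v \<le> h" "x = y - v" by auto
    then show "x \<in> {x. \<exists>y\<in>F. y - h \<le> x \<and> x \<le> y}" by (intro CollectI bexI[of _ y]) auto
  qed
  moreover have "compact ((\<lambda>p. fst p - snd p) ` (F \<times> {0..h}))"
    using assms by (intro compact_continuous_image continuous_intros compact_Times) auto
  ultimately show ?thesis by simp
qed

text \<open>Concavity is assumed for intervals only, because that is what slabs of a convex needle
  provide. Applied to windows of length \<open>h\<close> it says that the averaged density is
  quasiconcave. The margin \<open>\<eta>\<close> leaves room for the spreading caused by the
  averaging.\<close>

lemma sparse_bound_interval_concave: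
  fixes \<nu> :: "real measure"
  assumes prob: "prob_space \<nu>" and sets: "sets \<nu> = sets borel"
    and conc: "\<And>k p1 q1 p2 q2. 0 \<le> k \<Longrightarrow> k \<le> 1 \<Longrightarrow> p1 \<le> q1 \<Longrightarrow> p2 \<le> q2 \<Longrightarrow>
      0 < measure \<nu> {p1..q1} \<Longrightarrow> 0 < measure \<nu> {p2..q2} \<Longrightarrow>
      pmean s k (measure \<nu> {p1..q1}) (measure \<nu> {p2..q2})
        \<le> measure \<nu> {k * p1 + (1 - k) * p2..k * q1 + (1 - k) * q2}"
    and atom: "\<And>c. measure \<nu> {c} = 0" and bdd: "measure \<nu> {- R..R} = 1"
    and C: "compact C" and F: "compact F" and \<eta>: "0 < \<eta>"
    and sp: "sparse_near l {x. infdist x F \<le> \<eta>} {x. infdist x C \<le> \<eta>}"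
    and l: "0 < l" "l < 1" and s: "s \<le> 1" and th: "0 < measure \<nu> C" and "F \<noteq> {}"
  shows "measure \<nu> F \<le> 1 - pmean s l (measure \<nu> C) 1"
proof -
  interpret prob_space \<nu> by (rule prob)
  note [measurable_cong] = sets
  have space: "space \<nu> = UNIV" using sets_eq_imp_space_eq[OF sets] by simp
  have C0: "C \<noteq> {}" using th by auto
  define T where "T x = measure \<nu> {x..}" for x
  have Tle: "T y \<le> T x" if "x \<le> y" for x y
    unfolding T_def using that by (intro finite_measure_mono) (auto simp: sets)
  have T01: "0 \<le> T x" "T x \<le> 1" for x by (auto simp: T_def)
  have TI: "1 - T x = measure \<nu> {..x}" for x
  proof -
    have "measure \<nu> ({..x} \<union> {x<..}) = measure \<nu> {..x} + measure \<nu> {x<..}"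
      by (intro finite_measure_Union) (auto simp: sets)
    moreover have "{..x} \<union> {x<..} = space \<nu>" by (auto simp: space)
    moreover have "measure \<nu> ({x} \<union> {x<..}) = measure \<nu> {x} + measure \<nu> {x<..}"
      by (intro finite_measure_Union) (auto simp: sets)
    moreover have "{x} \<union> {x<..} = {x..}" by auto
    ultimately show ?thesis using atom prob_space by (simp add: T_def)
  qed
  have ivl: "measure \<nu> {x..y} = T x - T y" if "x \<le> y" for x y
  proof -
    have "measure \<nu> ({x..y} \<union> {y<..}) = measure \<nu> {x..y} + measure \<nu> {y<..}"
      by (intro finite_measure_Union) (auto simp: sets)
    moreover have "{x..y} \<union> {y<..} = {x..}" using that by auto
    moreover have "measure \<nu> ({y} \<union> {y<..}) = measure \<nu> {y} + measure \<nu> {y<..}"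
      by (intro finite_measure_Union) (auto simp: sets)
    moreover have "{y} \<union> {y<..} = {y..}" by auto
    ultimately show ?thesis using atom by (simp add: T_def)
  qed
  have T_hi: "T x = 0" if "R \<le> x" for x
  proof -
    have "measure \<nu> {- R..R} \<le> measure \<nu> {..R}" by (intro finite_measure_mono) (auto simp: sets)
    then have "T R \<le> 0" using TI[of R] bdd by simp
    then show ?thesis using Tle[OF that] T01(1)[of x] by simp
  qed
  have T_lo: "T x = 1" if "x \<le> - R" for x
  proof -
    have "measure \<nu> {- R..R} \<le> measure \<nu> {- R..}" by (intro finite_measure_mono) (auto simp: sets)
    then have "1 \<le> T (- R)" using bdd by (simp add: T_def)
    then show ?thesis using Tle[OF that] T01(2)[of x] by simp
  qed
  interpret finite_borel_measure \<nu> by standard (rule sets)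
  have Tcdf: "T = (\<lambda>x. 1 - cdf \<nu> x)" using TI by (auto simp: cdf_def2 algebra_simps)
  have Tcont: "continuous_on UNIV T"
    unfolding Tcdf using isCont_cdf atom by (intro continuous_intros continuous_at_imp_continuous_on) auto
  \<comment> \<open>Where it is positive, the tail at \<open>b\<close> is the mass of
    \<open>{b..R}\<close>, so the interval inequality applies to two intervals with the common end
    \<open>R\<close>.\<close>
  have tail: "pmean s l (T b) (T x) \<le> T (l * b + (1 - l) * x)" if "x \<le> b" "0 < T b" for b x
  proof -
    have "b \<le> R" using T_hi[of b] that by (cases "R \<le> b") auto
    moreover have "0 < T x" using that Tle[of x b] by simp
    moreover have "l * R + (1 - l) * R = R" by (simp add: algebra_simps)
    moreover have "l * b + (1 - l) * x \<le> R"
      using convex_bound_le[of b R x l "1 - l"] that l \<open>b \<le> R\<close> by simp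
    ultimately show ?thesis
      using conc[of l b R x R] that l T_hi[of R] by (simp add: ivl)
  qed
  have tail': "pmean s l (1 - T a) (1 - T x) \<le> 1 - T (l * a + (1 - l) * x)" if "a \<le> x" "T a < 1" for a x
  proof -
    have "- R \<le> a" using T_lo[of a] that by (cases "a \<le> - R") auto
    moreover have "T x < 1" using that Tle[of a x] by simp
    moreover have "l * (- R) + (1 - l) * (- R) = - R" by (simp add: algebra_simps)
    moreover have "- R \<le> l * a + (1 - l) * x"
      using convex_bound_le[of "- a" R "- x" l "1 - l"] that l \<open>- R \<le> a\<close> by simp
    ultimately show ?thesis
      using conc[of l "- R" a "- R" x] that l T_lo[of "- R"] by (simp add: ivl)
  qed
  have main: "measure \<nu> F \<le> 1 - pmean s l (measure \<nu> C - 2 * w) 1 + 8 * w"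
    if w: "0 < w" "2 * w < measure \<nu> C" for w
  proof -
    have "uniformly_continuous_on {- R - 1..R + 1} T"
      using Tcont by (intro compact_uniformly_continuous) (auto intro: continuous_on_subset)
    then obtain d where d: "0 < d"
      "\<And>x x'. x \<in> {- R - 1..R + 1} \<Longrightarrow> x' \<in> {- R - 1..R + 1} \<Longrightarrow> dist x' x < d \<Longrightarrow> dist (T x') (T x) < w"
      using w(1) unfolding uniformly_continuous_on_def by metis
    \<comment> \<open>\<open>h \<le> \<eta>\<close> keeps the spread sets inside the thickenings,
      \<open>h < d\<close> changes tails by at most \<open>w\<close>, and \<open>h \<le> 1\<close>
      keeps \<open>x + h\<close> in the range of uniform continuity.\<close>
    define h where "h = min (min 1 \<eta>) (d / 2)"
    have h: "0 < h" "h \<le> 1" "h \<le> \<eta>" "h < d" using d \<eta> by (auto simp: h_def)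
    have Th: "T x - T (x + h) \<le> w" for x
    proof -
      consider "R \<le> x" | "x \<le> - R - 1" | "x \<in> {- R - 1..R + 1}" "x + h \<in> {- R - 1..R + 1}"
        using h by force
      then show ?thesis
      proof cases
        case 3
        then have "dist (T (x + h)) (T x) < w" using h by (intro d) (auto simp: dist_real_def)
        then show ?thesis by (simp add: dist_real_def)
      qed (use T_hi T_lo w h in auto)
    qed
    define f where "f x = measure \<nu> {x..x + h} / h" for x
    define N where "N = density lborel f"
    have f_eq: "f x = (T x - T (x + h)) / h" for x using ivl[of x "x + h"] h by (simp add: f_def)
    have fb[measurable]: "f \<in> borel_measurable borel"
    proof -
      have "continuous_on UNIV (\<lambda>x. T (x + h))"
        by (rule continuous_on_compose2[OF Tcont]) (auto intro: continuous_intros)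
      then have "continuous_on UNIV (\<lambda>x. (T x - T (x + h)) / h)"
        using Tcont h by (intro continuous_intros) auto
      then show ?thesis unfolding f_eq by (rule borel_measurable_continuous_onI)
    qed
    have f0: "0 \<le> f x" for x using h by (simp add: f_def)
    have N: "emeasure N S = (\<integral>\<^sup>+y. emeasure lborel (S \<inter> {y - h..y}) / ennreal h \<partial>\<nu>)" if "S \<in> sets borel" for S
      unfolding N_def f_def using that h sets by (intro emeasure_smoothed) (auto intro: finite_measure_axioms)
    have full: "emeasure lborel (S \<inter> {y - h..y}) / ennreal h = 1" if "{y - h..y} \<subseteq> S" for S y
    proof -
      have "S \<inter> {y - h..y} = {y - h..y}" using that by auto
      then show ?thesis using h by (simp add: divide_ennreal)
    qed
    have le1: "emeasure lborel (S \<inter> {y - h..y}) / ennreal h \<le> 1" if "S \<in> sets borel" for S y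
    proof -
      have "emeasure lborel (S \<inter> {y - h..y}) \<le> emeasure lborel {y - h..y}"
        by (intro emeasure_mono) auto
      then have "emeasure lborel (S \<inter> {y - h..y}) / ennreal h \<le> emeasure lborel {y - h..y} / ennreal h"
        by (rule divide_right_mono_ennreal)
      then show ?thesis using full[of y UNIV] by simp
    qed
    have ge: "emeasure \<nu> A \<le> emeasure N S"
      if "A \<in> sets borel" "S \<in> sets borel" "\<And>y. y \<in> A \<Longrightarrow> {y - h..y} \<subseteq> S" for A S
    proof -
      have "emeasure \<nu> A = (\<integral>\<^sup>+y. indicator A y \<partial>\<nu>)" using that sets by simp
      also have "\<dots> \<le> (\<integral>\<^sup>+y. emeasure lborel (S \<inter> {y - h..y}) / ennreal h \<partial>\<nu>)"
        using full that by (intro nn_integral_mono) (auto split: split_indicator)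
      finally show ?thesis using N that by simp
    qed
    have N1: "emeasure N UNIV = 1"
    proof -
      have "emeasure N UNIV = (\<integral>\<^sup>+y. 1 \<partial>\<nu>)"
        using N[of UNIV] full[of _ UNIV] by (simp del: Int_UNIV_left)
      then show ?thesis by (simp add: emeasure_space_1)
    qed
    have Np: "prob_space N" by (rule prob_spaceI) (use N1 in \<open>simp add: N_def\<close>)
    interpret N: prob_space N by (rule Np)
    have setsN: "sets N = sets borel" by (simp add: N_def)
    have gem: "measure \<nu> A \<le> measure N S"
      if "A \<in> sets borel" "S \<in> sets borel" "\<And>y. y \<in> A \<Longrightarrow> {y - h..y} \<subseteq> S" for A S
      using ge[OF that] by (simp add: emeasure_eq_measure N.emeasure_eq_measure)
    have close: "\<bar>measure N {c..} - T c\<bar> \<le> w" for c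
    proof -
      have "measure \<nu> {c + h..} \<le> measure N {c..}" by (intro gem) auto
      moreover have "emeasure N {c..} \<le> emeasure \<nu> {c..}"
      proof -
        have "emeasure lborel ({c..} \<inter> {y - h..y}) / ennreal h \<le> indicator {c..} y" for y
        proof (cases "c \<le> y")
          case False
          then have "{c..} \<inter> {y - h..y} = {}" by auto
          then show ?thesis by simp
        next
          case True
          then have "indicator {c..} y = (1 :: ennreal)" by simp
          then show ?thesis by (simp only:) (rule le1, simp)
        qed
        then have "(\<integral>\<^sup>+y. emeasure lborel ({c..} \<inter> {y - h..y}) / ennreal h \<partial>\<nu>)
            \<le> (\<integral>\<^sup>+y. indicator {c..} y \<partial>\<nu>)"
          by (rule nn_integral_mono)
        then have "emeasure N {c..} \<le> (\<integral>\<^sup>+y. indicator {c..} y \<partial>\<nu>)"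
          by (subst N) simp_all
        then show ?thesis by (simp add: sets)
      qed
      then have "measure N {c..} \<le> T c" by (simp add: emeasure_eq_measure N.emeasure_eq_measure T_def)
      ultimately show ?thesis using Th[of c] unfolding T_def by linarith
    qed
    have qc: "quasiconcave f"
      unfolding quasiconcave_def
    proof (intro allI impI)
      fix x y z :: real assume xyz: "x \<le> y" "y \<le> z"
      show "min (f x) (f z) \<le> f y"
      proof (cases "0 < measure \<nu> {x..x + h} \<and> 0 < measure \<nu> {z..z + h} \<and> x < z")
        case True
        define k where "k = (z - y) / (z - x)"
        have k: "0 \<le> k" "k \<le> 1" using xyz True by (auto simp: k_def)
        have ky: "k * x + (1 - k) * z = y"
        proof -
          have "k * (z - x) = z - y" using True by (simp add: k_def)
          then show ?thesis by (simp add: algebra_simps)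
        qed
        have "k * (x + h) + (1 - k) * (z + h) = k * x + (1 - k) * z + h" by (simp add: algebra_simps)
        then have "pmean s k (measure \<nu> {x..x + h}) (measure \<nu> {z..z + h}) \<le> measure \<nu> {y..y + h}"
          using conc[of k x "x + h" z "z + h"] True k h ky by simp
        moreover have "min (measure \<nu> {x..x + h}) (measure \<nu> {z..z + h})
            \<le> pmean s k (measure \<nu> {x..x + h}) (measure \<nu> {z..z + h})"
          using True k by (intro pmean_ge_min) auto
        ultimately have "min (measure \<nu> {x..x + h}) (measure \<nu> {z..z + h}) \<le> measure \<nu> {y..y + h}" by simp
        then show ?thesis using h by (simp add: f_def min_le_iff_disj divide_le_cancel)
      next
        case False
        show ?thesis
        proof (cases "x < z")
          case True
          then have "f x = 0 \<or> f z = 0"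
            using False by (auto simp: f_def zero_less_measure_iff)
          then show ?thesis using f0[of x] f0[of y] f0[of z] by (auto simp: min_def)
        next
          case False
          then have "x = y" "z = y" using xyz by auto
          then show ?thesis by simp
        qed
      qed
    qed
    \<comment> \<open>Spreading to the left by at most \<open>h\<close> makes the sets large enough
      to receive all the mass that smoothing moves away from \<open>F\<close> and
      \<open>C\<close>.\<close>
    define F' where "F' = {x. \<exists>y\<in>F. y - h \<le> x \<and> x \<le> y}"
    define C' where "C' = {x. \<exists>y\<in>C. y - h \<le> x \<and> x \<le> y}"
    have cF': "compact F'" and cC': "compact C'"
      unfolding F'_def C'_def using F C by (auto intro: compact_shift)
    have nearF: "infdist x F \<le> \<eta>" if "x \<in> F'" for x
    proof -
      obtain y where "y \<in> F" "y - h \<le> x" "x \<le> y" using \<open>x \<in> F'\<close> by (auto simp: F'_def)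
      then show ?thesis using infdist_le2[of y F x \<eta>] h by (simp add: dist_real_def)
    qed
    have nearC: "infdist x C \<le> \<eta>" if "x \<in> C'" for x
    proof -
      obtain y where "y \<in> C" "y - h \<le> x" "x \<le> y" using \<open>x \<in> C'\<close> by (auto simp: C'_def)
      then show ?thesis using infdist_le2[of y C x \<eta>] h by (simp add: dist_real_def)
    qed
    obtain r where r: "\<And>x. x \<in> F' \<union> C' \<Longrightarrow> \<bar>x\<bar> \<le> r" "0 < r"
    proof -
      have "bounded (F' \<union> C')" using cF' cC' by (simp add: compact_imp_bounded)
      then show ?thesis using that unfolding bounded_pos by (metis real_norm_def)
    qed
    define r' where "r' = r + \<bar>R\<bar> + 2"
    \<comment> \<open>The barriers \<open>R'\<close> and \<open>- R'\<close> are added to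
      \<open>C\<close> so that \<open>C\<close> has points on both sides of the support of
      \<open>f\<close>. An interval from a barrier to \<open>F'\<close> has length at least
      \<open>2 * r' / l\<close>, and \<open>F'\<close> fits into an interval of length
      \<open>2 * r'\<close>, so sparseness holds at the barriers too.\<close>
    define R' where "R' = r' + 2 * r' / l"
    have r': "\<bar>x\<bar> < r'" if "x \<in> F' \<union> C'" for x using r(1)[OF that] by (simp add: r'_def)
    have r'0: "0 < r'" "R + 2 \<le> r'" using r(2) by (auto simp: r'_def)
    have R': "r' < R'" using r'0 l by (simp add: R'_def)
    define C1 where "C1 = insert (- R') (insert R' C')"
    have far: "emeasure lborel (F' \<inter> {p..q}) \<le> ennreal (l * (q - p))"
      if c: "p \<le> c" "c \<le> q" "\<bar>c\<bar> = R'" for p q c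
    proof (cases "F' \<inter> {p..q} = {}")
      case False
      then obtain x where "x \<in> F'" "p \<le> x" "x \<le> q" by auto
      moreover from this have "\<bar>x\<bar> < r'" by (intro r') simp
      ultimately have "\<bar>x\<bar> < r'" "p \<le> x" "x \<le> q" by auto
      then have "R' - r' \<le> q - p" using c by (auto simp: abs_if split: if_splits)
      then have "2 * r' / l \<le> q - p" by (simp add: R'_def)
      then have "2 * r' \<le> l * (q - p)" using l by (simp add: field_simps)
      moreover have "emeasure lborel (F' \<inter> {p..q}) \<le> emeasure lborel {- r'..r'}"
      proof (rule emeasure_mono)
        show "F' \<inter> {p..q} \<subseteq> {- r'..r'}" using r' by (force simp: abs_less_iff)
      qed simp
      ultimately show ?thesis using r'0 by (simp add: order_trans[OF _ ennreal_leI])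
    qed simp
    have sp1: "sparse_near l F' C1"
      unfolding sparse_near_def
    proof (intro ballI allI impI)
      fix c p q assume c: "c \<in> C1" "p \<le> c" "c \<le> q"
      show "emeasure lborel (F' \<inter> {p..q}) \<le> ennreal (l * (q - p))"
      proof (cases "c \<in> C'")
        case False
        then have "\<bar>c\<bar> = R'" using c r'0 R' by (auto simp: C1_def)
        then show ?thesis using far c by blast
      next
        case True
        have "closed {x. infdist x F \<le> \<eta>}"
          by (intro closed_Collect_le continuous_intros)
        then have "emeasure lborel (F' \<inter> {p..q}) \<le> emeasure lborel ({x. infdist x F \<le> \<eta>} \<inter> {p..q})"
          using nearF by (intro emeasure_mono) auto
        also have "\<dots> \<le> ennreal (l * (q - p))"
          using sparse_nearD[OF sp c(2,3)] nearC[OF True] by simp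
        finally show ?thesis .
      qed
    qed
    \<comment> \<open>A common point lies in some \<open>{y - h..y}\<close> contained in the
      thickened \<open>F\<close>; sparseness there would give \<open>h \<le> l * h\<close>.\<close>
    have disj: "F' \<inter> C1 = {}"
    proof (rule ccontr)
      assume "F' \<inter> C1 \<noteq> {}"
      then obtain x where x: "x \<in> F'" "x \<in> C1" by auto
      then have "x \<in> C'" using r'[of x] R' r'0 by (auto simp: C1_def)
      obtain y where y: "y \<in> F" "y - h \<le> x" "x \<le> y" using x by (auto simp: F'_def)
      have "emeasure lborel ({x. infdist x F \<le> \<eta>} \<inter> {y - h..y}) \<le> ennreal (l * h)"
        using sparse_nearD[OF sp y(2,3)] nearC[OF \<open>x \<in> C'\<close>] by simp
      moreover have "{x. infdist x F \<le> \<eta>} \<inter> {y - h..y} = {y - h..y}"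
      proof -
        have "v \<in> F'" if "v \<in> {y - h..y}" for v using that y(1) by (auto simp: F'_def)
        then show ?thesis using nearF by blast
      qed
      ultimately have "h \<le> l * h" using h l by (simp add: ennreal_le_iff)
      then show False using h l by simp
    qed
    have "measure N F' \<le> 1 - pmean s l (measure \<nu> C - 2 * w) 1 + 8 * w"
      unfolding N_def
    proof (rule density_sparse_bound[where T = T and C = C1 and R = R'])
      show "closed C1" unfolding C1_def using cC' by (auto intro: compact_imp_closed)
      show "f x = 0" if "x \<le> - R' \<or> R' \<le> x" for x
        using that R' r'0 h T_hi[of x] T_hi[of "x + h"] T_lo[of x] T_lo[of "x + h"] by (auto simp: f_eq)
      have "measure \<nu> C \<le> measure N C1"
      proof (rule gem)
        show "C \<in> sets borel" using C by (simp add: borel_compact)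
        show "C1 \<in> sets borel" unfolding C1_def using cC' by (simp add: borel_compact)
        show "{y - h..y} \<subseteq> C1" if "y \<in> C" for y
          using that by (auto simp: C1_def C'_def)
      qed
      then show "measure \<nu> C \<le> measure (density lborel (\<lambda>x. ennreal (f x))) C1"
        by (simp add: N_def)
      show "F' \<in> sets borel" using cF' by (simp add: borel_compact)
    qed (use fb f0 qc Np Tle Tcont T01 close tail tail' l s disj sp1 w in
        \<open>auto simp: C1_def N_def intro: antimonoI\<close>)
    moreover have "measure \<nu> F \<le> measure N F'"
      using F cF' by (intro gem) (auto simp: borel_compact F'_def)
    ultimately show ?thesis by simp
  qed
  have "((\<lambda>w. 1 - pmean s l (measure \<nu> C - 2 * w) 1 + 8 * w) \<longlongrightarrow> 1 - pmean s l (measure \<nu> C - 2 * 0) 1 + 8 * 0) (at_right 0)"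
  proof -
    have c: "isCont (\<lambda>x. pmean s l x 1) (measure \<nu> C - 2 * 0)"
      using th l by (intro isCont_pmean_left) auto
    have "((\<lambda>w. measure \<nu> C - 2 * w) \<longlongrightarrow> measure \<nu> C - 2 * 0) (at_right 0)"
      by (intro tendsto_intros)
    then show ?thesis
      by (intro tendsto_intros isCont_tendsto_compose[OF c])
  qed
  moreover have "\<forall>\<^sub>F w in at_right 0. measure \<nu> F \<le> 1 - pmean s l (measure \<nu> C - 2 * w) 1 + 8 * w"
    unfolding eventually_at_right_field
    using th main by (intro exI[of _ "measure \<nu> C / 2"]) auto
  ultimately show ?thesis
    using tendsto_lowerbound[of _ _ "at_right (0::real)" "measure \<nu> F"] by fastforce
qed

section \<open>Localization to needles\<close>

text \<open>Suppose the zero set \<open>A\<close> and some set \<open>B n\<close>, where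
  \<open>g\<close> is bounded away from 0, both have positive mass. Shrinking \<open>B n\<close>
  towards \<open>A\<close> by the factor \<open>r ^ j\<close> multiplies \<open>g\<close> by
  \<open>r ^ j\<close> and keeps the mass at least \<open>\<delta>\<close>. The images lie in
  disjoint shells \<open>D j\<close>, impossible for a finite measure. It is applied to the distance
  from a point and, up to a factor, from a hyperplane.\<close>

lemma quasiconcave_measure_zero_one:
  fixes M :: "'a::euclidean_space measure"
  assumes "finite_measure M" and sets: "sets M = sets borel"
    and conc: "\<And>A B k. compact A \<Longrightarrow> compact B \<Longrightarrow> 0 < measure M A \<Longrightarrow> 0 < measure M B \<Longrightarrow> 0 \<le> k \<Longrightarrow> k \<le> 1 \<Longrightarrow>
      min (measure M A) (measure M B) \<le> measure M {k *\<^sub>R x + (1 - k) *\<^sub>R y | x y. x \<in> A \<and> y \<in> B}"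
    and K: "compact K" and g: "continuous_on UNIV g" "\<And>x. 0 \<le> g x"
    and hom: "\<And>x y k. g x = 0 \<Longrightarrow> 0 \<le> k \<Longrightarrow> k \<le> 1 \<Longrightarrow> g ((1 - k) *\<^sub>R x + k *\<^sub>R y) = k * g y"
  shows "measure M {x\<in>K. g x = (0::real)} = 0 \<or> measure M {x\<in>K. g x = 0} = measure M K"
proof (rule ccontr)
  interpret finite_measure M by fact
  define A where "A = {x\<in>K. g x = 0}"
  assume "\<not> ?thesis"
  then have neg: "measure M A \<noteq> 0" "measure M A \<noteq> measure M K" by (auto simp: A_def)
  have "closed {x. g x = 0}" by (intro closed_Collect_eq g continuous_on_const)
  then have A: "compact A"
    using compact_Int_closed[OF K] by (simp add: A_def Collect_conj_eq)
  define B where "B n = {x\<in>K. 1 / real (Suc n) \<le> g x}" for n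
  have "closed {x. 1 / real (Suc n) \<le> g x}" for n by (intro closed_Collect_le g continuous_on_const)
  then have B: "compact (B n)" for n
    using compact_Int_closed[OF K] by (simp add: B_def Collect_conj_eq)
  have inK: "K \<in> sets M" "A \<in> sets M" "\<And>n. B n \<in> sets M"
    using K A B by (auto simp: sets borel_compact)
  have "K - A = (\<Union>n. B n)"
  proof (intro set_eqI iffI)
    fix x assume "x \<in> K - A"
    then have "x \<in> K" "0 < g x" using g(2)[of x] by (auto simp: A_def)
    moreover from this obtain n where "1 / real (Suc n) < g x" using nat_approx_posE by blast
    ultimately show "x \<in> (\<Union>n. B n)" by (auto simp: B_def intro!: exI[of _ n])
  next
    fix x assume "x \<in> (\<Union>n. B n)"
    then obtain n where "x \<in> K" "1 / real (Suc n) \<le> g x" by (auto simp: B_def)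
    moreover have "0 < 1 / real (Suc n)" by simp
    ultimately show "x \<in> K - A" by (auto simp: A_def)
  qed
  moreover have "measure M (K - A) = measure M K - measure M A"
    using inK by (intro finite_measure_Diff) (auto simp: A_def)
  moreover have "measure M (\<Union>n. B n) = 0" if "\<And>n. measure M (B n) = 0"
  proof -
    have "(\<Union>n. B n) \<in> null_sets M"
      using that inK by (intro null_sets_UN) (auto simp: null_sets_def emeasure_eq_measure)
    then show ?thesis by (simp add: null_sets_def measure_def)
  qed
  ultimately obtain n where n: "measure M (B n) \<noteq> 0" using neg by auto
  define b1 where "b1 = 1 / real (Suc n)"
  have b1: "0 < b1" by (simp add: b1_def)
  obtain b2 where b2: "\<And>x. x \<in> B n \<Longrightarrow> g x \<le> b2" "b1 \<le> b2"
  proof -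
    have "bounded (g ` B n)"
      using compact_continuous_image[OF continuous_on_subset[OF g(1)] B] compact_imp_bounded by blast
    then obtain b where "\<And>x. x \<in> B n \<Longrightarrow> norm (g x) \<le> b" by (auto simp: bounded_iff)
    then show ?thesis by (intro that[of "max b b1"]) fastforce+
  qed
  \<comment> \<open>With \<open>r * b2 < b1\<close> every shell lies strictly below its
    predecessor.\<close>
  define r where "r = b1 / (2 * b2)"
  have r: "0 < r" "r \<le> 1" "r * b2 < b1" using b1 b2(2) by (auto simp: r_def field_simps)
  define D where "D j = {x. r ^ j * b1 \<le> g x \<and> g x \<le> r ^ j * b2}" for j :: nat
  have D: "closed (D j)" for j
    unfolding D_def Collect_conj_eq by (intro closed_Int closed_Collect_le g continuous_on_const)
  have "D i \<inter> D j = {}" if "i < j" for i j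
  proof -
    have "r ^ j \<le> r ^ Suc i" using that r by (intro power_decreasing) auto
    then have "r ^ j * b2 \<le> r ^ i * (r * b2)" using b1 b2(2) by (simp add: mult.assoc mult_right_mono flip: power_Suc2)
    also have "\<dots> < r ^ i * b1" using r by (intro mult_strict_left_mono) auto
    finally show ?thesis by (fastforce simp: D_def)
  qed
  then have disj: "disjoint_family D"
    unfolding disjoint_family_on_def by (metis Int_commute linorder_neqE_nat)
  have "summable (\<lambda>j. measure M (D j))"
    using finite_measure_UNION[of D] D disj by (intro sums_summable) (auto simp: sets image_subset_iff)
  then have lim: "(\<lambda>j. measure M (D j)) \<longlonglongrightarrow> 0" by (rule summable_LIMSEQ_zero)
  define \<delta> where "\<delta> = min (measure M (B n)) (measure M A)"
  have \<delta>: "0 < \<delta>" using n neg by (simp add: \<delta>_def zero_less_measure_iff)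
  have "\<delta> \<le> measure M (D j)" for j
  proof -
    have rj: "0 \<le> r ^ j" "r ^ j \<le> 1" using r by (auto intro: power_le_one)
    have "\<delta> \<le> measure M {r ^ j *\<^sub>R x + (1 - r ^ j) *\<^sub>R y | x y. x \<in> B n \<and> y \<in> A}"
      unfolding \<delta>_def using A B n neg rj by (intro conc) (auto simp: zero_less_measure_iff)
    also have "\<dots> \<le> measure M (D j)"
    proof (rule finite_measure_mono)
      show "{r ^ j *\<^sub>R x + (1 - r ^ j) *\<^sub>R y | x y. x \<in> B n \<and> y \<in> A} \<subseteq> D j"
      proof clarify
        fix x y assume xy: "x \<in> B n" "y \<in> A"
        then have "g (r ^ j *\<^sub>R x + (1 - r ^ j) *\<^sub>R y) = r ^ j * g x"
          using hom[of y "r ^ j" x] rj by (simp add: A_def add.commute)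
        moreover have "b1 \<le> g x" "g x \<le> b2" using xy b2 by (auto simp: B_def b1_def)
        ultimately show "r ^ j *\<^sub>R x + (1 - r ^ j) *\<^sub>R y \<in> D j"
          using rj by (auto simp: D_def intro: mult_left_mono)
      qed
    qed (use D in \<open>auto simp: sets\<close>)
    finally show ?thesis .
  qed
  then have "\<delta> \<le> 0" using lim by (intro LIMSEQ_le_const) auto
  then show False using \<delta> by simp
qed

lemma measure_Int_null_diff:
  assumes "finite_measure M" "S \<in> sets M" "K \<in> sets M" "K' \<in> sets M" "K' \<subseteq> K" "measure M K' = measure M K"
  shows "measure M (S \<inter> K') = measure M (S \<inter> K)"
proof -
  interpret finite_measure M by fact
  have "measure M (K - K') = 0" using assms by (simp add: finite_measure_Diff)
  moreover have "measure M (S \<inter> K) \<le> measure M (S \<inter> K') + measure M (K - K')"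
  proof -
    have "measure M (S \<inter> K) \<le> measure M ((S \<inter> K') \<union> (K - K'))"
      using assms by (intro finite_measure_mono) auto
    also have "\<dots> \<le> measure M (S \<inter> K') + measure M (K - K')"
      using assms by (intro measure_Un_le) auto
    finally show ?thesis .
  qed
  moreover have "measure M (S \<inter> K') \<le> measure M (S \<inter> K)"
    using assms by (intro finite_measure_mono) auto
  ultimately show ?thesis by simp
qed

section \<open>Bisection of convex bodies\<close>

definition hyperplane_dichotomy :: "'a::euclidean_space measure \<Rightarrow> bool" where
  "hyperplane_dichotomy M \<longleftrightarrow> (\<forall>K n c. compact K \<longrightarrow> convex K \<longrightarrow>
     measure M {x\<in>K. n \<bullet> x = c} = 0 \<or> measure M {x\<in>K. n \<bullet> x = c} = measure M K)"

text \<open>A violation of the inequality that survives bisection: the equality for \<open>C\<close>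
  can be kept in both halves by choice of the hyperplane, and the excess of \<open>F\<close> over
  \<open>\<kappa>\<close> then persists in one of them. Strictness of the excess forces
  \<open>K\<close> to have positive mass.\<close>

definition balanced :: "'a::euclidean_space measure \<Rightarrow> 'a set \<Rightarrow> 'a set \<Rightarrow> real \<Rightarrow> real \<Rightarrow> 'a set \<Rightarrow> bool" where
  "balanced M C F \<theta> \<kappa> K \<longleftrightarrow> compact K \<and> convex K \<and> measure M (C \<inter> K) = \<theta> * measure M K
     \<and> \<kappa> * measure M K < measure M (F \<inter> K)"

text \<open>Rotating a hyperplane about the codimension-two flat \<open>e1 \<bullet> x = p1\<close>, \<open>e2 \<bullet> x = p2\<close> through the
  angle \<open>pi\<close> interchanges the two half-spaces, so some position splits \<open>C\<close> and \<open>K\<close> in the same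
  proportion.\<close>

lemma balanced_bisect:
  fixes M :: "'a::euclidean_space measure"
  assumes "finite_measure M" and sets: "sets M = sets borel"
    and zero_one: "hyperplane_dichotomy M"
    and C: "C \<in> sets borel" and F: "F \<in> sets borel" and bal: "balanced M C F \<theta> \<kappa> K"
  obtains K' n1 n2 where "K' \<subseteq> K" "balanced M C F \<theta> \<kappa> K'" "n1 \<noteq> 0 \<or> n2 \<noteq> (0::real)"
    "\<And>x. x \<in> K' \<Longrightarrow> 0 \<le> n1 * (e1 \<bullet> x - p1) + n2 * (e2 \<bullet> x - p2)"
proof -
  interpret finite_measure M by fact
  have space: "space M = UNIV" using sets_eq_imp_space_eq[OF sets] by simp
  have K: "compact K" "convex K" and KC: "measure M (C \<inter> K) = \<theta> * measure M K"
    and KF: "\<kappa> * measure M K < measure M (F \<inter> K)"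
    using bal by (auto simp: balanced_def)
  define L where "L h x = cos h * (e1 \<bullet> x - p1) + sin h * (e2 \<bullet> x - p2)" for h x
  define n where "n h = cos h *\<^sub>R e1 + sin h *\<^sub>R e2" for h
  define c where "c h = cos h * p1 + sin h * p2" for h
  have L: "L h x = n h \<bullet> x - c h" for h x
    by (simp add: L_def n_def c_def algebra_simps)
  have cs: "cos h \<noteq> 0 \<or> sin h \<noteq> 0" for h :: real
    using sin_zero_abs_cos_one[of h] by auto
  define Z where "Z h = {x\<in>K. L h x = 0}" for h
  define P where "P h = {x\<in>K. 0 \<le> L h x}" for h
  define Q where "Q h = {x\<in>K. L h x \<le> 0}" for h
  have ZPQ: "Z h = K \<inter> {x. n h \<bullet> x = c h}" "P h = K \<inter> {x. c h \<le> n h \<bullet> x}" "Q h = K \<inter> {x. n h \<bullet> x \<le> c h}" for h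
    by (auto simp: Z_def P_def Q_def L)
  have cc: "compact (Z h)" "compact (P h)" "compact (Q h)" "convex (Z h)" "convex (P h)" "convex (Q h)" for h
    unfolding ZPQ using K convex_halfspace_ge[of "c h" "n h"] closed_halfspace_ge[of "c h" "n h"]
    by (auto intro!: compact_Int_closed convex_Int closed_hyperplane closed_halfspace_le convex_hyperplane convex_halfspace_le)
  have meas: "K \<in> sets M" "Z h \<in> sets M" "P h \<in> sets M" "Q h \<in> sets M" for h
    using K cc by (auto simp: sets borel_compact)
  show thesis
  proof (cases "\<exists>h. measure M (Z h) \<noteq> 0")
    case True
    \<comment> \<open>A hyperplane of positive mass in \<open>K\<close> carries all of it;
      \<open>K\<close> shrinks to that slice, on which the cutting function vanishes.\<close>
    then obtain h where "measure M (Z h) \<noteq> 0" by blast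
    then have full: "measure M (Z h) = measure M K"
      using zero_one K unfolding hyperplane_dichotomy_def by (auto simp: Z_def L)
    have "measure M (S \<inter> Z h) = measure M (S \<inter> K)" if "S \<in> sets borel" for S
      using that meas full by (intro measure_Int_null_diff) (auto simp: sets Z_def intro: finite_measure_axioms)
    then have "balanced M C F \<theta> \<kappa> (Z h)"
      using cc C F KC KF full by (simp add: balanced_def)
    then show ?thesis
      using cs[of h] by (intro that[of "Z h" "cos h" "sin h"]) (auto simp: Z_def L_def)
  next
    case False
    then have null: "Z h \<in> null_sets M" for h
      using meas by (auto simp: null_sets_def emeasure_eq_measure)
    have split: "measure M (S \<inter> K) = measure M (S \<inter> P h) + measure M (S \<inter> Q h)" if "S \<in> sets borel" for S h
    proof -
      have "measure M (S \<inter> K) = measure M ((S \<inter> P h) \<union> (S \<inter> Q h))"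
        by (rule arg_cong[where f = "measure M"]) (auto simp: P_def Q_def)
      also have "\<dots> = measure M (S \<inter> P h) + measure M (S \<inter> Q h)"
      proof (rule measure_Un_AE)
        show "AE x in M. x \<notin> S \<inter> P h \<or> x \<notin> S \<inter> Q h"
          by (rule AE_I'[OF null[of h]]) (auto simp: P_def Q_def Z_def)
      qed (use that meas in \<open>auto simp: sets fmeasurable_eq_sets\<close>)
      finally show ?thesis .
    qed
    \<comment> \<open>Away from the null hyperplane \<open>Z h\<close> the indicators are eventually
      constant, so dominated convergence applies.\<close>
    have cont: "isCont (\<lambda>h. measure M (S \<inter> P h)) h" if S: "S \<in> sets borel" for S h
      unfolding continuous_at_sequentially comp_def
    proof (intro allI impI)
      fix X :: "nat \<Rightarrow> real" assume X: "X \<longlonglongrightarrow> h"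
      have "(\<lambda>i. \<integral>x. indicat_real (S \<inter> P (X i)) x \<partial>M) \<longlonglongrightarrow> (\<integral>x. indicat_real (S \<inter> P h) x \<partial>M)"
      proof (rule integral_dominated_convergence[where w = "\<lambda>_. 1"])
        show "AE x in M. (\<lambda>i. indicat_real (S \<inter> P (X i)) x) \<longlonglongrightarrow> indicat_real (S \<inter> P h) x"
        proof (rule AE_I'[OF null[of h]], clarify, rule ccontr)
          fix x assume nl: "\<not> (\<lambda>i. indicat_real (S \<inter> P (X i)) x) \<longlonglongrightarrow> indicat_real (S \<inter> P h) x"
            and "x \<notin> Z h"
          have lim: "(\<lambda>i. L (X i) x) \<longlonglongrightarrow> L h x"
            unfolding L_def by (intro tendsto_intros X)
          consider "x \<notin> K" | "L h x < 0" | "0 < L h x" using \<open>x \<notin> Z h\<close> by (cases "L h x" "0::real" rule: linorder_cases) (auto simp: Z_def)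
          then have "\<forall>\<^sub>F i in sequentially. indicat_real (S \<inter> P (X i)) x = indicat_real (S \<inter> P h) x"
          proof cases
            case 2
            then show ?thesis
              using order_tendstoD(2)[OF lim, of 0] by (auto elim!: eventually_mono simp: P_def indicator_def)
          next
            case 3
            then show ?thesis
              using order_tendstoD(1)[OF lim, of 0] by (auto elim!: eventually_mono simp: P_def indicator_def)
          qed (simp add: P_def indicator_def)
          then have "(\<lambda>i. indicat_real (S \<inter> P (X i)) x) \<longlonglongrightarrow> indicat_real (S \<inter> P h) x"
            by (rule tendsto_eventually)
          with nl show False by (rule notE)
        qed
        show "indicat_real (S \<inter> P h) \<in> borel_measurable M"
          using S meas by (intro borel_measurable_indicator sets.Int) (simp_all add: sets)
        show "indicat_real (S \<inter> P (X i)) \<in> borel_measurable M" for i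
          using S meas by (intro borel_measurable_indicator sets.Int) (simp_all add: sets)
      qed (simp_all add: indicator_def)
      then show "(\<lambda>i. measure M (S \<inter> P (X i))) \<longlonglongrightarrow> measure M (S \<inter> P h)"
        by (simp add: space)
    qed
    define g where "g h = measure M (C \<inter> P h) - \<theta> * measure M (UNIV \<inter> P h)" for h
    have gc: "isCont g h" for h
      unfolding g_def using C by (intro continuous_intros cont) auto
    have "P pi = Q 0" by (auto simp: P_def Q_def L_def)
    then have "g pi = - g 0"
      using split[OF C, of 0] split[of UNIV 0] KC unfolding g_def by (simp add: algebra_simps)
    then have "\<exists>h. g h = 0"
      using IVT[of g 0 0 pi] IVT2[of g pi 0 0] gc by (cases "g 0 \<le> 0") auto
    then obtain h where h: "g h = 0" by blast
    have PC: "measure M (C \<inter> P h) = \<theta> * measure M (P h)" using h by (simp add: g_def)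
    have QC: "measure M (C \<inter> Q h) = \<theta> * measure M (Q h)"
      using PC split[OF C, of h] split[of UNIV h] KC by (simp add: algebra_simps)
    have "\<kappa> * measure M (P h) + \<kappa> * measure M (Q h) < measure M (F \<inter> P h) + measure M (F \<inter> Q h)"
      using KF split[OF F, of h] split[of UNIV h] by (simp add: algebra_simps)
    then consider "\<kappa> * measure M (P h) < measure M (F \<inter> P h)" | "\<kappa> * measure M (Q h) < measure M (F \<inter> Q h)"
      by linarith
    then show ?thesis
    proof cases
      case 1
      then have "balanced M C F \<theta> \<kappa> (P h)" using cc PC by (simp add: balanced_def)
      then show ?thesis using cs[of h] by (intro that[of "P h" "cos h" "sin h"]) (auto simp: P_def L_def)
    next
      case 2
      then have "balanced M C F \<theta> \<kappa> (Q h)" using cc QC by (simp add: balanced_def)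
      then show ?thesis using cs[of h] by (intro that[of "Q h" "- cos h" "- sin h"]) (auto simp: Q_def L_def)
    qed
  qed
qed

text \<open>Geometrically, the projection of \<open>K\<close> to the coordinates \<open>e1\<close>,
  \<open>e2\<close> lies on one side of a line through \<open>(p1, p2)\<close>. The data form one
  tuple so that finitely many cuts can be imposed by induction on a finite set.\<close>

definition cut_through :: "'a::euclidean_space set \<Rightarrow> 'a \<times> 'a \<times> real \<times> real \<Rightarrow> bool" where
  "cut_through K w \<longleftrightarrow> (case w of (e1, e2, p1, p2) \<Rightarrow> \<exists>n1 n2. (n1 \<noteq> 0 \<or> n2 \<noteq> 0) \<and>
     (\<forall>x\<in>K. 0 \<le> n1 * (e1 \<bullet> x - p1) + n2 * (e2 \<bullet> x - p2)))"

lemma cut_through_subset: "cut_through K w \<Longrightarrow> K' \<subseteq> K \<Longrightarrow> cut_through K' w"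
  unfolding cut_through_def by (cases w) (simp, meson subsetD)

text \<open>A cut persists in subsets, so cuts can be imposed one after another.\<close>

lemma balanced_bisect_finite:
  fixes M :: "'a::euclidean_space measure"
  assumes "finite_measure M" and sets: "sets M = sets borel"
    and zero_one: "hyperplane_dichotomy M"
    and C: "C \<in> sets borel" and F: "F \<in> sets borel" and bal: "balanced M C F \<theta> \<kappa> K" and "finite W"
  shows "\<exists>K'\<subseteq>K. balanced M C F \<theta> \<kappa> K' \<and> (\<forall>w\<in>W. cut_through K' w)"
  using \<open>finite W\<close>
proof (induction W)
  case empty
  show ?case using bal by (intro exI[of _ K]) simp
next
  case (insert w W)
  obtain K1 where K1: "K1 \<subseteq> K" "balanced M C F \<theta> \<kappa> K1" "\<forall>w\<in>W. cut_through K1 w"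
    using insert.IH by blast
  obtain e1 e2 p1 p2 where w: "w = (e1, e2, p1, p2)" by (cases w)
  obtain K' n1 n2 where K': "K' \<subseteq> K1" "balanced M C F \<theta> \<kappa> K'" "n1 \<noteq> 0 \<or> n2 \<noteq> (0::real)"
    "\<And>x. x \<in> K' \<Longrightarrow> 0 \<le> n1 * (e1 \<bullet> x - p1) + n2 * (e2 \<bullet> x - p2)"
    by (rule balanced_bisect[OF assms(1) sets zero_one C F K1(2), of e1 p1 e2 p2]) (erule (2) that, simp)
  have "cut_through K' w"
    unfolding cut_through_def w using K'(3,4) by (simp, intro exI[of _ n1] exI[of _ n2]) simp
  moreover have "\<forall>w\<in>W. cut_through K' w"
    using K1(3) cut_through_subset[OF _ K'(1)] by simp
  ultimately show ?case
    using K1(1) K' by (intro exI[of _ K']) simp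
qed

text \<open>\<open>D\<close> is twice the signed area of a triangle, and \<open>(p1, p2)\<close> is
  close to its centroid. Its barycentric coordinates differ from \<open>1 / 3\<close> by at most
  \<open>4 * R * \<eta> / \<bar>D\<bar>\<close>, whence the constant 12: for larger area the point
  is interior, and no line through it has all three vertices on one side.\<close>

lemma triangle_grid_small:
  fixes x1 x2 y1 y2 z1 z2 p1 p2 n1 n2 :: real
  defines "D \<equiv> (y1 - x1) * (z2 - x2) - (y2 - x2) * (z1 - x1)"
  assumes bd: "\<bar>x1\<bar> \<le> R" "\<bar>x2\<bar> \<le> R" "\<bar>y1\<bar> \<le> R" "\<bar>y2\<bar> \<le> R" "\<bar>z1\<bar> \<le> R" "\<bar>z2\<bar> \<le> R"
    and p: "\<bar>p1 - (x1 + y1 + z1) / 3\<bar> \<le> \<eta>" "\<bar>p2 - (x2 + y2 + z2) / 3\<bar> \<le> \<eta>"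
    and n: "n1 \<noteq> 0 \<or> n2 \<noteq> 0"
    and pos: "0 \<le> n1 * (x1 - p1) + n2 * (x2 - p2)" "0 \<le> n1 * (y1 - p1) + n2 * (y2 - p2)"
      "0 \<le> n1 * (z1 - p1) + n2 * (z2 - p2)"
  shows "\<bar>D\<bar> \<le> 12 * R * \<eta>"
proof (rule ccontr)
  assume "\<not> ?thesis"
  then have D: "12 * R * \<eta> < \<bar>D\<bar>" by simp
  have R\<eta>: "0 \<le> R" "0 \<le> \<eta>" using bd(1) p(1) by linarith+
  then have "0 < \<bar>D\<bar>" using D by (smt (verit) mult_nonneg_nonneg)
  then have D0: "D \<noteq> 0" by simp
  define w1 where "w1 = p1 - (x1 + y1 + z1) / 3"
  define w2 where "w2 = p2 - (x2 + y2 + z2) / 3"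
  \<comment> \<open>Barycentric coordinates of \<open>(p1, p2)\<close> by Cramer's rule, written as
    deviations from those of the centroid.\<close>
  define k1 where "k1 = 1 / 3 + (w1 * (y2 - z2) - w2 * (y1 - z1)) / D"
  define k2 where "k2 = 1 / 3 + (w1 * (z2 - x2) - w2 * (z1 - x1)) / D"
  define k3 where "k3 = 1 / 3 + (w1 * (x2 - y2) - w2 * (x1 - y1)) / D"
  have small: "\<bar>(w1 * (a - b) - w2 * (c - d)) / D\<bar> < 1 / 3"
    if "\<bar>a\<bar> \<le> R" "\<bar>b\<bar> \<le> R" "\<bar>c\<bar> \<le> R" "\<bar>d\<bar> \<le> R" for a b c d
  proof -
    have "\<bar>w1 * (a - b)\<bar> \<le> \<eta> * (2 * R)" "\<bar>w2 * (c - d)\<bar> \<le> \<eta> * (2 * R)"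
      unfolding abs_mult w1_def w2_def using that p R\<eta> by (intro mult_mono; simp)+
    then have "\<bar>w1 * (a - b) - w2 * (c - d)\<bar> \<le> 4 * R * \<eta>" by (simp add: abs_le_iff algebra_simps)
    also have "\<dots> < \<bar>D\<bar> / 3" using D by simp
    finally show ?thesis using \<open>0 < \<bar>D\<bar>\<close> by (simp add: abs_divide field_simps)
  qed
  have k: "0 < k1" "0 < k2" "0 < k3"
    unfolding k1_def k2_def k3_def
    using small[OF bd(4,6,3,5)] small[OF bd(6,2,5,1)] small[OF bd(2,4,1,3)]
    by (simp_all only: abs_less_iff) linarith+
  have bary: "k1 * x1 + k2 * y1 + k3 * z1 = p1" "k1 * x2 + k2 * y2 + k3 * z2 = p2" "k1 + k2 + k3 = 1"
  proof -
    have comb: "(1 / 3 + a / D) * x + (1 / 3 + b / D) * y + (1 / 3 + c / D) * z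
        = (x + y + z) / 3 + (a * x + b * y + c * z) / D" for a b c x y z
      by (simp add: add_divide_distrib distrib_right)
    have "(w1 * (y2 - z2) - w2 * (y1 - z1)) * x1 + (w1 * (z2 - x2) - w2 * (z1 - x1)) * y1
        + (w1 * (x2 - y2) - w2 * (x1 - y1)) * z1 = w1 * D"
      by (simp add: D_def algebra_simps)
    then have "((w1 * (y2 - z2) - w2 * (y1 - z1)) * x1 + (w1 * (z2 - x2) - w2 * (z1 - x1)) * y1
        + (w1 * (x2 - y2) - w2 * (x1 - y1)) * z1) / D = w1" using D0 by simp
    then have "k1 * x1 + k2 * y1 + k3 * z1 = (x1 + y1 + z1) / 3 + w1"
      unfolding k1_def k2_def k3_def comb by simp
    then show "k1 * x1 + k2 * y1 + k3 * z1 = p1" by (simp add: w1_def)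
    have "(w1 * (y2 - z2) - w2 * (y1 - z1)) * x2 + (w1 * (z2 - x2) - w2 * (z1 - x1)) * y2
        + (w1 * (x2 - y2) - w2 * (x1 - y1)) * z2 = w2 * D"
      by (simp add: D_def algebra_simps)
    then have "((w1 * (y2 - z2) - w2 * (y1 - z1)) * x2 + (w1 * (z2 - x2) - w2 * (z1 - x1)) * y2
        + (w1 * (x2 - y2) - w2 * (x1 - y1)) * z2) / D = w2" using D0 by simp
    then have "k1 * x2 + k2 * y2 + k3 * z2 = (x2 + y2 + z2) / 3 + w2"
      unfolding k1_def k2_def k3_def comb by simp
    then show "k1 * x2 + k2 * y2 + k3 * z2 = p2" by (simp add: w2_def)
    have "(w1 * (y2 - z2) - w2 * (y1 - z1)) + (w1 * (z2 - x2) - w2 * (z1 - x1))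
        + (w1 * (x2 - y2) - w2 * (x1 - y1)) = 0"
      by (simp add: algebra_simps)
    then have "(w1 * (y2 - z2) - w2 * (y1 - z1)) / D + (w1 * (z2 - x2) - w2 * (z1 - x1)) / D
        + (w1 * (x2 - y2) - w2 * (x1 - y1)) / D = 0" by (simp flip: add_divide_distrib)
    then show "k1 + k2 + k3 = 1" unfolding k1_def k2_def k3_def by simp
  qed
  \<comment> \<open>A combination of the nonnegative \<open>X\<close>, \<open>Y\<close>,
    \<open>Z\<close> with positive weights vanishes, so all three vanish and the vertices are
    collinear.\<close>
  define X where "X = n1 * (x1 - p1) + n2 * (x2 - p2)"
  define Y where "Y = n1 * (y1 - p1) + n2 * (y2 - p2)"
  define Z where "Z = n1 * (z1 - p1) + n2 * (z2 - p2)"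
  have "k1 * X + k2 * Y + k3 * Z = n1 * (k1 * x1 + k2 * y1 + k3 * z1 - (k1 + k2 + k3) * p1)
      + n2 * (k1 * x2 + k2 * y2 + k3 * z2 - (k1 + k2 + k3) * p2)"
    by (simp add: X_def Y_def Z_def algebra_simps)
  also have "\<dots> = 0" by (simp add: bary)
  finally have "k1 * X + k2 * Y + k3 * Z = 0" .
  moreover have "0 \<le> k1 * X" "0 \<le> k2 * Y" "0 \<le> k3 * Z"
    using k pos by (auto simp: X_def Y_def Z_def)
  ultimately have "k1 * X = 0" "k2 * Y = 0" "k3 * Z = 0" by linarith+
  then have XYZ: "X = 0" "Y = 0" "Z = 0" using k by auto
  have 1: "n1 * (y1 - x1) + n2 * (y2 - x2) = 0" "n1 * (z1 - x1) + n2 * (z2 - x2) = 0"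
    using XYZ by (simp_all add: X_def Y_def Z_def algebra_simps)
  have "n1 * D = (n1 * (y1 - x1) + n2 * (y2 - x2)) * (z2 - x2) - (n1 * (z1 - x1) + n2 * (z2 - x2)) * (y2 - x2)"
    "n2 * D = (n1 * (z1 - x1) + n2 * (z2 - x2)) * (y1 - x1) - (n1 * (y1 - x1) + n2 * (y2 - x2)) * (z1 - x1)"
    by (simp_all add: D_def algebra_simps)
  then show False using 1 D0 n by simp
qed

section \<open>Thin sets from small minors\<close>

lemma lagrange_identity:
  fixes u w :: "'a::euclidean_space"
  shows "(\<Sum>i\<in>Basis. \<Sum>j\<in>Basis. ((u \<bullet> i) * (w \<bullet> j) - (u \<bullet> j) * (w \<bullet> i))\<^sup>2)
    = 2 * ((norm u)\<^sup>2 * (norm w)\<^sup>2 - (u \<bullet> w)\<^sup>2)"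
proof -
  have "(\<Sum>i\<in>Basis. \<Sum>j\<in>Basis. ((u \<bullet> i) * (w \<bullet> j) - (u \<bullet> j) * (w \<bullet> i))\<^sup>2)
     = (\<Sum>i\<in>Basis. \<Sum>j\<in>Basis. ((u \<bullet> i) * (u \<bullet> i)) * ((w \<bullet> j) * (w \<bullet> j))
        + ((w \<bullet> i) * (w \<bullet> i)) * ((u \<bullet> j) * (u \<bullet> j))
        - 2 * (((u \<bullet> i) * (w \<bullet> i)) * ((u \<bullet> j) * (w \<bullet> j))))"
    by (intro sum.cong refl) (simp add: power2_eq_square algebra_simps)
  also have "\<dots> = (u \<bullet> u) * (w \<bullet> w) + (w \<bullet> w) * (u \<bullet> u) - 2 * ((u \<bullet> w) * (u \<bullet> w))"
    unfolding sum_subtractf sum.distrib sum_product[symmetric] sum_distrib_left[symmetric]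
    by (simp add: euclidean_inner[of u u] euclidean_inner[of w w] euclidean_inner[of u w] flip: sum_distrib_left sum_distrib_right)
  finally show ?thesis
    unfolding power2_norm_eq_inner by (simp add: power2_eq_square)
qed

text \<open>Take the line through two points at maximal distance \<open>norm u\<close>. Lagrange's
  identity bounds \<open>d * norm u\<close> by the minors, where \<open>d\<close> is the distance of
  \<open>x\<close> from the line. Maximality gives \<open>d \<le> norm u\<close>, so
  \<open>d\<close> squared is bounded as well, whatever the size of the diameter.\<close>

lemma thin_of_small_minors:
  fixes K :: "'a::euclidean_space set"
  assumes "compact K" and "0 \<le> \<epsilon>"
    and small: "\<And>x y z i j. x \<in> K \<Longrightarrow> y \<in> K \<Longrightarrow> z \<in> K \<Longrightarrow> i \<in> Basis \<Longrightarrow> j \<in> Basis \<Longrightarrow>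
      \<bar>((y - x) \<bullet> i) * ((z - x) \<bullet> j) - ((y - x) \<bullet> j) * ((z - x) \<bullet> i)\<bar> \<le> \<alpha>"
    and \<alpha>: "real DIM('a) * \<alpha> \<le> \<epsilon>\<^sup>2"
  obtains a v where "norm v = 1" "\<And>x. x \<in> K \<Longrightarrow> norm (x - (a + ((x - a) \<bullet> v) *\<^sub>R v)) \<le> \<epsilon>"
proof -
  obtain e :: 'a where e: "e \<in> Basis" using nonempty_Basis by blast
  show thesis
  proof (cases "\<exists>x\<in>K. \<exists>y\<in>K. x \<noteq> y")
    case False
    then obtain a where "K \<subseteq> {a}" by (cases "K = {}") blast+
    then have "x = a" if "x \<in> K" for x using that by blast
    moreover have "norm e = 1" using e by simp
    ultimately show ?thesis using that[of e a] \<open>0 \<le> \<epsilon>\<close> by simp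
  next
    case True
    then have "K \<noteq> {}" by auto
    then obtain a b where ab: "a \<in> K" "b \<in> K" and max: "\<And>x y. x \<in> K \<Longrightarrow> y \<in> K \<Longrightarrow> dist x y \<le> dist a b"
      using diameter_compact_attained[OF \<open>compact K\<close>] diameter_bounded_bound[OF compact_imp_bounded[OF \<open>compact K\<close>]]
      by (metis)
    define u where "u = b - a"
    have u: "0 < norm u"
    proof -
      obtain x y where "x \<in> K" "y \<in> K" "x \<noteq> y" using True by blast
      then have "0 < dist a b" using max[of x y] by (metis less_le_trans zero_less_dist_iff)
      then show ?thesis by (simp add: u_def dist_norm norm_minus_commute)
    qed
    define v where "v = u /\<^sub>R norm u"
    have v: "norm v = 1" using u by (simp add: v_def)
    have "norm (x - (a + ((x - a) \<bullet> v) *\<^sub>R v)) \<le> \<epsilon>" if x: "x \<in> K" for x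
    proof -
      define w where "w = x - a"
      define d where "d = norm (w - (w \<bullet> v) *\<^sub>R v)"
      have wu: "norm w \<le> norm u"
        using max[OF x ab(1)] by (simp add: w_def u_def dist_norm norm_minus_commute)
      have d2: "d\<^sup>2 = (norm w)\<^sup>2 - (w \<bullet> v)\<^sup>2"
      proof -
        have "v \<bullet> v = 1" using v by (simp add: norm_eq_1)
        then show ?thesis
          unfolding d_def power2_norm_eq_inner by (simp add: algebra_simps inner_commute power2_eq_square)
      qed
      then have "d\<^sup>2 \<le> (norm u)\<^sup>2" using power_mono[OF wu norm_ge_zero, of 2] zero_le_power2[of "w \<bullet> v"] by linarith
      then have "d\<^sup>2 * d\<^sup>2 \<le> d\<^sup>2 * (norm u)\<^sup>2" by (intro mult_left_mono) auto
      also have "\<dots> = (norm u)\<^sup>2 * (norm w)\<^sup>2 - (u \<bullet> w)\<^sup>2"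
      proof -
        have "norm u * (w \<bullet> v) = u \<bullet> w" using u by (simp add: v_def inner_commute)
        then have "(norm u)\<^sup>2 * (w \<bullet> v)\<^sup>2 = (u \<bullet> w)\<^sup>2" by (metis power_mult_distrib)
        then show ?thesis by (simp add: d2 algebra_simps)
      qed
      also have "\<dots> \<le> 2 * ((norm u)\<^sup>2 * (norm w)\<^sup>2 - (u \<bullet> w)\<^sup>2)"
        using Cauchy_Schwarz_ineq[of u w] by (simp add: power2_norm_eq_inner)
      also have "\<dots> = (\<Sum>i\<in>Basis. \<Sum>j\<in>Basis. ((u \<bullet> i) * (w \<bullet> j) - (u \<bullet> j) * (w \<bullet> i))\<^sup>2)"
        by (rule lagrange_identity[symmetric])
      also have "\<dots> \<le> (\<Sum>i\<in>(Basis::'a set). \<Sum>j\<in>(Basis::'a set). \<alpha>\<^sup>2)"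
        using small[OF ab(1,2) x] unfolding u_def w_def
        by (intro sum_mono) (metis abs_ge_zero power2_abs power_mono)
      also have "\<dots> = (real DIM('a) * \<alpha>)\<^sup>2" by (simp add: power2_eq_square)
      also have "\<dots> \<le> (\<epsilon>\<^sup>2)\<^sup>2"
      proof (rule power_mono[OF \<alpha>])
        have "0 \<le> \<alpha>" using small[OF ab(1) ab(1) ab(1) e e] by simp
        then show "0 \<le> real DIM('a) * \<alpha>" by simp
      qed
      finally have "(d\<^sup>2)\<^sup>2 \<le> (\<epsilon>\<^sup>2)\<^sup>2" by (simp add: power2_eq_square)
      then have "d\<^sup>2 \<le> \<epsilon>\<^sup>2" by (rule power2_le_imp_le) simp
      then have "d \<le> \<epsilon>" using \<open>0 \<le> \<epsilon>\<close> by (rule power2_le_imp_le)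
      then show ?thesis by (simp add: d_def w_def algebra_simps)
    qed
    then show ?thesis using that[OF v] by blast
  qed
qed

text \<open>One cut is made through each grid point for each pair of coordinates. Every triangle
  with vertices in the remaining set projects to triangles whose centroids are close to grid points,
  so these have small area.\<close>

lemma balanced_needle:
  fixes M :: "'a::euclidean_space measure"
  assumes "finite_measure M" and sets: "sets M = sets borel"
    and zero_one: "hyperplane_dichotomy M"
    and C: "C \<in> sets borel" and F: "F \<in> sets borel" and bal: "balanced M C F \<theta> \<kappa> K" and "0 < \<epsilon>"
  obtains K' a v where "K' \<subseteq> K" "balanced M C F \<theta> \<kappa> K'" "norm v = 1"
    "\<And>x. x \<in> K' \<Longrightarrow> norm (x - (a + ((x - a) \<bullet> v) *\<^sub>R v)) \<le> \<epsilon>"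
proof -
  note result = that
  have "bounded K" using bal by (simp add: balanced_def compact_imp_bounded)
  then obtain R where R: "0 < R" "\<And>x. x \<in> K \<Longrightarrow> norm x \<le> R" by (auto simp: bounded_pos)
  \<comment> \<open>Chosen so that \<open>real DIM('a) * (12 * R * \<eta>)\<close> is the square of
    \<open>\<epsilon>\<close>, as \<open>thin_of_small_minors\<close> requires.\<close>
  define \<eta> where "\<eta> = \<epsilon>\<^sup>2 / (12 * R * real DIM('a))"
  have \<eta>: "0 < \<eta>" using R \<open>0 < \<epsilon>\<close> by (simp add: \<eta>_def)
  obtain G where G: "finite G" "{- R..R} \<subseteq> (\<Union>g\<in>G. ball g \<eta>)"
    using compactE_image[of "{- R..R}" "{- R..R}" "\<lambda>g. ball g \<eta>"] \<eta> by (metis UN_I centre_in_ball compact_Icc open_ball subsetI)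
  define W where "W = (Basis::'a set) \<times> (Basis::'a set) \<times> G \<times> G"
  have "finite W" using G by (simp add: W_def)
  from balanced_bisect_finite[OF assms(1) sets zero_one C F bal this] obtain K' where
    K': "K' \<subseteq> K" "balanced M C F \<theta> \<kappa> K'" and cut: "\<And>w. w \<in> W \<Longrightarrow> cut_through K' w"
    by auto
  have near: "\<exists>g\<in>G. \<bar>g - r\<bar> \<le> \<eta>" if "\<bar>r\<bar> \<le> R" for r
  proof -
    have "r \<in> {- R..R}" using that by auto
    then obtain g where "g \<in> G" "r \<in> ball g \<eta>" using G by blast
    then show ?thesis by (auto simp: dist_real_def intro!: bexI[of _ g])
  qed
  have "\<bar>((y - x) \<bullet> i) * ((z - x) \<bullet> j) - ((y - x) \<bullet> j) * ((z - x) \<bullet> i)\<bar> \<le> 12 * R * \<eta>"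
    if xyz: "x \<in> K'" "y \<in> K'" "z \<in> K'" and ij: "i \<in> Basis" "j \<in> Basis" for x y z i j
  proof -
    have bd: "\<bar>i' \<bullet> x'\<bar> \<le> R" if "x' \<in> K'" "i' \<in> Basis" for x' i'
      using Basis_le_norm[OF that(2), of x'] R(2)[of x'] that K'(1) by (auto simp: inner_commute)
    have "\<bar>(i' \<bullet> x + i' \<bullet> y + i' \<bullet> z) / 3\<bar> \<le> R" if "i' \<in> Basis" for i'
    proof -
      have avg: "\<bar>(r1 + r2 + r3) / 3\<bar> \<le> R" if "\<bar>r1\<bar> \<le> R" "\<bar>r2\<bar> \<le> R" "\<bar>r3\<bar> \<le> R" for r1 r2 r3 :: real
        using that by (simp add: abs_le_iff field_simps)
      show ?thesis using that by (intro avg bd xyz)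
    qed
    then obtain p1 p2 where p: "p1 \<in> G" "\<bar>p1 - (i \<bullet> x + i \<bullet> y + i \<bullet> z) / 3\<bar> \<le> \<eta>"
      "p2 \<in> G" "\<bar>p2 - (j \<bullet> x + j \<bullet> y + j \<bullet> z) / 3\<bar> \<le> \<eta>"
      using near[of "(i \<bullet> x + i \<bullet> y + i \<bullet> z) / 3"] near[of "(j \<bullet> x + j \<bullet> y + j \<bullet> z) / 3"] ij by auto
    have "(i, j, p1, p2) \<in> W" using ij p by (simp add: W_def)
    from cut[OF this] have "\<exists>n1 n2. (n1 \<noteq> 0 \<or> n2 \<noteq> 0) \<and>
        (\<forall>x\<in>K'. 0 \<le> n1 * (i \<bullet> x - p1) + n2 * (j \<bullet> x - p2))"
      by (simp only: cut_through_def prod.case)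
    then obtain n1 n2 where n: "n1 \<noteq> 0 \<or> n2 \<noteq> 0"
      and nx: "\<forall>x\<in>K'. 0 \<le> n1 * (i \<bullet> x - p1) + n2 * (j \<bullet> x - p2)"
      by (elim exE conjE)
    have "\<bar>(i \<bullet> y - i \<bullet> x) * (j \<bullet> z - j \<bullet> x) - (j \<bullet> y - j \<bullet> x) * (i \<bullet> z - i \<bullet> x)\<bar> \<le> 12 * R * \<eta>"
      by (rule triangle_grid_small[OF bd bd bd bd bd bd p(2) p(4) n
            bspec[OF nx xyz(1)] bspec[OF nx xyz(2)] bspec[OF nx xyz(3)]]) (fact xyz ij)+
    then show ?thesis by (simp add: inner_diff_left inner_diff_right inner_commute)
  qed
  note small = this
  show thesis
  proof (rule thin_of_small_minors[of K' \<epsilon> "12 * R * \<eta>"])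
    show "compact K'" using K' by (simp add: balanced_def)
    show "real DIM('a) * (12 * R * \<eta>) \<le> \<epsilon>\<^sup>2" using R by (simp add: \<eta>_def)
    show "thesis" if "norm v = 1" "\<And>x. x \<in> K' \<Longrightarrow> norm (x - (a + ((x - a) \<bullet> v) *\<^sub>R v)) \<le> \<epsilon>" for a v
      by (rule result[OF K' that(1)]) (rule that(2))
  qed (use small \<open>0 < \<epsilon>\<close> in \<open>auto simp: less_imp_le\<close>)
qed

section \<open>Sparseness along lines\<close>

definition line_sparse :: "real \<Rightarrow> 'a::euclidean_space set \<Rightarrow> 'a set \<Rightarrow> bool" where
  "line_sparse l F C \<longleftrightarrow> (\<forall>a v. norm v = 1 \<longrightarrow> sparse_near l {r. a + r *\<^sub>R v \<in> F} {r. a + r *\<^sub>R v \<in> C})"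

lemma sparse_near_mono:
  assumes "sparse_near l F C" "F' \<subseteq> F" "C' \<subseteq> C" "F \<in> sets borel"
  shows "sparse_near l F' C'"
  unfolding sparse_near_def
proof (intro ballI allI impI)
  fix c p q assume c: "c \<in> C'" "p \<le> c" "c \<le> q"
  have "emeasure lborel (F' \<inter> {p..q}) \<le> emeasure lborel (F \<inter> {p..q})"
    using assms by (intro emeasure_mono) auto
  also have "\<dots> \<le> ennreal (l * (q - p))"
    using sparse_nearD[OF assms(1) c(2,3)] c(1) assms(3) by auto
  finally show "emeasure lborel (F' \<inter> {p..q}) \<le> ennreal (l * (q - p))" .
qed

lemma emeasure_lborel_translate:
  fixes S :: "real set"
  assumes "S \<in> sets borel"
  shows "emeasure lborel {r. c + r \<in> S} = emeasure lborel S"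
proof -
  have "emeasure lborel S = emeasure (distr lborel borel ((+) c)) S"
    by (simp add: lborel_distr_plus)
  also have "\<dots> = emeasure lborel {r. c + r \<in> S}"
    using assms by (subst emeasure_distr) (auto simp: vimage_def)
  finally show ?thesis by simp
qed

lemma closed_infdist_line:
  fixes a v :: "'a::real_normed_vector"
  shows "closed {r::real. infdist (a + r *\<^sub>R v) F \<le> \<epsilon>}"
  by (intro closed_Collect_le continuous_on_infdist) (auto intro!: continuous_intros)

text \<open>Compactness: a sequence of counterexamples with \<open>\<epsilon> \<longrightarrow> 0\<close> converges to an interval violating
  \<open>line_sparse l F C\<close>; disjointness of \<open>F\<close> and \<open>C\<close> keeps that interval from degenerating.\<close>

lemma line_sparse_thicken:
  fixes F C :: "'a::euclidean_space set"
  assumes F: "compact F" "F \<noteq> {}" and C: "compact C" "C \<noteq> {}" and disj: "F \<inter> C = {}"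
    and l: "0 < l" "l < l'" and sp: "line_sparse l F C"
  obtains \<epsilon> where "0 < \<epsilon>" "\<And>a v. norm v = 1 \<Longrightarrow>
    sparse_near l' {r. infdist (a + r *\<^sub>R v) F \<le> \<epsilon>} {r. infdist (a + r *\<^sub>R v) C \<le> \<epsilon>}"
proof (rule ccontr)
  note result = that
  assume neg: "\<not> thesis"
  define e where "e k = 1 / real (Suc k)" for k
  have e0: "0 < e k" "e k \<le> 1" for k by (auto simp: e_def)
  have elim: "e \<longlonglongrightarrow> 0" unfolding e_def by (rule LIMSEQ_Suc[OF lim_1_over_n])
  define S where "S k a v = {r. infdist (a + r *\<^sub>R v) F \<le> e k}" for k and a v :: 'a
  have Sc: "closed (S k a v)" for k a v unfolding S_def by (rule closed_infdist_line)
  have "\<exists>a v p q. norm v = 1 \<and> p \<le> 0 \<and> 0 \<le> q \<and> infdist a C \<le> e k \<and>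
      \<not> emeasure lborel (S k a v \<inter> {p..q}) \<le> ennreal (l' * (q - p))" for k
  proof -
    have "\<not> (\<forall>a v. norm v = 1 \<longrightarrow>
        sparse_near l' {r. infdist (a + r *\<^sub>R v) F \<le> e k} {r. infdist (a + r *\<^sub>R v) C \<le> e k})"
      using neg result[of "e k"] e0(1)[of k] by auto
    then obtain a v c p q where *: "norm v = 1" "p \<le> c" "c \<le> q" "infdist (a + c *\<^sub>R v) C \<le> e k"
      "\<not> emeasure lborel (S k a v \<inter> {p..q}) \<le> ennreal (l' * (q - p))"
      unfolding sparse_near_def S_def by blast
    \<comment> \<open>The line is reparametrized so that the point near \<open>C\<close> has
      parameter 0; this keeps the base points bounded.\<close>
    have "emeasure lborel {r. c + r \<in> S k a v \<inter> {p..q}} = emeasure lborel (S k a v \<inter> {p..q})"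
      using Sc by (intro emeasure_lborel_translate) auto
    moreover have "{r. c + r \<in> S k a v \<inter> {p..q}} = S k (a + c *\<^sub>R v) v \<inter> {p - c..q - c}"
      by (auto simp: S_def algebra_simps)
    ultimately have "\<not> emeasure lborel (S k (a + c *\<^sub>R v) v \<inter> {p - c..q - c}) \<le> ennreal (l' * ((q - c) - (p - c)))"
      using *(5) by simp
    then show ?thesis
      using * by (intro exI[of _ "a + c *\<^sub>R v"] exI[of _ v] exI[of _ "p - c"] exI[of _ "q - c"]) simp
  qed
  then obtain a v p q where v: "\<And>k. norm (v k :: 'a) = 1" and pq: "\<And>k. p k \<le> (0::real)" "\<And>k. (0::real) \<le> q k"
    and aC: "\<And>k. infdist (a k) C \<le> e k"
    and big: "\<And>k. \<not> emeasure lborel (S k (a k) (v k) \<inter> {p k..q k}) \<le> ennreal (l' * (q k - p k))"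
    by metis
  obtain RC where RC: "\<And>x. x \<in> C \<Longrightarrow> norm x \<le> RC" "0 < RC" using compact_imp_bounded[OF C(1)] by (auto simp: bounded_pos)
  obtain RF where RF: "\<And>x. x \<in> F \<Longrightarrow> norm x \<le> RF" "0 < RF" using compact_imp_bounded[OF F(1)] by (auto simp: bounded_pos)
  have normle: "norm x \<le> R + 1" if xA: "infdist x A \<le> e k" "compact A" "A \<noteq> {}" "\<And>y. y \<in> A \<Longrightarrow> norm y \<le> R" for x :: 'a and A R k
  proof -
    obtain y where "y \<in> A" "infdist x A = dist x y"
      using infdist_attains_inf[OF compact_imp_closed[OF xA(2)] xA(3)] by blast
    then have "norm (x - y) \<le> 1" using xA(1) e0(2)[of k] by (simp add: dist_norm)
    moreover have "norm x \<le> norm y + norm (x - y)" using norm_triangle_sub by blast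
    ultimately show ?thesis using xA(4)[OF \<open>y \<in> A\<close>] by linarith
  qed
  have na: "norm (a k) \<le> RC + 1" for k using normle[OF aC C RC(1)] .
  define \<rho> where "\<rho> = RC + RF + 2"
  have \<rho>: "0 < \<rho>" using RC RF by (simp add: \<rho>_def)
  have S\<rho>: "\<bar>r\<bar> \<le> \<rho>" if "r \<in> S k (a k) (v k)" for r k
  proof -
    have "norm (a k + r *\<^sub>R v k) \<le> RF + 1"
      using that by (intro normle[OF _ F RF(1)]) (auto simp: S_def)
    moreover have "norm (r *\<^sub>R v k) = \<bar>r\<bar>" using v by simp
    moreover have "norm (r *\<^sub>R v k) \<le> norm (a k + r *\<^sub>R v k) + norm (a k)"
      using norm_triangle_ineq4[of "a k + r *\<^sub>R v k" "a k"] by simp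
    ultimately show ?thesis using na[of k] unfolding \<rho>_def by linarith
  qed
  \<comment> \<open>A violating interval satisfies \<open>l' * (q k - p k) < 2 * \<rho>\<close>, so
    its length is bounded and a convergent subsequence exists.\<close>
  define B where "B = 2 * \<rho> / l'"
  have qp: "q k - p k \<le> B" for k
  proof -
    have "emeasure lborel (S k (a k) (v k) \<inter> {p k..q k}) \<le> emeasure lborel {- \<rho>..\<rho>}"
    proof (rule emeasure_mono)
      show "S k (a k) (v k) \<inter> {p k..q k} \<subseteq> {- \<rho>..\<rho>}" using S\<rho> by (force simp: abs_le_iff)
    qed simp
    then have "emeasure lborel (S k (a k) (v k) \<inter> {p k..q k}) \<le> ennreal (2 * \<rho>)" using \<rho> by simp
    then have "\<not> 2 * \<rho> \<le> l' * (q k - p k)" using big[of k] by (meson ennreal_leI order_trans)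
    then show ?thesis using l by (simp add: B_def field_simps)
  qed
  define w where "w k = (a k, v k, p k, q k)" for k
  have "compact (cball 0 (RC + 1) \<times> cball 0 1 \<times> {- B..0} \<times> {0..B} :: ('a \<times> 'a \<times> real \<times> real) set)"
    by (intro compact_Times) auto
  moreover have "w k \<in> cball 0 (RC + 1) \<times> cball 0 1 \<times> {- B..0} \<times> {0..B}" for k
    using na[of k] v[of k] pq[of k] qp[of k] by (auto simp: w_def)
  ultimately obtain lim h where h: "strict_mono h" "(w \<circ> h) \<longlonglongrightarrow> lim"
    unfolding compact_eq_seq_compact_metric by (metis seq_compactE)
  obtain a0 v0 p0 q0 where lim: "lim = (a0, v0, p0, q0)" by (cases lim)
  have wlim: "(\<lambda>k. (a (h k), v (h k), p (h k), q (h k))) \<longlonglongrightarrow> (a0, v0, p0, q0)"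
    using h(2) by (simp add: lim w_def comp_def)
  have alim: "(\<lambda>k. a (h k)) \<longlonglongrightarrow> a0" using tendsto_fst[OF wlim] by simp
  have vlim: "(\<lambda>k. v (h k)) \<longlonglongrightarrow> v0" using tendsto_fst[OF tendsto_snd[OF wlim]] by simp
  have plim: "(\<lambda>k. p (h k)) \<longlonglongrightarrow> p0" using tendsto_fst[OF tendsto_snd[OF tendsto_snd[OF wlim]]] by simp
  have qlim: "(\<lambda>k. q (h k)) \<longlonglongrightarrow> q0" using tendsto_snd[OF tendsto_snd[OF tendsto_snd[OF wlim]]] by simp
  have eh: "(\<lambda>k. e (h k)) \<longlonglongrightarrow> 0" using LIMSEQ_subseq_LIMSEQ[OF elim h(1)] by (simp add: comp_def)
  have v0: "norm v0 = 1"
    using tendsto_norm[OF vlim] v by (simp add: LIMSEQ_const_iff)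
  have p0: "p0 \<le> 0" by (rule LIMSEQ_le_const2[OF plim]) (use pq in auto)
  have q0: "0 \<le> q0" by (rule LIMSEQ_le_const[OF qlim]) (use pq in auto)
  have "infdist a0 C \<le> 0"
    by (rule LIMSEQ_le[OF tendsto_infdist[OF alim] eh]) (use aC in auto)
  then have a0: "a0 \<in> C"
    using in_closed_iff_infdist_zero[OF compact_imp_closed[OF C(1)] C(2)] infdist_nonneg[of a0 C] by simp
  \<comment> \<open>Closed sets on the limit line: \<open>U m\<close> contains all violating sets
    from some index on, and the \<open>U m\<close> decrease to a subset of \<open>V\<close>.\<close>
  define U where "U m = {r. \<bar>r\<bar> \<le> \<rho> \<and> infdist (a0 + r *\<^sub>R v0) F \<le> e m \<and> p0 - e m \<le> r \<and> r \<le> q0 + e m}" for m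
  have sub: "\<forall>\<^sub>F k in sequentially. S (h k) (a (h k)) (v (h k)) \<inter> {p (h k)..q (h k)} \<subseteq> U m" for m
  proof -
    have "(\<lambda>k. e (h k) + dist a0 (a (h k)) + \<rho> * dist v0 (v (h k))) \<longlonglongrightarrow> 0 + dist a0 a0 + \<rho> * dist v0 v0"
      by (intro tendsto_intros eh alim vlim)
    then have 1: "\<forall>\<^sub>F k in sequentially. e (h k) + dist a0 (a (h k)) + \<rho> * dist v0 (v (h k)) < e m"
      using order_tendstoD(2)[of _ _ _ "e m"] e0[of m] by force
    have 2: "\<forall>\<^sub>F k in sequentially. p0 - e m < p (h k)"
      using order_tendstoD(1)[OF plim] e0[of m] by simp
    have 3: "\<forall>\<^sub>F k in sequentially. q (h k) < q0 + e m"
      using order_tendstoD(2)[OF qlim] e0[of m] by simp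
    show ?thesis using 1 2 3
    proof eventually_elim
      case (elim k)
      show ?case
      proof
        fix r assume r: "r \<in> S (h k) (a (h k)) (v (h k)) \<inter> {p (h k)..q (h k)}"
        then have r\<rho>: "\<bar>r\<bar> \<le> \<rho>" using S\<rho> by auto
        have "infdist (a0 + r *\<^sub>R v0) F \<le> infdist (a (h k) + r *\<^sub>R v (h k)) F + dist (a0 + r *\<^sub>R v0) (a (h k) + r *\<^sub>R v (h k))"
          by (rule infdist_triangle)
        also have "dist (a0 + r *\<^sub>R v0) (a (h k) + r *\<^sub>R v (h k)) \<le> dist a0 (a (h k)) + \<bar>r\<bar> * dist v0 (v (h k))"
        proof -
          have "a0 + r *\<^sub>R v0 - (a (h k) + r *\<^sub>R v (h k)) = (a0 - a (h k)) + r *\<^sub>R (v0 - v (h k))"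
            by (simp add: algebra_simps)
          then show ?thesis unfolding dist_norm by (metis norm_scaleR norm_triangle_ineq)
        qed
        also have "\<bar>r\<bar> * dist v0 (v (h k)) \<le> \<rho> * dist v0 (v (h k))"
          using r\<rho> by (intro mult_right_mono) auto
        finally have "infdist (a0 + r *\<^sub>R v0) F \<le> e m"
          using r elim(1) by (auto simp: S_def)
        then show "r \<in> U m" using r r\<rho> elim by (auto simp: U_def)
      qed
    qed
  qed
  have Uclosed: "closed (U m)" for m
  proof -
    have "U m = {- \<rho>..\<rho>} \<inter> {r. infdist (a0 + r *\<^sub>R v0) F \<le> e m} \<inter> {p0 - e m..q0 + e m}"
      by (auto simp: U_def)
    then show ?thesis using closed_infdist_line[of a0 v0 F "e m"] by auto
  qed
  have Ule: "ennreal (l' * (q0 - p0)) \<le> emeasure lborel (U m)" for m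
  proof -
    have "(\<lambda>k. ennreal (l' * (q (h k) - p (h k)))) \<longlonglongrightarrow> ennreal (l' * (q0 - p0))"
      by (intro tendsto_ennrealI tendsto_intros plim qlim)
    moreover have "\<forall>\<^sub>F k in sequentially. ennreal (l' * (q (h k) - p (h k))) \<le> emeasure lborel (U m)"
      using sub[of m]
    proof eventually_elim
      case (elim k)
      have "ennreal (l' * (q (h k) - p (h k))) \<le> emeasure lborel (S (h k) (a (h k)) (v (h k)) \<inter> {p (h k)..q (h k)})"
        using big[of "h k"] by simp
      also have "\<dots> \<le> emeasure lborel (U m)"
        using elim Uclosed by (intro emeasure_mono) auto
      finally show ?case .
    qed
    ultimately show ?thesis by (intro tendsto_upperbound) auto
  qed
  have Une: "U m \<noteq> {}" for m
  proof -
    obtain k where k: "S (h k) (a (h k)) (v (h k)) \<inter> {p (h k)..q (h k)} \<subseteq> U m"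
      using sub[of m] by (auto simp: eventually_sequentially)
    moreover have "S (h k) (a (h k)) (v (h k)) \<inter> {p (h k)..q (h k)} \<noteq> {}"
    proof
      assume "S (h k) (a (h k)) (v (h k)) \<inter> {p (h k)..q (h k)} = {}"
      then show False using big[of "h k"] by simp
    qed
    ultimately show ?thesis by auto
  qed
  define V where "V = {r. a0 + r *\<^sub>R v0 \<in> F} \<inter> {p0..q0}"
  have e_mono: "e n \<le> e m" if "m \<le> n" for m n using that by (simp add: e_def frac_le)
  have INT: "(\<Inter>m. U m) \<subseteq> V"
  proof
    fix r assume "r \<in> (\<Inter>m. U m)"
    then have r: "\<And>m. infdist (a0 + r *\<^sub>R v0) F \<le> e m" "\<And>m. p0 \<le> r + e m" "\<And>m. r \<le> q0 + e m"
      by (auto simp: U_def algebra_simps)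
    have "infdist (a0 + r *\<^sub>R v0) F \<le> 0" by (rule LIMSEQ_le_const[OF elim]) (use r in auto)
    then have "a0 + r *\<^sub>R v0 \<in> F"
      using in_closed_iff_infdist_zero[OF compact_imp_closed[OF F(1)] F(2)] infdist_nonneg[of "a0 + r *\<^sub>R v0" F] by simp
    moreover have "p0 \<le> r + 0" by (rule LIMSEQ_le_const[OF tendsto_add[OF tendsto_const elim]]) (use r in auto)
    moreover have "r \<le> q0 + 0" by (rule LIMSEQ_le_const[OF tendsto_add[OF tendsto_const elim]]) (use r in auto)
    ultimately show "r \<in> V" by (simp add: V_def)
  qed
  have "closed {r. a0 + r *\<^sub>R v0 \<in> F}"
  proof -
    have "continuous_on UNIV (\<lambda>r::real. a0 + r *\<^sub>R v0)" by (intro continuous_intros)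
    then show ?thesis
      using closed_vimage[OF compact_imp_closed[OF F(1)]] by (simp add: vimage_def)
  qed
  then have Vb: "V \<in> sets borel" by (auto simp: V_def)
  have "(\<lambda>m. emeasure lborel (U m)) \<longlonglongrightarrow> emeasure lborel (\<Inter>m. U m)"
  proof (rule Lim_emeasure_decseq)
    show "range U \<subseteq> sets lborel" using Uclosed by auto
    show "decseq U"
    proof (rule decseq_SucI)
      fix m show "U (Suc m) \<subseteq> U m" using e_mono[of m "Suc m"] by (auto simp: U_def)
    qed
    fix m
    have "emeasure lborel (U m) \<le> emeasure lborel {- \<rho>..\<rho>}"
      by (intro emeasure_mono) (auto simp: U_def abs_le_iff)
    then show "emeasure lborel (U m) \<noteq> \<infinity>" using \<rho> by (auto simp: top_unique)
  qed
  then have "ennreal (l' * (q0 - p0)) \<le> emeasure lborel (\<Inter>m. U m)"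
    using Ule by (intro LIMSEQ_le_const) auto
  also have "\<dots> \<le> emeasure lborel V" using INT Vb by (intro emeasure_mono) auto
  also have "\<dots> \<le> ennreal (l * (q0 - p0))"
    unfolding V_def using sp a0 v0 p0 q0 unfolding line_sparse_def
    by (intro sparse_nearD[of l _ "{r. a0 + r *\<^sub>R v0 \<in> C}" p0 0 q0]) auto
  finally have "l' * (q0 - p0) \<le> l * (q0 - p0)" using l p0 q0 by (simp add: ennreal_le_iff)
  then have "(l' - l) * (q0 - p0) \<le> 0" by (simp add: algebra_simps)
  then have "q0 - p0 \<le> 0" using l by (simp add: mult_le_0_iff)
  then have pq0: "p0 = 0" "q0 = 0" using p0 q0 by auto
  \<comment> \<open>The limit interval is the single point \<open>a0\<close> of \<open>C\<close>; as
    no \<open>U m\<close> is empty, \<open>a0\<close> has distance 0 from \<open>F\<close>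
    too.\<close>
  have "infdist a0 F \<le> 2 * e m" for m
  proof -
    obtain r where r: "r \<in> U m" using Une by blast
    have "infdist a0 F \<le> infdist (a0 + r *\<^sub>R v0) F + dist a0 (a0 + r *\<^sub>R v0)" by (rule infdist_triangle)
    also have "dist a0 (a0 + r *\<^sub>R v0) = \<bar>r\<bar>" using v0 by (simp add: dist_norm)
    finally show ?thesis using r by (auto simp: U_def pq0 abs_le_iff)
  qed
  then have "infdist a0 F \<le> 2 * 0"
    by (intro LIMSEQ_le_const[OF tendsto_mult[OF tendsto_const elim]]) auto
  then have "a0 \<in> F"
    using in_closed_iff_infdist_zero[OF compact_imp_closed[OF F(1)] F(2)] infdist_nonneg[of a0 F] by simp
  then show False using a0 disj by auto
qed

section \<open>Disjoint compact sets under an s-concave measure\<close>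

lemma s_concave_pmean:
  fixes M :: "(real ^ 'n) measure"
  assumes "s_concave s M" "compact A" "compact B" "0 < measure M A" "0 < measure M B" "0 \<le> k" "k \<le> 1"
  shows "pmean s k (measure M A) (measure M B)
    \<le> measure M {k *\<^sub>R x + (1 - k) *\<^sub>R y | x y. x \<in> A \<and> y \<in> B}"
proof -
  have "k \<in> {0..1}" "0 < measure M A * measure M B" using assms by auto
  then show ?thesis using assms(1-3) unfolding s_concave_def pmean_def by blast
qed

lemma s_concave_min:
  fixes M :: "(real ^ 'n) measure"
  assumes "s_concave s M" "compact A" "compact B" "0 < measure M A" "0 < measure M B" "0 \<le> k" "k \<le> 1"
  shows "min (measure M A) (measure M B)
    \<le> measure M {k *\<^sub>R x + (1 - k) *\<^sub>R y | x y. x \<in> A \<and> y \<in> B}"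
  using s_concave_pmean[OF assms] pmean_ge_min[OF assms(4,5,6,7), of s] by simp

lemma s_concave_hyperplane_dichotomy:
  fixes M :: "(real ^ 'n) measure"
  assumes M: "finite_measure M" "sets M = sets borel" and s: "s_concave s M"
  shows "hyperplane_dichotomy M"
  unfolding hyperplane_dichotomy_def
proof (intro allI impI)
  fix K :: "(real ^ 'n) set" and n c assume K: "compact K"
  have "measure M {x\<in>K. \<bar>n \<bullet> x - c\<bar> = 0} = 0 \<or> measure M {x\<in>K. \<bar>n \<bullet> x - c\<bar> = 0} = measure M K"
  proof (rule quasiconcave_measure_zero_one[OF M _ K])
    show "continuous_on UNIV (\<lambda>x. \<bar>n \<bullet> x - c\<bar>)" by (intro continuous_intros)
    show "\<bar>n \<bullet> ((1 - k) *\<^sub>R x + k *\<^sub>R y) - c\<bar> = k * \<bar>n \<bullet> y - c\<bar>"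
      if "\<bar>n \<bullet> x - c\<bar> = 0" "0 \<le> k" for x y k
    proof -
      have "n \<bullet> ((1 - k) *\<^sub>R x + k *\<^sub>R y) - c = k * (n \<bullet> y - c)"
        using that by (simp add: algebra_simps)
      then show ?thesis using that by (simp add: abs_mult)
    qed
  qed (use s_concave_min[OF s] in auto)
  then show "measure M {x\<in>K. n \<bullet> x = c} = 0 \<or> measure M {x\<in>K. n \<bullet> x = c} = measure M K"
    by simp
qed

text \<open>The margin between \<open>l\<close> and \<open>l'\<close> buys a thickening by
  \<open>\<epsilon>\<close>. One half of it absorbs the width of the needle, the other half is the
  margin \<open>\<eta>\<close> of the one-dimensional inequality, which is applied to the normalized
  measure of the needle projected to its axis.\<close>

lemma s_concave_line_sparse_strict:
  fixes M :: "(real ^ 'n) measure"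
  assumes prob: "prob_space M" and sets: "sets M = sets borel" and sc: "s_concave s M" and s: "s \<le> 1"
    and C: "compact C" and F: "compact F" "F \<noteq> {}" and disj: "F \<inter> C = {}" and Cpos: "0 < measure M C"
    and l: "0 < l" "l < l'" "l' < 1" and sp: "line_sparse l F C"
  shows "measure M F \<le> 1 - pmean s l' (measure M C) 1"
proof (rule ccontr)
  interpret prob_space M by (rule prob)
  have spaceM: "space M = UNIV" using sets_eq_imp_space_eq[OF sets] by simp
  define \<kappa> where "\<kappa> = 1 - pmean s l' (measure M C) 1"
  assume "\<not> ?thesis"
  then have F\<kappa>: "\<kappa> < measure M F" by (simp add: \<kappa>_def)
  have "pmean s l' (measure M C) 1 \<le> max (measure M C) 1" using Cpos l by (intro pmean_le_max) auto
  then have \<kappa>0: "0 \<le> \<kappa>" using prob_le_1[of C] by (simp add: \<kappa>_def)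
  have C0: "C \<noteq> {}" using Cpos by auto
  have [simp]: "C \<in> sets borel" "F \<in> sets borel" using C F by (auto simp: borel_compact)
  obtain \<epsilon> where \<epsilon>: "0 < \<epsilon>" and thick: "\<And>a v. norm v = 1 \<Longrightarrow>
      sparse_near l' {r. infdist (a + r *\<^sub>R v) F \<le> \<epsilon>} {r. infdist (a + r *\<^sub>R v) C \<le> \<epsilon>}"
    using line_sparse_thicken[OF F C C0 disj l(1,2) sp] by blast
  obtain R where R: "\<And>x. x \<in> C \<union> F \<Longrightarrow> norm x \<le> R"
    using compact_imp_bounded[OF compact_Un[OF C F(1)]] by (auto simp: bounded_iff)
  define K0 where "K0 = cball (0 :: real ^ 'n) R"
  have CK: "C \<inter> K0 = C" "F \<inter> K0 = F" using R by (auto simp: K0_def)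
  have CK0: "measure M C \<le> measure M K0"
    using CK by (intro finite_measure_mono) (auto simp: sets K0_def)
  \<comment> \<open>Dividing by the mass of the ball can only increase the share of
    \<open>C\<close>; monotonicity of the mean makes this harmless.\<close>
  define \<theta> where "\<theta> = measure M C / measure M K0"
  have \<theta>: "measure M C \<le> \<theta>"
  proof -
    have "measure M C * measure M K0 \<le> measure M C * 1" using Cpos prob_le_1 by (intro mult_left_mono) auto
    then show ?thesis using CK0 Cpos by (simp add: \<theta>_def field_simps)
  qed
  have "\<kappa> * measure M K0 \<le> \<kappa> * 1" using \<kappa>0 prob_le_1 by (intro mult_left_mono) auto
  then have "balanced M C F \<theta> \<kappa> K0"
    unfolding balanced_def CK using F\<kappa> CK0 Cpos by (auto simp: \<theta>_def K0_def)
  note bal0 = this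
  obtain K a v where bal: "balanced M C F \<theta> \<kappa> K" and v: "norm v = 1"
    and thin: "\<And>x. x \<in> K \<Longrightarrow> norm (x - (a + ((x - a) \<bullet> v) *\<^sub>R v)) \<le> \<epsilon> / 2"
  proof (rule balanced_needle[OF finite_measure_axioms sets
        s_concave_hyperplane_dichotomy[OF finite_measure_axioms sets sc] _ _ bal0, of "\<epsilon> / 2"])
    fix K' v a
    assume 1: "balanced M C F \<theta> \<kappa> K'" and 2: "norm v = 1"
      and 3: "\<And>x. x \<in> K' \<Longrightarrow> norm (x - (a + ((x - a) \<bullet> v) *\<^sub>R v)) \<le> \<epsilon> / 2"
    show thesis by (rule that[OF 1 2]) (rule 3)
  qed (use \<epsilon> in auto)
  have K: "compact K" "convex K" and KC: "measure M (C \<inter> K) = \<theta> * measure M K"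
    and KF: "\<kappa> * measure M K < measure M (F \<inter> K)"
    using bal by (auto simp: balanced_def)
  have [simp]: "K \<in> sets borel" using K by (simp add: borel_compact)
  define m where "m = measure M K"
  have "measure M (F \<inter> K) \<le> m" unfolding m_def by (intro finite_measure_mono) (auto simp: sets)
  moreover have "0 \<le> \<kappa> * measure M K" using \<kappa>0 by simp
  ultimately have m: "0 < m" using KF by linarith
  define \<rho> where "\<rho> x = (x - a) \<bullet> v" for x
  have \<rho>c: "continuous_on A \<rho>" for A unfolding \<rho>_def by (intro continuous_intros)
  have \<rho>m: "\<rho> \<in> borel_measurable borel" by (intro borel_measurable_continuous_onI \<rho>c)
  define \<nu> where "\<nu> = distr (uniform_measure M K) borel \<rho>"
  have \<nu>sets: "sets \<nu> = sets borel" by (simp add: \<nu>_def)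
  have K0': "emeasure M K \<noteq> 0" "emeasure M K \<noteq> \<infinity>" using m by (auto simp: m_def emeasure_eq_measure)
  have mu: "\<rho> \<in> measurable (uniform_measure M K) borel"
    using \<rho>m sets by (simp cong: measurable_cong_sets)
  have \<nu>p: "prob_space \<nu>"
    unfolding \<nu>_def using mu by (intro prob_space.prob_space_distr prob_space_uniform_measure K0')
  have \<nu>: "measure \<nu> S = measure M (K \<inter> {x. \<rho> x \<in> S}) / m" if S: "S \<in> sets borel" for S
  proof -
    have pre: "{x. \<rho> x \<in> S} \<in> sets M" using measurable_sets[OF \<rho>m S] by (simp add: sets vimage_def)
    have "measure \<nu> S = measure (uniform_measure M K) (\<rho> -` S \<inter> space (uniform_measure M K))"
      unfolding \<nu>_def by (rule measure_distr[OF mu S])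
    also have "\<rho> -` S \<inter> space (uniform_measure M K) = {x. \<rho> x \<in> S}" by (auto simp: spaceM)
    also have "measure (uniform_measure M K) {x. \<rho> x \<in> S} = measure M (K \<inter> {x. \<rho> x \<in> S}) / measure M K"
      using pre K0' by (intro measure_uniform_measure) auto
    finally show ?thesis by (simp add: m_def)
  qed
  \<comment> \<open>Parameters of the axis points within \<open>\<epsilon> / 2\<close> of
    \<open>A\<close>. The needle is that thin, so \<open>A \<inter> K\<close> projects into
    \<open>D A\<close>.\<close>
  define D where "D A = {r. infdist (a + r *\<^sub>R v) A \<le> \<epsilon> / 2}" for A
  have Dc: "compact (D A)" if A: "compact A" "A \<noteq> {}" for A
  proof -
    obtain RA where RA: "\<And>x. x \<in> A \<Longrightarrow> norm x \<le> RA" using compact_imp_bounded[OF A(1)] by (auto simp: bounded_iff)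
    have "\<bar>r\<bar> \<le> RA + \<epsilon> / 2 + norm a" if "r \<in> D A" for r
    proof -
      obtain y where y: "y \<in> A" "infdist (a + r *\<^sub>R v) A = dist (a + r *\<^sub>R v) y"
        using infdist_attains_inf[OF compact_imp_closed[OF A(1)] A(2)] by blast
      then have 1: "norm (a + r *\<^sub>R v - y) \<le> \<epsilon> / 2" using that by (simp add: D_def dist_norm)
      have "norm (r *\<^sub>R v) = \<bar>r\<bar>" using v by simp
      moreover have "r *\<^sub>R v = (a + r *\<^sub>R v - y) + (y - a)" by simp
      then have "norm (r *\<^sub>R v) \<le> norm (a + r *\<^sub>R v - y) + norm (y - a)" by (metis norm_triangle_ineq)
      moreover have "norm (y - a) \<le> norm y + norm a" by (rule norm_triangle_ineq4)
      ultimately show ?thesis using 1 RA[OF y(1)] by linarith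
    qed
    then have "bounded (D A)" by (auto simp: bounded_iff)
    moreover have "closed (D A)" unfolding D_def by (rule closed_infdist_line)
    ultimately show ?thesis by (simp add: compact_eq_bounded_closed)
  qed
  have cl: "closed {r. infdist (a + r *\<^sub>R v) A \<le> \<epsilon>}" for A by (rule closed_infdist_line)
  have D\<nu>: "measure M (A \<inter> K) / m \<le> measure \<nu> (D A)" if A: "compact A" "A \<noteq> {}" for A
  proof -
    have "A \<inter> K \<subseteq> K \<inter> {x. \<rho> x \<in> D A}"
    proof
      fix x assume x: "x \<in> A \<inter> K"
      have "infdist (a + \<rho> x *\<^sub>R v) A \<le> dist (a + \<rho> x *\<^sub>R v) x" using x by (intro infdist_le) auto
      also have "\<dots> \<le> \<epsilon> / 2" using thin[of x] x by (simp add: dist_norm \<rho>_def norm_minus_commute)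
      finally show "x \<in> K \<inter> {x. \<rho> x \<in> D A}" using x by (simp add: D_def)
    qed
    moreover have DA: "D A \<in> sets borel" using Dc[OF A] by (rule borel_compact)
    moreover have "{x. \<rho> x \<in> D A} \<in> sets M" using measurable_sets[OF \<rho>m DA] by (simp add: sets vimage_def)
    ultimately have "measure M (A \<inter> K) \<le> measure M (K \<inter> {x. \<rho> x \<in> D A})"
      by (intro finite_measure_mono) (auto simp: sets)
    then show ?thesis using \<nu>[OF DA] m by (simp add: divide_right_mono)
  qed
  have \<nu>F: "\<kappa> < measure \<nu> (D F)"
  proof -
    have "\<kappa> < measure M (F \<inter> K) / m" using KF m by (simp add: m_def less_divide_eq)
    also have "\<dots> \<le> measure \<nu> (D F)" by (rule D\<nu>[OF F])
    finally show ?thesis .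
  qed
  have \<nu>C: "\<theta> \<le> measure \<nu> (D C)"
    using D\<nu>[OF C C0] KC m by (simp add: m_def)
  have DF0: "D F \<noteq> {}" using \<nu>F \<kappa>0 by auto
  have DC0: "D C \<noteq> {}" using \<nu>C \<theta> Cpos by auto
  have Dthick: "{r. infdist r (D A) \<le> \<epsilon> / 2} \<subseteq> {r. infdist (a + r *\<^sub>R v) A \<le> \<epsilon>}"
    if A: "compact A" "A \<noteq> {}" "D A \<noteq> {}" for A
  proof clarify
    fix r assume r: "infdist r (D A) \<le> \<epsilon> / 2"
    obtain r' where r': "r' \<in> D A" "infdist r (D A) = dist r r'"
      using infdist_attains_inf[OF compact_imp_closed[OF Dc[OF A(1,2)]] A(3)] by blast
    have "infdist (a + r *\<^sub>R v) A \<le> infdist (a + r' *\<^sub>R v) A + dist (a + r *\<^sub>R v) (a + r' *\<^sub>R v)"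
      by (rule infdist_triangle)
    also have "dist (a + r *\<^sub>R v) (a + r' *\<^sub>R v) = dist r r'"
      using v by (simp add: dist_norm flip: scaleR_diff_left)
    finally show "infdist (a + r *\<^sub>R v) A \<le> \<epsilon>" using r r' by (simp add: D_def)
  qed
  have \<nu>sp: "sparse_near l' {r. infdist r (D F) \<le> \<epsilon> / 2} {r. infdist r (D C) \<le> \<epsilon> / 2}"
    using cl[of F] by (intro sparse_near_mono[OF thick[OF v] Dthick[OF F DF0] Dthick[OF C C0 DC0]]) auto
  have slab: "compact (K \<inter> {x. \<rho> x \<in> {p..q}})" for p q
  proof -
    have "closed {x. \<rho> x \<in> {p..q}}"
      using closed_vimage[OF closed_atLeastAtMost \<rho>c] by (simp add: vimage_def)
    then show ?thesis using K by (intro compact_Int_closed)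
  qed
  obtain RK where RK: "\<And>x. x \<in> K \<Longrightarrow> \<bar>\<rho> x\<bar> \<le> RK"
  proof -
    have "compact (\<rho> ` K)" using K \<rho>c by (intro compact_continuous_image)
    then show ?thesis using that compact_imp_bounded by (force simp: bounded_iff)
  qed
  have "measure \<nu> (D F) \<le> 1 - pmean s l' (measure \<nu> (D C)) 1"
  proof (rule sparse_bound_interval_concave[OF \<nu>p \<nu>sets _ _ _ Dc[OF C C0] Dc[OF F] _ \<nu>sp])
    fix k p1 q1 p2 q2 :: real
    assume k: "0 \<le> k" "k \<le> 1" and "p1 \<le> q1" "p2 \<le> q2"
      and pos: "0 < measure \<nu> {p1..q1}" "0 < measure \<nu> {p2..q2}"
    \<comment> \<open>Preimages of intervals are slabs of the convex set \<open>K\<close>. The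
      projection is affine, so combinations of points of two slabs lie in the slab over the combined
      interval.\<close>
    define A where "A = K \<inter> {x. \<rho> x \<in> {p1..q1}}"
    define B where "B = K \<inter> {x. \<rho> x \<in> {p2..q2}}"
    define E where "E = K \<inter> {x. \<rho> x \<in> {k * p1 + (1 - k) * p2..k * q1 + (1 - k) * q2}}"
    have AB: "measure \<nu> {p1..q1} = (1 / m) * measure M A" "measure \<nu> {p2..q2} = (1 / m) * measure M B"
      unfolding A_def B_def by (simp_all add: \<nu>)
    have pos': "0 < measure M A" "0 < measure M B" using pos m unfolding AB by (simp_all add: zero_less_mult_iff zero_less_divide_iff)
    have "pmean s k (measure M A) (measure M B) \<le> measure M {k *\<^sub>R x + (1 - k) *\<^sub>R y | x y. x \<in> A \<and> y \<in> B}"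
      using slab pos' k by (intro s_concave_pmean[OF sc]) (auto simp: A_def B_def)
    also have "\<dots> \<le> measure M E"
    proof (rule finite_measure_mono)
      show "E \<in> events" using slab unfolding E_def by (simp add: sets borel_compact)
      show "{k *\<^sub>R x + (1 - k) *\<^sub>R y | x y. x \<in> A \<and> y \<in> B} \<subseteq> E"
      proof clarify
        fix x y assume x: "x \<in> A" and y: "y \<in> B"
        have "k *\<^sub>R x + (1 - k) *\<^sub>R y \<in> K"
          using x y k K(2) by (intro convexD) (auto simp: A_def B_def)
        moreover have "\<rho> (k *\<^sub>R x + (1 - k) *\<^sub>R y) = k * \<rho> x + (1 - k) * \<rho> y"
          by (simp add: \<rho>_def algebra_simps)
        ultimately show "k *\<^sub>R x + (1 - k) *\<^sub>R y \<in> E"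
          using x y k by (auto simp: E_def A_def B_def intro!: add_mono mult_left_mono)
      qed
    qed
    finally have "(1 / m) * pmean s k (measure M A) (measure M B) \<le> (1 / m) * measure M E"
      using m by (intro mult_left_mono) auto
    also have "(1 / m) * measure M E = measure \<nu> {k * p1 + (1 - k) * p2..k * q1 + (1 - k) * q2}"
      unfolding E_def by (simp add: \<nu>)
    finally show "pmean s k (measure \<nu> {p1..q1}) (measure \<nu> {p2..q2})
        \<le> measure \<nu> {k * p1 + (1 - k) * p2..k * q1 + (1 - k) * q2}"
      unfolding AB using pmean_scale[of "1 / m" "measure M A" "measure M B" k s] m pos' k by simp
  next
    fix c
    \<comment> \<open>The level sets of the projection are hyperplane slices, so an atom would have
      full mass and lie in both \<open>D F\<close> and \<open>D C\<close>, against sparseness on a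
      short interval around it.\<close>
    have c: "K \<inter> {x. \<rho> x \<in> {c}} = {x\<in>K. v \<bullet> x = c + v \<bullet> a}"
      by (auto simp: \<rho>_def inner_diff_left inner_diff_right inner_commute algebra_simps)
    have dich: "measure M (K \<inter> {x. \<rho> x \<in> {c}}) = 0 \<or> measure M (K \<inter> {x. \<rho> x \<in> {c}}) = m"
      using s_concave_hyperplane_dichotomy[OF finite_measure_axioms sets sc] K
      unfolding c m_def hyperplane_dichotomy_def by blast
    show "measure \<nu> {c} = 0"
    proof (rule ccontr)
      assume "measure \<nu> {c} \<noteq> 0"
      then have one: "measure \<nu> {c} = 1" using dich m by (auto simp: \<nu>)
      interpret nu: prob_space \<nu> by (rule \<nu>p)
      have inD: "c \<in> D A" if "0 < measure \<nu> (D A)" "D A \<in> sets borel" for A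
      proof (rule ccontr)
        assume "c \<notin> D A"
        then have "measure \<nu> ({c} \<union> D A) = measure \<nu> {c} + measure \<nu> (D A)"
          using that by (intro nu.finite_measure_Union) (auto simp: \<nu>sets)
        then show False using one that nu.prob_le_1[of "{c} \<union> D A"] by simp
      qed
      have cF: "c \<in> D F" using \<nu>F \<kappa>0 Dc[OF F] by (intro inD) (auto simp: borel_compact)
      have cC: "c \<in> D C" using \<nu>C \<theta> Cpos Dc[OF C C0] by (intro inD) (auto simp: borel_compact)
      have "emeasure lborel ({r. infdist r (D F) \<le> \<epsilon> / 2} \<inter> {c - \<epsilon> / 2..c + \<epsilon> / 2}) \<le> ennreal (l' * ((c + \<epsilon> / 2) - (c - \<epsilon> / 2)))"
        using cC \<epsilon> by (intro sparse_nearD[OF \<nu>sp, of _ c]) (auto simp: infdist_zero)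
      moreover have "{r. infdist r (D F) \<le> \<epsilon> / 2} \<inter> {c - \<epsilon> / 2..c + \<epsilon> / 2} = {c - \<epsilon> / 2..c + \<epsilon> / 2}"
      proof -
        have "infdist r (D F) \<le> \<epsilon> / 2" if "c - \<epsilon> / 2 \<le> r" "r \<le> c + \<epsilon> / 2" for r
          using that by (intro infdist_le2[OF cF], unfold dist_real_def) linarith
        then show ?thesis by auto
      qed
      ultimately have "\<epsilon> \<le> l' * \<epsilon>" using \<epsilon> l by (simp add: ennreal_le_iff)
      then show False using \<epsilon> l by simp
    qed
  next
    have "K \<inter> {x. \<rho> x \<in> {- RK..RK}} = K" using RK by (auto simp: abs_le_iff minus_le_iff)
    then show "measure \<nu> {- RK..RK} = 1" using m by (simp add: \<nu> m_def)
  qed (use \<epsilon> l s \<nu>C \<theta> Cpos DF0 in auto)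
  also have "\<dots> \<le> \<kappa>"
    using pmean_mono[of "measure M C" "measure \<nu> (D C)" 1 1 l' s] Cpos \<nu>C \<theta> l by (simp add: \<kappa>_def)
  finally show False using \<nu>F by simp
qed

text \<open>Continuity of the mean in its weight removes the margin between \<open>l\<close> and
  \<open>l'\<close>.\<close>

lemma s_concave_line_sparse:
  fixes M :: "(real ^ 'n) measure"
  assumes prob: "prob_space M" and sets: "sets M = sets borel" and sc: "s_concave s M" and s: "s \<le> 1"
    and C: "compact C" and F: "compact F" and disj: "F \<inter> C = {}" and Cpos: "0 < measure M C"
    and l: "0 < l" "l < 1" and sp: "line_sparse l F C"
  shows "measure M F \<le> 1 - pmean s l (measure M C) 1"
proof (cases "F = {}")
  case True
  interpret prob_space M by (rule prob)
  have "pmean s l (measure M C) 1 \<le> 1"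
    using pmean_le_max[of "measure M C" 1 l s] prob_le_1[of C] Cpos l by simp
  then show ?thesis using True by simp
next
  case False
  have "isCont (\<lambda>l. pmean s l (measure M C) 1) l" using Cpos l by (intro isCont_pmean_weight) auto
  then have "((\<lambda>l. pmean s l (measure M C) 1) \<longlongrightarrow> pmean s l (measure M C) 1) (at l)"
    by (simp only: isCont_def)
  then have "((\<lambda>l. pmean s l (measure M C) 1) \<longlongrightarrow> pmean s l (measure M C) 1) (at_right l)"
    by (rule tendsto_within_subset) simp
  then have lim: "((\<lambda>l. 1 - pmean s l (measure M C) 1) \<longlongrightarrow> 1 - pmean s l (measure M C) 1) (at_right l)"
    by (intro tendsto_diff tendsto_const)
  show ?thesis
  proof (rule tendsto_lowerbound[OF lim])
    show "\<forall>\<^sub>F l' in at_right l. measure M F \<le> 1 - pmean s l' (measure M C) 1"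
      unfolding eventually_at_right_field
      using s_concave_line_sparse_strict[OF prob sets sc s C F False disj Cpos l(1) _ _ sp] l
      by (intro exI[of _ 1]) auto
  qed simp
qed

section \<open>Measurability of projections\<close>

lemma tendsto_fun_iff:
  fixes f :: "nat \<Rightarrow> 'i \<Rightarrow> 'a::topological_space"
  shows "f \<longlonglongrightarrow> g \<longleftrightarrow> (\<forall>i. (\<lambda>n. f n i) \<longlonglongrightarrow> g i)"
  using limitin_componentwise[of "\<lambda>_. euclidean" UNIV f g sequentially]
  by (simp add: euclidean_product_topology)

lemma compact_nat_box: "compact {\<sigma> :: nat \<Rightarrow> nat. \<forall>i. \<sigma> i \<le> m i}"
proof -
  have "compactin (product_topology (\<lambda>i. euclidean) UNIV) (PiE UNIV (\<lambda>i. {..m i}))"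
    unfolding compactin_PiE by (auto intro: finite_imp_compact)
  moreover have "PiE UNIV (\<lambda>i. {..m i}) = {\<sigma>. \<forall>i. \<sigma> i \<le> m i}"
    by (auto simp: PiE_UNIV_domain)
  ultimately show ?thesis by (simp add: euclidean_product_topology)
qed

text \<open>The analytic sets, as projections of closed sets along the Baire space:
  \<open>nat \<Rightarrow> nat\<close> carries the product topology with discrete factors.\<close>

definition souslin :: "'a::metric_space set \<Rightarrow> bool" where
  "souslin S \<longleftrightarrow> (\<exists>E :: ('a \<times> (nat \<Rightarrow> nat)) set. closed E \<and> S = fst ` E)"

lemma souslin_closed: "closed S \<Longrightarrow> souslin S"
  unfolding souslin_def by (intro exI[of _ "S \<times> UNIV"]) (auto intro: closed_Times)

text \<open>The sequence announces the index \<open>n\<close> in its term 0; the shifted sequence is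
  the witness for \<open>S n\<close>.\<close>

lemma souslin_UN:
  fixes S :: "nat \<Rightarrow> 'a::metric_space set"
  assumes "\<And>n. souslin (S n)"
  shows "souslin (\<Union>n. S n)"
proof -
  obtain E :: "nat \<Rightarrow> ('a \<times> (nat \<Rightarrow> nat)) set" where E: "\<And>n. closed (E n)" "\<And>n. S n = fst ` E n"
    using assms unfolding souslin_def by metis
  define G where "G = (\<Inter>n. {p. snd p 0 \<in> - {n}} \<union> {p :: 'a \<times> (nat \<Rightarrow> nat). (fst p, \<lambda>k. snd p (Suc k)) \<in> E n})"
  have "closed G"
    unfolding G_def
  proof (intro closed_INT ballI closed_Un)
    fix n :: nat
    have c: "continuous_on UNIV (\<lambda>p :: 'a \<times> (nat \<Rightarrow> nat). snd p i)" for i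
      by (rule continuous_on_product_then_coordinatewise) (intro continuous_intros)
    have "closed (- {n})" by (simp add: closed_def open_discrete)
    from closed_vimage[OF this c[of 0]] show "closed {p :: 'a \<times> (nat \<Rightarrow> nat). snd p 0 \<in> - {n}}"
      by (simp add: vimage_def)
    have "continuous_on UNIV (\<lambda>p :: 'a \<times> (nat \<Rightarrow> nat). (fst p, \<lambda>k. snd p (Suc k)))"
      by (intro continuous_intros c)
    from closed_vimage[OF E(1) this] show "closed {p :: 'a \<times> (nat \<Rightarrow> nat). (fst p, \<lambda>k. snd p (Suc k)) \<in> E n}"
      by (simp add: vimage_def)
  qed
  moreover have "(\<Union>n. S n) = fst ` G"
  proof (intro set_eqI iffI)
    fix x assume "x \<in> (\<Union>n. S n)"
    then obtain n \<sigma> where n: "(x, \<sigma>) \<in> E n" unfolding E(2) by force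
    have "(x, \<lambda>k. case k of 0 \<Rightarrow> n | Suc j \<Rightarrow> \<sigma> j) \<in> G" using n by (auto simp: G_def)
    then show "x \<in> fst ` G" by force
  next
    fix x assume "x \<in> fst ` G"
    then obtain \<sigma> where "(x, \<sigma>) \<in> G" by auto
    then have "(x, \<lambda>k. \<sigma> (Suc k)) \<in> E (\<sigma> 0)" by (auto simp: G_def)
    then show "x \<in> (\<Union>n. S n)" unfolding E(2) by force
  qed
  ultimately show ?thesis unfolding souslin_def by blast
qed

text \<open>One sequence codes a witness for every \<open>S n\<close> through
  \<open>prod_encode\<close>.\<close>

lemma souslin_INT:
  fixes S :: "nat \<Rightarrow> 'a::metric_space set"
  assumes "\<And>n. souslin (S n)"
  shows "souslin (\<Inter>n. S n)"
proof -
  obtain E :: "nat \<Rightarrow> ('a \<times> (nat \<Rightarrow> nat)) set" where E: "\<And>n. closed (E n)" "\<And>n. S n = fst ` E n"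
    using assms unfolding souslin_def by metis
  define G where "G = (\<Inter>n. {p :: 'a \<times> (nat \<Rightarrow> nat). (fst p, \<lambda>k. snd p (prod_encode (n, k))) \<in> E n})"
  have "closed G"
    unfolding G_def
  proof (intro closed_INT ballI)
    fix n
    have c: "continuous_on UNIV (\<lambda>p :: 'a \<times> (nat \<Rightarrow> nat). snd p i)" for i
      by (rule continuous_on_product_then_coordinatewise) (intro continuous_intros)
    have "continuous_on UNIV (\<lambda>p :: 'a \<times> (nat \<Rightarrow> nat). (fst p, \<lambda>k. snd p (prod_encode (n, k))))"
      by (intro continuous_intros c)
    from closed_vimage[OF E(1) this] show "closed {p :: 'a \<times> (nat \<Rightarrow> nat). (fst p, \<lambda>k. snd p (prod_encode (n, k))) \<in> E n}"
      by (simp add: vimage_def)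
  qed
  moreover have "(\<Inter>n. S n) = fst ` G"
  proof (intro set_eqI iffI)
    fix x assume "x \<in> (\<Inter>n. S n)"
    then have "\<forall>n. \<exists>\<sigma>. (x, \<sigma>) \<in> E n" unfolding E(2) by force
    then obtain \<sigma> where \<sigma>: "\<And>n. (x, \<sigma> n) \<in> E n" by metis
    have "(x, \<lambda>m. \<sigma> (fst (prod_decode m)) (snd (prod_decode m))) \<in> G" using \<sigma> by (simp add: G_def)
    then show "x \<in> fst ` G" by force
  next
    fix x assume "x \<in> fst ` G"
    then obtain \<sigma> where "(x, \<sigma>) \<in> G" by auto
    then have "(x, \<lambda>k. \<sigma> (prod_encode (n, k))) \<in> E n" for n by (auto simp: G_def)
    then show "x \<in> (\<Inter>n. S n)" unfolding E(2) by force
  qed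
  ultimately show ?thesis unfolding souslin_def by blast
qed

lemma souslin_open:
  fixes S :: "'a::metric_space set"
  assumes "open S"
  shows "souslin S"
proof (cases "S = UNIV")
  case False
  have "S = (\<Union>n. {x. 1 / real (Suc n) \<le> infdist x (- S)})"
  proof (intro set_eqI iffI)
    fix x assume "x \<in> S"
    then have "infdist x (- S) \<noteq> 0"
      using in_closed_iff_infdist_zero[of "- S" x] False assms by auto
    then have "0 < infdist x (- S)" using infdist_nonneg[of x "- S"] by simp
    then obtain n where "1 / real (Suc n) < infdist x (- S)" using nat_approx_posE by blast
    then show "x \<in> (\<Union>n. {x. 1 / real (Suc n) \<le> infdist x (- S)})"
      by (intro UN_I[of n]) auto
  next
    fix x assume "x \<in> (\<Union>n. {x. 1 / real (Suc n) \<le> infdist x (- S)})"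
    then obtain n where n: "1 / real (Suc n) \<le> infdist x (- S)" by auto
    show "x \<in> S"
    proof (rule ccontr)
      assume "x \<notin> S"
      then have "infdist x (- S) = 0" by simp
      moreover have "0 < 1 / real (Suc n)" by simp
      ultimately show False using n by linarith
    qed
  qed
  moreover have "souslin (\<Union>n. {x. 1 / real (Suc n) \<le> infdist x (- S)})"
    by (intro souslin_UN souslin_closed closed_Collect_le continuous_intros)
  ultimately show ?thesis by simp
qed (simp add: souslin_closed)

lemma souslin_borel:
  fixes S :: "'a::metric_space set"
  assumes "S \<in> sets borel"
  shows "souslin S"
proof -
  have "S \<in> sigma_sets UNIV (Collect closed)"
    using assms by (simp add: borel_eq_closed)
  \<comment> \<open>Complements of analytic sets need not be analytic, so the induction carries the
    complement along, for which unions become intersections.\<close>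
  then have "souslin S \<and> souslin (- S)"
  proof (induction rule: sigma_sets.induct)
    case (Basic A)
    then show ?case using souslin_closed souslin_open[of "- A"] by auto
  next
    case Empty
    then show ?case by (simp add: souslin_closed)
  next
    case (Compl A)
    then show ?case by (simp add: Compl_eq_Diff_UNIV[symmetric])
  next
    case (Union A)
    then show ?case using souslin_UN[of A] souslin_INT[of "\<lambda>n. - A n"] by (simp add: Compl_UN)
  qed
  then show ?thesis by simp
qed

text \<open>Choquet's capacitability argument: bounding the auxiliary coordinates one after another costs
  arbitrarily little outer measure, and bounding all of them leaves a set of compact type.\<close>

lemma souslin_projection_closed_subset:
  fixes M :: "'a::euclidean_space measure" and E :: "(('a \<times> 'b::euclidean_space) \<times> (nat \<Rightarrow> nat)) set"
  assumes "finite_measure M" and sets: "sets M = sets borel" and E: "closed E"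
    and t: "t < outer_measure_of M (fst ` fst ` E)"
  obtains N where "closed N" "N \<subseteq> fst ` fst ` E" "t \<le> emeasure M N"
proof -
  interpret finite_measure M by fact
  have space: "space M = UNIV" using sets_eq_imp_space_eq[OF sets] by simp
  \<comment> \<open>Coordinate 0 bounds the norm of the Euclidean component \<open>y\<close> and the
    others are the terms of \<open>\<sigma>\<close>, so one bounding sequence \<open>m\<close>
    confines both to a compact set.\<close>
  define c where "c y \<sigma> i = (case i of 0 \<Rightarrow> nat \<lceil>norm y\<rceil> | Suc j \<Rightarrow> \<sigma> j)" for y :: 'b and \<sigma> :: "nat \<Rightarrow> nat" and i
  define A where "A k m = {x. \<exists>y \<sigma>. ((x, y), \<sigma>) \<in> E \<and> (\<forall>i<k. c y \<sigma> i \<le> m i)}" for k and m :: "nat \<Rightarrow> nat"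
  have A0: "A 0 m = fst ` fst ` E" for m by (force simp: A_def)
  have Acong: "A k m = A k m'" if "\<And>i. i < k \<Longrightarrow> m i = m' i" for k m m'
    using that by (simp add: A_def)
  \<comment> \<open>Raising the bound on coordinate \<open>k\<close> exhausts \<open>A k m\<close>,
    and outer measure is continuous along increasing sequences of arbitrary sets.\<close>
  have step: "\<exists>v. t < outer_measure_of M (A (Suc k) (m(k := v)))" if k: "t < outer_measure_of M (A k m)" for k m
  proof -
    have "incseq (\<lambda>v. A (Suc k) (m(k := v)))"
    proof (intro incseq_SucI subsetI)
      fix v x assume "x \<in> A (Suc k) (m(k := v))"
      then obtain y \<sigma> where "((x, y), \<sigma>) \<in> E" "\<forall>i<Suc k. c y \<sigma> i \<le> (m(k := v)) i"
        unfolding A_def by auto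
      then show "x \<in> A (Suc k) (m(k := Suc v))"
        unfolding A_def by (intro CollectI exI[of _ y] exI[of _ \<sigma>]) (auto simp: less_Suc_eq le_SucI)
    qed
    then have "(SUP v. outer_measure_of M (A (Suc k) (m(k := v)))) = outer_measure_of M (\<Union>v. A (Suc k) (m(k := v)))"
      by (intro SUP_outer_measure_of_incseq) (auto simp: space)
    also have "(\<Union>v. A (Suc k) (m(k := v))) = A k m"
    proof (intro set_eqI iffI)
      fix x assume "x \<in> A k m"
      then obtain y \<sigma> where "((x, y), \<sigma>) \<in> E" "\<forall>i<k. c y \<sigma> i \<le> m i" unfolding A_def by auto
      then have "x \<in> A (Suc k) (m(k := c y \<sigma> k))"
        unfolding A_def by (intro CollectI exI[of _ y] exI[of _ \<sigma>]) (auto simp: less_Suc_eq)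
      then show "x \<in> (\<Union>v. A (Suc k) (m(k := v)))" by blast
    next
      fix x assume "x \<in> (\<Union>v. A (Suc k) (m(k := v)))"
      then obtain v y \<sigma> where *: "((x, y), \<sigma>) \<in> E" "\<forall>i<Suc k. c y \<sigma> i \<le> (m(k := v)) i"
        unfolding A_def by auto
      have "c y \<sigma> i \<le> m i" if "i < k" for i using *(2)[rule_format, of i] that by simp
      then show "x \<in> A k m" using *(1) unfolding A_def by blast
    qed
    finally have "t < (SUP v. outer_measure_of M (A (Suc k) (m(k := v))))" using k by (simp only:)
    then show ?thesis by (auto simp: less_SUP_iff)
  qed
  have "\<exists>f. \<forall>k. t < outer_measure_of M (A k (f k)) \<and> (\<forall>i<k. f (Suc k) i = f k i)"
  proof (rule dependent_nat_choice)
    show "\<exists>m. t < outer_measure_of M (A 0 m)" using t by (simp add: A0)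
    fix m k assume "t < outer_measure_of M (A k m)"
    then obtain v where "t < outer_measure_of M (A (Suc k) (m(k := v)))" using step by blast
    then show "\<exists>m'. t < outer_measure_of M (A (Suc k) m') \<and> (\<forall>i<k. m' i = m i)"
      by (intro exI[of _ "m(k := v)"]) auto
  qed
  then obtain f where f: "\<And>k. t < outer_measure_of M (A k (f k))" "\<And>k i. i < k \<Longrightarrow> f (Suc k) i = f k i" by blast
  define m where "m i = f (Suc i) i" for i
  have fm: "i < k \<Longrightarrow> f k i = m i" for k i
  proof (induction k)
    case (Suc k)
    then show ?case using f(2)[of i k] by (cases "i = k") (auto simp: m_def)
  qed simp
  have tA: "t < outer_measure_of M (A k m)" for k
    using f(1)[of k] Acong[of k "f k" m] fm by simp
  have Adec: "A (Suc k) m \<subseteq> A k m" for k unfolding A_def by (auto simp: less_Suc_eq)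
  define N where "N = (\<Inter>k. closure (A k m))"
  have "closed N" unfolding N_def by auto
  moreover have "t \<le> emeasure M N"
  proof -
    have "(\<lambda>k. emeasure M (closure (A k m))) \<longlonglongrightarrow> emeasure M N"
      unfolding N_def
    proof (rule Lim_emeasure_decseq)
      show "decseq (\<lambda>k. closure (A k m))"
        using Adec by (intro decseq_SucI closure_mono)
    qed (auto simp: sets emeasure_eq_measure)
    moreover have "t \<le> emeasure M (closure (A k m))" for k
    proof -
      have "outer_measure_of M (A k m) \<le> outer_measure_of M (closure (A k m))"
        by (intro outer_measure_of_mono closure_subset)
      also have "\<dots> = emeasure M (closure (A k m))" by (simp add: sets)
      finally show ?thesis using tA[of k] by simp
    qed
    ultimately show ?thesis by (intro LIMSEQ_le_const) auto
  qed
  moreover have "N \<subseteq> fst ` fst ` E"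
  proof
    fix x assume x: "x \<in> N"
    have "\<exists>z y \<sigma>. dist z x < 1 / real (Suc k) \<and> ((z, y), \<sigma>) \<in> E \<and> (\<forall>i<Suc k. c y \<sigma> i \<le> m i)" for k
    proof -
      have "x \<in> closure (A (Suc k) m)" using x by (auto simp: N_def)
      then obtain z where "z \<in> A (Suc k) m" "dist z x < 1 / real (Suc k)"
        unfolding closure_approachable by (meson of_nat_0_less_iff zero_less_Suc zero_less_divide_1_iff)
      then show ?thesis unfolding A_def by blast
    qed
    then obtain z y \<sigma> where zx: "\<And>k. dist (z k) x < 1 / real (Suc k)"
      and zE: "\<And>k. ((z k, y k), \<sigma> k) \<in> E" and cm: "\<And>k i. i < Suc k \<Longrightarrow> c (y k) (\<sigma> k) i \<le> m i"
      by metis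
    \<comment> \<open>\<open>\<sigma> k\<close> obeys only finitely many of the bounds. Truncation
      puts it into the compact box and, in each fixed coordinate, changes nothing for large
      \<open>k\<close>.\<close>
    define \<tau> where "\<tau> k i = min (\<sigma> k i) (m (Suc i))" for k i
    have y: "norm (y k) \<le> real (m 0)" for k
    proof -
      have "nat \<lceil>norm (y k)\<rceil> \<le> m 0" using cm[of 0 k] by (simp add: c_def)
      then show ?thesis by linarith
    qed
    have "compact (cball (0::'b) (real (m 0)) \<times> {\<sigma>. \<forall>i. \<sigma> i \<le> m (Suc i)})"
      by (intro compact_Times compact_cball compact_nat_box)
    then have sc: "seq_compact (cball (0::'b) (real (m 0)) \<times> {\<sigma>. \<forall>i. \<sigma> i \<le> m (Suc i)})"
      by (rule compact_imp_seq_compact)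
    have mem: "\<forall>k. (y k, \<tau> k) \<in> cball (0::'b) (real (m 0)) \<times> {\<sigma>. \<forall>i. \<sigma> i \<le> m (Suc i)}"
      using y by (auto simp: \<tau>_def)
    obtain w h where h: "strict_mono h" "((\<lambda>k. (y k, \<tau> k)) \<circ> h) \<longlonglongrightarrow> w"
      by (rule seq_compactE[OF sc mem])
    have ylim: "(\<lambda>k. y (h k)) \<longlonglongrightarrow> fst w" using tendsto_fst[OF h(2)] by (simp add: comp_def)
    have \<tau>lim: "(\<lambda>k. \<tau> (h k)) \<longlonglongrightarrow> snd w" using tendsto_snd[OF h(2)] by (simp add: comp_def)
    have "(\<lambda>k. \<sigma> (h k)) \<longlonglongrightarrow> snd w"
      unfolding tendsto_fun_iff
    proof
      fix i
      have "\<forall>\<^sub>F k in sequentially. \<tau> (h k) i = \<sigma> (h k) i"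
        unfolding eventually_sequentially
      proof (intro exI allI impI)
        fix k assume "Suc i \<le> k"
        then have "Suc i < Suc (h k)" using seq_suble[OF h(1), of k] by simp
        then have "\<sigma> (h k) i \<le> m (Suc i)" using cm[of "Suc i" "h k"] by (simp add: c_def)
        then show "\<tau> (h k) i = \<sigma> (h k) i" by (simp add: \<tau>_def)
      qed
      moreover have "(\<lambda>k. \<tau> (h k) i) \<longlonglongrightarrow> snd w i" using \<tau>lim unfolding tendsto_fun_iff by simp
      ultimately show "(\<lambda>k. \<sigma> (h k) i) \<longlonglongrightarrow> snd w i" by (rule Lim_transform_eventually[rotated])
    qed
    moreover have "z \<longlonglongrightarrow> x"
    proof (rule metric_tendsto_imp_tendsto[OF LIMSEQ_Suc[OF lim_1_over_n]])
      show "\<forall>\<^sub>F k in sequentially. dist (z k) x \<le> dist (1 / real (Suc k)) 0"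
        using zx by (intro always_eventually) (auto simp: less_imp_le)
    qed
    then have "(\<lambda>k. z (h k)) \<longlonglongrightarrow> x" using LIMSEQ_subseq_LIMSEQ[OF _ h(1)] by (simp add: comp_def)
    ultimately have "(\<lambda>k. ((z (h k), y (h k)), \<sigma> (h k))) \<longlonglongrightarrow> ((x, fst w), snd w)"
      using ylim by (intro tendsto_Pair)
    from closed_sequentially[OF E _ this] have "((x, fst w), snd w) \<in> E"
      using zE by simp
    then show "x \<in> fst ` fst ` E" by force
  qed
  ultimately show thesis using that by blast
qed

text \<open>The projection contains closed sets of measure arbitrarily close to its outer measure.
  Together with a measurable hull \<open>H\<close> this traps it between two Borel sets of equal
  measure.\<close>

lemma measurable_projection:
  fixes M :: "'a::euclidean_space measure" and B :: "('a \<times> 'b::euclidean_space) set"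
  assumes "finite_measure M" and sets: "sets M = sets borel" and B: "B \<in> sets borel"
  shows "fst ` B \<in> sets (completion M)"
proof -
  interpret finite_measure M by fact
  have space: "space M = UNIV" using sets_eq_imp_space_eq[OF sets] by simp
  obtain E :: "(('a \<times> 'b) \<times> (nat \<Rightarrow> nat)) set" where E: "closed E" "B = fst ` E"
    using souslin_borel[OF B] unfolding souslin_def by blast
  define S where "S = fst ` B"
  obtain H where H: "H \<in> sets M" "S \<subseteq> H" "outer_measure_of M S = emeasure M H"
    using outer_measure_of_attain[of S M] by (auto simp: space)
  have "\<exists>N. closed N \<and> N \<subseteq> S \<and> emeasure M H \<le> emeasure M N + ennreal (1 / real (Suc n))" for n
  proof (cases "emeasure M H = 0")
    case True
    then show ?thesis by (intro exI[of _ "{}"]) simp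
  next
    case False
    define t where "t = measure M H - 1 / real (Suc n)"
    have "0 < measure M H" using False by (simp add: emeasure_eq_measure zero_less_measure_iff)
    \<comment> \<open>\<open>t\<close> may be negative, and then \<open>ennreal t\<close> is 0;
      positivity of the mass keeps the inequality strict.\<close>
    then have "ennreal t < emeasure M H"
      unfolding emeasure_eq_measure by (intro ennreal_lessI) (simp_all add: t_def)
    then have "ennreal t < outer_measure_of M (fst ` fst ` E)" using H(3) by (simp add: S_def E(2))
    from souslin_projection_closed_subset[OF assms(1) sets E(1) this] obtain N where
      N: "closed N" "N \<subseteq> fst ` fst ` E" "ennreal t \<le> emeasure M N" by blast
    then have "t \<le> measure M N" by (simp add: emeasure_eq_measure)
    then have "emeasure M H \<le> emeasure M N + ennreal (1 / real (Suc n))"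
      by (simp add: t_def emeasure_eq_measure ennreal_plus[symmetric] del: ennreal_plus)
    then show ?thesis
      using N unfolding S_def E(2) by blast
  qed
  then obtain N where N: "\<And>n. closed (N n)" "\<And>n. N n \<subseteq> S"
    "\<And>n. emeasure M H \<le> emeasure M (N n) + ennreal (1 / real (Suc n))" by metis
  define L where "L = (\<Union>n. N n)"
  have L: "L \<in> sets M" unfolding L_def using N(1) by (auto simp: sets)
  have LS: "L \<subseteq> S" using N(2) by (auto simp: L_def)
  have "measure M H \<le> measure M L + 1 / real (Suc n)" for n
  proof -
    have "measure M H \<le> measure M (N n) + 1 / real (Suc n)"
      using N(3)[of n] by (simp add: emeasure_eq_measure ennreal_plus[symmetric] del: ennreal_plus)
    also have "measure M (N n) \<le> measure M L"
      using N(1) L by (intro finite_measure_mono) (auto simp: L_def)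
    finally show ?thesis by simp
  qed
  then have "measure M H \<le> measure M L + 0"
    by (intro LIMSEQ_le_const[OF tendsto_add[OF tendsto_const LIMSEQ_Suc[OF lim_1_over_n]]]) auto
  then have "measure M (H - L) = 0"
    using finite_measure_Diff[OF H(1) L] LS H(2) measure_nonneg[of M "H - L"] by (simp add: subset_trans)
  then have "H - L \<in> null_sets M" using H(1) L by (auto simp: null_sets_def emeasure_eq_measure)
  then have "S - L \<in> sets (completion M)" using H(2) by (intro sets_completionI_sub) auto
  moreover have "S = L \<union> (S - L)" using LS by auto
  ultimately show ?thesis unfolding S_def[symmetric] using L by (metis sets.Un sets_completionI_sets)
qed

section \<open>Dilations\<close>

lemma line_measure_eq:
  fixes a v :: "real ^ 'n"
  assumes "S \<in> sets borel"
  shows "emeasure (line_measure a v) S = emeasure lborel {r. a + r *\<^sub>R v \<in> S}"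
proof -
  have "(\<lambda>r. a + r *\<^sub>R v) \<in> borel_measurable borel"
    by (intro borel_measurable_continuous_onI continuous_intros)
  then show ?thesis
    unfolding line_measure_def using assms by (subst emeasure_distr) (auto simp: vimage_def)
qed

lemma line_preimage_borel:
  fixes a v :: "'a::euclidean_space"
  assumes "S \<in> sets borel"
  shows "{r. a + r *\<^sub>R v \<in> S} \<in> sets (borel :: real measure)"
proof -
  have "(\<lambda>r::real. a + r *\<^sub>R v) \<in> borel_measurable borel"
    by (intro borel_measurable_continuous_onI continuous_intros)
  from measurable_sets[OF this assms] show ?thesis by (simp add: vimage_def)
qed

text \<open>Together with \<open>dilationE\<close> this replaces arbitrary intervals by compact ones
  on lines through \<open>x\<close>, so that membership is decided by the finite-dimensional data
  \<open>v\<close>, \<open>p\<close>, \<open>q\<close>.\<close>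

lemma dilationI:
  fixes a v :: "real ^ 'n"
  assumes F: "F \<in> sets borel" and v: "norm v = 1" and p: "p \<le> 0" "0 \<le> q"
    and less: "ennreal (q - p) < ennreal ((t + 1) / 2) * emeasure lborel ({r. x + r *\<^sub>R v \<in> F} \<inter> {p..q})"
  shows "x \<in> dilation t F"
proof -
  define I where "I = (\<lambda>r. x + r *\<^sub>R v) ` {p..q}"
  have "v \<noteq> 0" using v by auto
  then have inj: "x + r *\<^sub>R v = x + r' *\<^sub>R v \<longleftrightarrow> r = r'" for r r' by simp
  have Ipre: "{r. x + r *\<^sub>R v \<in> I} = {p..q}" unfolding I_def using inj by (auto simp: image_iff)
  have "compact I" unfolding I_def by (intro compact_continuous_image continuous_intros compact_Icc)
  then have Ib: "I \<in> sets borel" by (rule borel_compact)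
  have "convex ((\<lambda>r. r *\<^sub>R v) ` {p..q})"
    by (intro convex_linear_image linear_scaleR_left convex_real_interval)
  moreover have "I = (\<lambda>y. x + y) ` ((\<lambda>r. r *\<^sub>R v) ` {p..q})" by (simp add: I_def image_image)
  ultimately have "convex I" by (simp add: convex_translation)
  moreover have "I \<subseteq> affine_line x v" by (auto simp: I_def affine_line_def)
  moreover have "x \<in> I" unfolding I_def using p by (intro image_eqI[of _ _ 0]) auto
  moreover have "{r. x + r *\<^sub>R v \<in> F \<inter> I} = {r. x + r *\<^sub>R v \<in> F} \<inter> {p..q}"
    using Ipre by blast
  then have "emeasure (line_measure x v) I < ennreal ((t + 1) / 2) * emeasure (line_measure x v) (F \<inter> I)"
    using less p Ib F by (simp add: line_measure_eq Ipre)
  ultimately show ?thesis unfolding dilation_def using v by blast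
qed

text \<open>The strict inequality survives cutting the interval down to a large bounded piece around
  \<open>x\<close>, by continuity of measure, and closing that piece up, since end points have no
  length.\<close>

lemma dilationE:
  fixes F :: "(real ^ 'n) set"
  assumes F: "F \<in> sets borel" and x: "x \<in> dilation t F"
  obtains v p q where "norm v = 1" "p \<le> 0" "0 \<le> q"
    "ennreal (q - p) < ennreal ((t + 1) / 2) * emeasure lborel ({r. x + r *\<^sub>R v \<in> F} \<inter> {p..q})"
proof -
  obtain a v I where v: "norm v = 1" and I: "I \<subseteq> affine_line a v" "convex I" "x \<in> I"
    and less: "emeasure (line_measure a v) I < ennreal ((t + 1) / 2) * emeasure (line_measure a v) (F \<inter> I)"
    using x unfolding dilation_def by blast
  define J where "J = {r. a + r *\<^sub>R v \<in> I}"
  obtain r0 where r0: "x = a + r0 *\<^sub>R v" using I by (auto simp: affine_line_def)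
  have r0J: "r0 \<in> J" using r0 I by (simp add: J_def)
  have Jint: "r \<in> J" if r: "r1 \<in> J" "r2 \<in> J" "r1 \<le> r" "r \<le> r2" for r r1 r2
  proof (cases "r1 = r2")
    case False
    define k where "k = (r - r1) / (r2 - r1)"
    have k: "0 \<le> k" "k \<le> 1" using r False by (auto simp: k_def)
    have "k * (r2 - r1) = r - r1" using False by (simp add: k_def)
    then have rk: "r = (1 - k) * r1 + k * r2" by (simp add: algebra_simps)
    have "(1 - k) *\<^sub>R (a + r1 *\<^sub>R v) + k *\<^sub>R (a + r2 *\<^sub>R v) \<in> I"
      using r k I(2) by (intro convexD) (auto simp: J_def)
    moreover have "(1 - k) *\<^sub>R (a + r1 *\<^sub>R v) + k *\<^sub>R (a + r2 *\<^sub>R v) = a + r *\<^sub>R v"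
      by (simp add: rk algebra_simps)
    ultimately show ?thesis by (simp add: J_def)
  qed (use r in auto)
  have Jb: "J \<in> sets borel"
  proof (rule real_interval_borel_measurable, unfold is_interval_1, intro ballI allI impI)
    fix r1 r2 r assume "r1 \<in> J" "r2 \<in> J" "r1 \<le> r \<and> r \<le> r2"
    then show "r \<in> J" by (elim conjE) (rule Jint)
  qed
  \<comment> \<open>\<open>emeasure\<close> is 0 by default on sets that are not measurable, so the
    length of \<open>I\<close> can be computed on the parameter line only once \<open>I\<close> is
    known to be Borel.\<close>
  have Ib: "I \<in> sets borel"
  proof -
    have vv: "v \<bullet> v = 1" using v by (simp add: norm_eq_1)
    have "I = {y. (y - a) \<bullet> v \<in> J \<and> y = a + ((y - a) \<bullet> v) *\<^sub>R v}"
    proof (intro set_eqI iffI)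
      fix y assume "y \<in> I"
      then obtain r where "y = a + r *\<^sub>R v" using I by (auto simp: affine_line_def)
      then show "y \<in> {y. (y - a) \<bullet> v \<in> J \<and> y = a + ((y - a) \<bullet> v) *\<^sub>R v}"
        using \<open>y \<in> I\<close> vv by (simp add: J_def)
    next
      fix y assume "y \<in> {y. (y - a) \<bullet> v \<in> J \<and> y = a + ((y - a) \<bullet> v) *\<^sub>R v}"
      then have "a + ((y - a) \<bullet> v) *\<^sub>R v \<in> I" "y = a + ((y - a) \<bullet> v) *\<^sub>R v" by (auto simp: J_def)
      then show "y \<in> I" by simp
    qed
    also have "\<dots> = {y. (y - a) \<bullet> v \<in> J} \<inter> {y. y = a + ((y - a) \<bullet> v) *\<^sub>R v}" by auto
    also have "\<dots> \<in> sets borel"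
    proof (rule sets.Int)
      have "(\<lambda>y. (y - a) \<bullet> v) \<in> borel_measurable borel"
        by (intro borel_measurable_continuous_onI continuous_intros)
      from measurable_sets[OF this Jb] show "{y. (y - a) \<bullet> v \<in> J} \<in> sets borel" by (simp add: vimage_def)
      show "{y. y = a + ((y - a) \<bullet> v) *\<^sub>R v} \<in> sets borel"
        by (intro borel_closed closed_Collect_eq continuous_intros)
    qed
    finally show ?thesis .
  qed
  define G where "G = {r. a + r *\<^sub>R v \<in> F}"
  have Gb: "G \<in> sets borel" unfolding G_def by (rule line_preimage_borel[OF F])
  have "{r. a + r *\<^sub>R v \<in> F \<inter> I} = G \<inter> J" by (auto simp: G_def J_def)
  then have less': "emeasure lborel J < ennreal ((t + 1) / 2) * emeasure lborel (G \<inter> J)"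
    using less Ib F by (simp add: line_measure_eq flip: J_def)
  define Jn where "Jn n = J \<inter> {r0 - real n..r0 + real n}" for n
  have "(SUP n. emeasure lborel (G \<inter> Jn n)) = emeasure lborel (\<Union>n. G \<inter> Jn n)"
  proof (rule SUP_emeasure_incseq)
    show "range (\<lambda>n. G \<inter> Jn n) \<subseteq> sets lborel" using Gb Jb by (auto simp: Jn_def)
    show "incseq (\<lambda>n. G \<inter> Jn n)" by (intro incseq_SucI) (auto simp: Jn_def)
  qed
  also have "(\<Union>n. G \<inter> Jn n) = G \<inter> J"
  proof (intro set_eqI iffI)
    fix r assume r: "r \<in> G \<inter> J"
    obtain n where "\<bar>r - r0\<bar> \<le> real n" using real_arch_simple by blast
    then have "r \<in> G \<inter> Jn n" using r by (auto simp: Jn_def abs_le_iff)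
    then show "r \<in> (\<Union>n. G \<inter> Jn n)" by blast
  qed (auto simp: Jn_def)
  finally have "emeasure lborel J < ennreal ((t + 1) / 2) * (SUP n. emeasure lborel (G \<inter> Jn n))"
    using less' by (simp only:)
  also have "\<dots> = (SUP n. ennreal ((t + 1) / 2) * emeasure lborel (G \<inter> Jn n))"
    by (rule SUP_mult_left_ennreal)
  finally have "emeasure lborel J < (SUP n. ennreal ((t + 1) / 2) * emeasure lborel (G \<inter> Jn n))" .
  then obtain n where n: "emeasure lborel J < ennreal ((t + 1) / 2) * emeasure lborel (G \<inter> Jn n)"
    by (auto simp: less_SUP_iff)
  define p where "p = Inf (Jn n)"
  define q where "q = Sup (Jn n)"
  have ne: "Jn n \<noteq> {}" and r0n: "r0 \<in> Jn n" using r0J by (auto simp: Jn_def)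
  have bdd: "bdd_below (Jn n)" "bdd_above (Jn n)"
    by (rule bdd_belowI[of _ "r0 - real n"], simp add: Jn_def) (rule bdd_aboveI[of _ "r0 + real n"], simp add: Jn_def)
  have pq: "p \<le> r" "r \<le> q" if "r \<in> Jn n" for r
    using cInf_lower[OF that bdd(1)] cSup_upper[OF that bdd(2)] by (simp_all add: p_def q_def)
  have sup: "{p<..<q} \<subseteq> J"
  proof
    fix r assume r: "r \<in> {p<..<q}"
    obtain r1 where r1: "r1 \<in> Jn n" "r1 < r" using cInf_lessD[OF ne, of r] r unfolding p_def by auto
    obtain r2 where r2: "r2 \<in> Jn n" "r < r2" using less_cSupD[OF ne, of r] r unfolding q_def by auto
    show "r \<in> J" using Jint[of r1 r2 r] r1 r2 by (simp add: Jn_def)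
  qed
  have p0q: "p \<le> r0" "r0 \<le> q" using pq[OF r0n] .
  have "ennreal (q - p) = emeasure lborel {p<..<q}" using p0q by simp
  also have "\<dots> \<le> emeasure lborel J" using sup Jb by (intro emeasure_mono) auto
  also note n
  also have "ennreal ((t + 1) / 2) * emeasure lborel (G \<inter> Jn n) \<le> ennreal ((t + 1) / 2) * emeasure lborel (G \<inter> {p..q})"
    using pq Gb by (intro mult_left_mono emeasure_mono) auto
  also have "emeasure lborel (G \<inter> {p..q}) = emeasure lborel {r. r0 + r \<in> G \<inter> {p..q}}"
    using Gb by (intro emeasure_lborel_translate[symmetric]) auto
  also have "{r. r0 + r \<in> G \<inter> {p..q}} = {r. x + r *\<^sub>R v \<in> F} \<inter> {p - r0..q - r0}"
    by (auto simp: G_def r0 algebra_simps)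
  finally show thesis
    using p0q by (intro that[OF v, of "p - r0" "q - r0"]) auto
qed

text \<open>The admissible tuples \<open>(x, v, p, q)\<close> form a Borel set, because the length
  of the part of \<open>F\<close> on a segment is a Borel function of the tuple; the dilation is its
  projection to \<open>x\<close>.\<close>

lemma dilation_measurable:
  fixes M :: "(real ^ 'n) measure"
  assumes M: "finite_measure M" "sets M = sets borel" and F[measurable]: "F \<in> sets borel"
  shows "dilation t F \<in> sets (completion M)"
proof -
  define h where "h w = emeasure lborel ({r. fst w + r *\<^sub>R fst (snd w) \<in> F} \<inter> {fst (snd (snd w))..snd (snd (snd w))})"
    for w :: "(real ^ 'n) \<times> (real ^ 'n) \<times> real \<times> real"
  define P where "P = {z :: ((real ^ 'n) \<times> (real ^ 'n) \<times> real \<times> real) \<times> real.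
    fst (fst z) + snd z *\<^sub>R fst (snd (fst z)) \<in> F \<and> fst (snd (snd (fst z))) \<le> snd z \<and> snd z \<le> snd (snd (snd (fst z)))}"
  have "P \<in> sets borel"
  proof -
    have "(\<lambda>z :: ((real ^ 'n) \<times> (real ^ 'n) \<times> real \<times> real) \<times> real. fst (fst z) + snd z *\<^sub>R fst (snd (fst z))) \<in> borel_measurable borel"
      by (intro borel_measurable_continuous_onI continuous_intros)
    from measurable_sets[OF this F]
    have 1: "{z :: ((real ^ 'n) \<times> (real ^ 'n) \<times> real \<times> real) \<times> real. fst (fst z) + snd z *\<^sub>R fst (snd (fst z)) \<in> F} \<in> sets borel"
      by (simp add: vimage_def)
    have 2: "closed {z :: ((real ^ 'n) \<times> (real ^ 'n) \<times> real \<times> real) \<times> real. fst (snd (snd (fst z))) \<le> snd z}"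
      "closed {z :: ((real ^ 'n) \<times> (real ^ 'n) \<times> real \<times> real) \<times> real. snd z \<le> snd (snd (snd (fst z)))}"
      by (intro closed_Collect_le continuous_intros)+
    show ?thesis unfolding P_def Collect_conj_eq by (rule sets.Int[OF 1 sets.Int[OF borel_closed[OF 2(1)] borel_closed[OF 2(2)]]])
  qed
  then have "P \<in> sets (borel \<Otimes>\<^sub>M borel)"
    by (simp only: borel_prod)
  then have P: "P \<in> sets (borel \<Otimes>\<^sub>M lborel)"
    by (simp cong: sets_pair_measure_cong)
  have "(\<lambda>w. emeasure lborel (Pair w -` P)) \<in> borel_measurable borel"
    by (rule lborel.measurable_emeasure_Pair[OF P])
  moreover have "Pair w -` P = {r. fst w + r *\<^sub>R fst (snd w) \<in> F} \<inter> {fst (snd (snd w))..snd (snd (snd w))}" for w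
    by (auto simp: P_def)
  ultimately have h[measurable]: "h \<in> borel_measurable borel" by (simp add: h_def[abs_def])
  define B where "B = {w. norm (fst (snd w)) = 1} \<inter> {w. fst (snd (snd w)) \<le> 0} \<inter> {w. 0 \<le> snd (snd (snd w))}
    \<inter> {w. ennreal (snd (snd (snd w)) - fst (snd (snd w))) < ennreal ((t + 1) / 2) * h w}"
  have "B \<in> sets borel"
    unfolding B_def
  proof (intro sets.Int)
    show "{w :: (real ^ 'n) \<times> (real ^ 'n) \<times> real \<times> real. norm (fst (snd w)) = 1} \<in> sets borel"
      by (intro borel_closed closed_Collect_eq continuous_intros)
    show "{w :: (real ^ 'n) \<times> (real ^ 'n) \<times> real \<times> real. fst (snd (snd w)) \<le> 0} \<in> sets borel"
      "{w :: (real ^ 'n) \<times> (real ^ 'n) \<times> real \<times> real. 0 \<le> snd (snd (snd w))} \<in> sets borel"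
      by (intro borel_closed closed_Collect_le continuous_intros)+
    have [measurable]: "(\<lambda>w :: (real ^ 'n) \<times> (real ^ 'n) \<times> real \<times> real. snd (snd (snd w)) - fst (snd (snd w))) \<in> borel_measurable borel"
      by (intro borel_measurable_continuous_onI continuous_intros)
    have "{w \<in> space borel. ennreal (snd (snd (snd w)) - fst (snd (snd w))) < ennreal ((t + 1) / 2) * h w} \<in> sets borel"
      by measurable
    then show "{w. ennreal (snd (snd (snd w)) - fst (snd (snd w))) < ennreal ((t + 1) / 2) * h w} \<in> sets borel"
      by simp
  qed
  moreover have "dilation t F = fst ` B"
  proof (intro set_eqI iffI)
    fix x assume "x \<in> dilation t F"
    then obtain v p q where "norm v = 1" "p \<le> 0" "0 \<le> q"
      "ennreal (q - p) < ennreal ((t + 1) / 2) * emeasure lborel ({r. x + r *\<^sub>R v \<in> F} \<inter> {p..q})"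
      by (rule dilationE[OF F])
    then have "(x, v, p, q) \<in> B" by (simp add: B_def h_def)
    then show "x \<in> fst ` B" by force
  next
    fix x assume "x \<in> fst ` B"
    then obtain v p q where "(x, v, p, q) \<in> B" by auto
    then show "x \<in> dilation t F" by (intro dilationI[OF F, of v p q]) (auto simp: B_def h_def)
  qed
  ultimately show ?thesis using measurable_projection[OF M, of B] by simp
qed

lemma not_dilation_line_sparse:
  fixes F :: "(real ^ 'n) set"
  assumes F: "F \<in> sets borel" and t: "1 < t" and C: "C \<inter> dilation t F = {}"
  shows "line_sparse (2 / (t + 1)) F C"
  unfolding line_sparse_def sparse_near_def
proof (intro allI impI ballI)
  fix a v c p q assume v: "norm (v :: real ^ 'n) = 1" and c: "c \<in> {r. a + r *\<^sub>R v \<in> C}" and pq: "p \<le> c" "c \<le> q"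
  define G where "G = {r. a + r *\<^sub>R v \<in> F}"
  have Gb: "G \<in> sets borel" unfolding G_def by (rule line_preimage_borel[OF F])
  have "a + c *\<^sub>R v \<notin> dilation t F" using c C by auto
  then have "\<not> ennreal ((q - c) - (p - c)) < ennreal ((t + 1) / 2) * emeasure lborel ({r. (a + c *\<^sub>R v) + r *\<^sub>R v \<in> F} \<inter> {p - c..q - c})"
    using dilationI[OF F v, of "p - c" "q - c" t "a + c *\<^sub>R v"] pq by auto
  moreover have "{r. (a + c *\<^sub>R v) + r *\<^sub>R v \<in> F} \<inter> {p - c..q - c} = {r. c + r \<in> G \<inter> {p..q}}"
    by (auto simp: G_def algebra_simps)
  moreover have "emeasure lborel {r. c + r \<in> G \<inter> {p..q}} = emeasure lborel (G \<inter> {p..q})"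
    using Gb by (intro emeasure_lborel_translate) auto
  ultimately have le: "ennreal ((t + 1) / 2) * emeasure lborel (G \<inter> {p..q}) \<le> ennreal (q - p)" by (simp add: not_less)
  have "emeasure lborel (G \<inter> {p..q}) = ennreal (2 / (t + 1)) * (ennreal ((t + 1) / 2) * emeasure lborel (G \<inter> {p..q}))"
  proof -
    have "ennreal (2 / (t + 1)) * ennreal ((t + 1) / 2) = ennreal (2 / (t + 1) * ((t + 1) / 2))"
      using t by (intro ennreal_mult[symmetric]) auto
    also have "2 / (t + 1) * ((t + 1) / 2) = 1" using t by simp
    finally show ?thesis by (simp add: mult.assoc[symmetric])
  qed
  also have "\<dots> \<le> ennreal (2 / (t + 1)) * ennreal (q - p)" using le by (intro mult_left_mono) auto
  also have "\<dots> = ennreal (2 / (t + 1) * (q - p))" using t pq by (intro ennreal_mult[symmetric]) auto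
  finally show "emeasure lborel ({r. a + r *\<^sub>R v \<in> F} \<inter> {p..q}) \<le> ennreal (2 / (t + 1) * (q - p))"
    by (simp add: G_def)
qed

text \<open>This replaces the density theorem. Cover \<open>S\<close> by an open set of measure at
  most \<open>m + e\<close>: each component that meets \<open>S\<close> has at most the fraction
  \<open>l\<close> of its length in \<open>S\<close>, so \<open>m \<le> l * (m + e)\<close> for all
  \<open>e > 0\<close>.\<close>

lemma sparse_near_self_null:
  fixes S :: "real set"
  assumes S: "compact S" and sp: "sparse_near l S S" and l: "0 \<le> l" "l < 1"
  shows "emeasure lborel S = 0"
proof -
  have Sb: "S \<in> sets borel" using S by (rule borel_compact)
  obtain R where R: "\<And>x. x \<in> S \<Longrightarrow> \<bar>x\<bar> \<le> R"
    using compact_imp_bounded[OF S] by (auto simp: bounded_iff)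
  have fin: "emeasure lborel S < \<infinity>" by (rule emeasure_compact_finite[OF S])
  then obtain m where m: "emeasure lborel S = ennreal m" "0 \<le> m" by (cases "emeasure lborel S") auto
  have "m \<le> l * (m + e)" if e: "0 < e" for e
  proof -
    obtain U where U: "open U" "S \<subseteq> U" "emeasure lborel (U - S) < ennreal e"
      using outer_regular_lborel[OF Sb e] by blast
    define V where "V = U \<inter> {- R - 1<..<R + 1}"
    have V: "open V" "bounded V" "S \<subseteq> V"
    proof -
      show "open V" using U(1) unfolding V_def by (intro open_Int) auto
      show "bounded V" by (rule bounded_subset[of "{- R - 1..R + 1}"]) (auto simp: V_def)
      show "S \<subseteq> V" using U(2) R unfolding V_def by (force simp: abs_le_iff)
    qed
    have "emeasure lborel (S \<inter> V) \<le> ennreal l * emeasure lborel V"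
    proof (rule emeasure_open_le_components[OF V(1) Sb])
      fix I assume I: "I \<in> components V"
      obtain u v where uv: "u < v" "I = {u<..<v}" by (rule component_interval[OF V(1,2) I])
      show "emeasure lborel (S \<inter> I) \<le> ennreal l * emeasure lborel I"
      proof (cases "S \<inter> I = {}")
        case False
        then obtain c where c: "c \<in> S" "u < c" "c < v" unfolding uv(2) by auto
        have "emeasure lborel (S \<inter> I) \<le> emeasure lborel (S \<inter> {u..v})"
          unfolding uv(2) using Sb by (intro emeasure_mono) auto
        also have "\<dots> \<le> ennreal (l * (v - u))" using c by (intro sparse_nearD[OF sp, of _ c]) auto
        also have "\<dots> = ennreal l * emeasure lborel I"
          unfolding uv(2) using uv(1) l by (simp add: ennreal_mult)
        finally show ?thesis .
      qed simp
    qed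
    also have "S \<inter> V = S" using V(3) by auto
    also have "emeasure lborel V \<le> ennreal (m + e)"
    proof -
      have "emeasure lborel V \<le> emeasure lborel (S \<union> (U - S))"
        using U(1) Sb by (intro emeasure_mono) (auto simp: V_def)
      also have "\<dots> \<le> emeasure lborel S + emeasure lborel (U - S)"
        using U(1) Sb by (intro emeasure_subadditive) auto
      also have "\<dots> \<le> ennreal m + ennreal e"
        using U(3) unfolding m(1) by (intro add_mono) auto
      finally show ?thesis using m(2) e by simp
    qed
    finally have "ennreal m \<le> ennreal l * ennreal (m + e)" by (simp add: m(1) mult_left_mono)
    then show ?thesis using l m(2) e by (simp add: ennreal_mult[symmetric] del: ennreal_plus)
  qed
  then have ev: "\<forall>\<^sub>F e in at_right 0. m \<le> l * (m + e)"
    unfolding eventually_at_right_field by (intro exI[of _ 1]) auto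
  have "((\<lambda>e. l * (m + e)) \<longlongrightarrow> l * (m + 0)) (at_right 0)" by (intro tendsto_intros)
  from tendsto_lowerbound[OF this ev] have "m \<le> l * m" by simp
  then have "(1 - l) * m \<le> 0" by (simp add: algebra_simps)
  then have "m \<le> 0" using l by (simp add: mult_le_0_iff)
  then show ?thesis using m by simp
qed

text \<open>The zero-one law for the distance from \<open>p\<close> gives an atom the full mass of
  every ball around it, so the measure would be a point mass.\<close>

lemma s_concave_no_atoms:
  fixes M :: "(real ^ 'n) measure"
  assumes prob: "prob_space M" and sets: "sets M = sets borel" and sc: "s_concave s M"
    and nd: "\<nexists>a. M = return borel a"
  shows "measure M {p} = 0"
proof (rule ccontr)
  interpret prob_space M by (rule prob)
  have space: "space M = UNIV" using sets_eq_imp_space_eq[OF sets] by simp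
  assume pos: "measure M {p} \<noteq> 0"
  have dich: "measure M {p} = measure M (cball p (real n))" for n
  proof -
    have "measure M {x\<in>cball p (real n). dist x p = 0} = 0 \<or>
        measure M {x\<in>cball p (real n). dist x p = 0} = measure M (cball p (real n))"
    proof (rule quasiconcave_measure_zero_one[OF finite_measure_axioms sets])
      show "continuous_on UNIV (\<lambda>x. dist x p)" by (intro continuous_intros)
      show "dist ((1 - k) *\<^sub>R x + k *\<^sub>R y) p = k * dist y p"
        if "dist x p = 0" "0 \<le> k" for x y and k :: real
      proof -
        have "x = p" using that by simp
        then have "(1 - k) *\<^sub>R x + k *\<^sub>R y - p = k *\<^sub>R (y - p)" by (simp add: algebra_simps)
        then show ?thesis using that by (simp add: dist_norm)
      qed
    qed (use s_concave_min[OF sc] in auto)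
    moreover have "{x\<in>cball p (real n). dist x p = 0} = {p}" by auto
    ultimately show ?thesis using pos by simp
  qed
  have "(\<lambda>n. measure M (cball p (real n))) \<longlonglongrightarrow> measure M (\<Union>n. cball p (real n))"
  proof (rule finite_Lim_measure_incseq)
    show "range (\<lambda>n. cball p (real n)) \<subseteq> events" by (auto simp: sets)
    show "incseq (\<lambda>n. cball p (real n))" by (intro incseq_SucI) auto
  qed
  moreover have "(\<Union>n. cball p (real n)) = space M"
    using real_arch_simple by (auto simp: space)
  ultimately have "(\<lambda>n::nat. measure M {p}) \<longlonglongrightarrow> 1" using dich prob_space by simp
  then have one: "measure M {p} = 1" by (simp add: LIMSEQ_const_iff)
  have "M = return borel p"
  proof (rule measure_eqI)
    show "sets M = sets (return borel p)" by (simp add: sets)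
    fix A assume A: "A \<in> sets M"
    show "emeasure M A = emeasure (return borel p) A"
    proof (cases "p \<in> A")
      case True
      then have "measure M {p} \<le> measure M A" using A by (intro finite_measure_mono) auto
      then have "measure M A = 1" using one prob_le_1[of A] by simp
      then show ?thesis using A True by (simp add: emeasure_eq_measure sets)
    next
      case False
      then have "measure M ({p} \<union> A) = measure M {p} + measure M A"
        using A by (intro finite_measure_Union) (auto simp: sets)
      then have "measure M A = 0"
        using one prob_le_1[of "{p} \<union> A"] measure_nonneg[of M A] by linarith
      then show ?thesis using A False by (simp add: emeasure_eq_measure sets)
    qed
  qed
  then show False using nd by blast
qed

text \<open>By compactness some \<open>p\<close> in \<open>E\<close> has positive mass of
  \<open>E\<close> in all its neighbourhoods. As \<open>p\<close> itself is null, a small ball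
  around it leaves positive mass outside, and a smaller concentric ball gives the other
  piece.\<close>

lemma no_atoms_split_compact:
  fixes M :: "'a::euclidean_space measure"
  assumes "finite_measure M" and sets: "sets M = sets borel" and atom: "\<And>p. measure M {p} = 0"
    and E: "compact E" "0 < measure M E"
  obtains E1 E2 where "compact E1" "compact E2" "E1 \<subseteq> E" "E2 \<subseteq> E" "E1 \<inter> E2 = {}"
    "0 < measure M E1" "0 < measure M E2"
proof -
  interpret finite_measure M by fact
  have Eb: "E \<in> sets borel" using E(1) by (rule borel_compact)
  have "\<exists>p\<in>E. \<forall>r>0. 0 < measure M (E \<inter> ball p r)"
  proof (rule ccontr)
    assume "\<not> ?thesis"
    then have "\<forall>p\<in>E. \<exists>r>0. measure M (E \<inter> ball p r) = 0"
      by (simp add: zero_less_measure_iff)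
    then obtain r where r: "\<And>p. p \<in> E \<Longrightarrow> 0 < r p" "\<And>p. p \<in> E \<Longrightarrow> measure M (E \<inter> ball p (r p)) = 0"
      by metis
    obtain D where D: "D \<subseteq> E" "finite D" "E \<subseteq> (\<Union>p\<in>D. ball p (r p))"
    proof (rule compactE_image[OF E(1), of E "\<lambda>p. ball p (r p)"])
      show "E \<subseteq> (\<Union>p\<in>E. ball p (r p))" using r(1) by force
    qed auto
    have "E = (\<Union>p\<in>D. E \<inter> ball p (r p))" using D(3) by auto
    also have "measure M \<dots> \<le> (\<Sum>p\<in>D. measure M (E \<inter> ball p (r p)))"
      using D(2) Eb by (intro finite_measure_subadditive_finite) (auto simp: sets)
    also have "\<dots> = 0" using r(2) D(1) by (intro sum.neutral) auto
    finally show False using E(2) by simp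
  qed
  then obtain p where p: "\<And>r. 0 < r \<Longrightarrow> 0 < measure M (E \<inter> ball p r)" by blast
  have "(\<lambda>n. measure M (E \<inter> cball p (1 / real (Suc n)))) \<longlonglongrightarrow> measure M (\<Inter>n. E \<inter> cball p (1 / real (Suc n)))"
  proof (rule finite_Lim_measure_decseq)
    show "range (\<lambda>n. E \<inter> cball p (1 / real (Suc n))) \<subseteq> sets M" using Eb by (auto simp: sets)
    show "decseq (\<lambda>n. E \<inter> cball p (1 / real (Suc n)))"
    proof (intro decseq_SucI Int_mono order_refl subset_cball)
      show "1 / real (Suc (Suc n)) \<le> 1 / real (Suc n)" for n by (simp add: frac_le)
    qed
  qed
  moreover have "(\<Inter>n. E \<inter> cball p (1 / real (Suc n))) \<subseteq> {p}"
  proof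
    fix x assume "x \<in> (\<Inter>n. E \<inter> cball p (1 / real (Suc n)))"
    then have "dist p x \<le> 1 / real (Suc n)" for n by auto
    then have "dist p x \<le> 0"
      by (intro LIMSEQ_le_const[OF LIMSEQ_Suc[OF lim_1_over_n]]) auto
    then show "x \<in> {p}" by simp
  qed
  then have "measure M (\<Inter>n. E \<inter> cball p (1 / real (Suc n))) \<le> measure M {p}"
    by (intro finite_measure_mono) (auto simp: sets)
  then have "measure M (\<Inter>n. E \<inter> cball p (1 / real (Suc n))) = 0"
    using atom[of p] measure_nonneg[of M "\<Inter>n. E \<inter> cball p (1 / real (Suc n))"] by linarith
  ultimately have "\<forall>\<^sub>F n in sequentially. measure M (E \<inter> cball p (1 / real (Suc n))) < measure M E"
    using order_tendstoD(2)[of _ 0 _ "measure M E"] E(2) by auto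
  then obtain n where n: "measure M (E \<inter> cball p (1 / real (Suc n))) < measure M E"
    by (auto simp: eventually_sequentially)
  define r where "r = 1 / real (Suc n)"
  have r: "0 < r" by (simp add: r_def)
  define E1 where "E1 = E \<inter> cball p (r / 2)"
  define E2 where "E2 = E - ball p r"
  have c: "compact E1" "compact E2"
    unfolding E1_def E2_def using E(1) by (auto intro: compact_Int_closed compact_diff)
  have b: "E1 \<in> sets borel" "E2 \<in> sets borel" using c by (auto simp: borel_compact)
  have "0 < measure M (E \<inter> ball p (r / 2))" using p r by simp
  also have "\<dots> \<le> measure M E1" unfolding E1_def using Eb by (intro finite_measure_mono) (auto simp: sets)
  finally have 1: "0 < measure M E1" .
  have "measure M E \<le> measure M ((E \<inter> cball p r) \<union> E2)"
    using Eb b by (intro finite_measure_mono) (auto simp: sets E2_def)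
  also have "\<dots> \<le> measure M (E \<inter> cball p r) + measure M E2"
    using Eb b by (intro measure_Un_le) (auto simp: sets)
  finally have 2: "0 < measure M E2" using n by (simp add: r_def)
  have "E1 \<inter> E2 = {}" using r by (auto simp: E1_def E2_def)
  then show thesis using that[OF c] 1 2 by (auto simp: E1_def E2_def)
qed

text \<open>Disjoint compact pieces of \<open>E\<close> are sparse around each other for every
  \<open>l\<close>. As \<open>l\<close> tends to 0 the mean tends to 1 and leaves no mass for the
  first piece.\<close>

lemma s_concave_line_null:
  fixes M :: "(real ^ 'n) measure"
  assumes prob: "prob_space M" and sets: "sets M = sets borel" and sc: "s_concave s M" and s: "s \<le> 1"
    and nd: "\<nexists>a. M = return borel a" and E: "compact E"
    and null: "\<And>a v. norm v = 1 \<Longrightarrow> emeasure lborel {r. a + r *\<^sub>R v \<in> E} = 0"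
  shows "measure M E = 0"
proof (rule ccontr)
  interpret prob_space M by (rule prob)
  assume "measure M E \<noteq> 0"
  then have "0 < measure M E" by (simp add: zero_less_measure_iff)
  from no_atoms_split_compact[OF finite_measure_axioms sets s_concave_no_atoms[OF prob sets sc nd] E this]
  obtain E1 E2 where E12: "compact E1" "compact E2" "E1 \<subseteq> E" "E2 \<subseteq> E" "E1 \<inter> E2 = {}"
    "0 < measure M E1" "0 < measure M E2" by blast
  have sp: "line_sparse l E1 E2" for l
    unfolding line_sparse_def sparse_near_def
  proof (intro allI impI ballI)
    fix a v :: "real ^ 'n" and c p q :: real assume v: "norm v = 1"
    have "emeasure lborel ({r. a + r *\<^sub>R v \<in> E1} \<inter> {p..q}) \<le> emeasure lborel {r. a + r *\<^sub>R v \<in> E}"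
      using E12(3) line_preimage_borel[OF borel_compact[OF E]] by (intro emeasure_mono) auto
    then show "emeasure lborel ({r. a + r *\<^sub>R v \<in> E1} \<inter> {p..q}) \<le> ennreal (l * (q - p))"
      using null[OF v] by simp
  qed
  have le: "measure M E1 \<le> 1 - pmean s l (measure M E2) 1" if "0 < l" "l < 1" for l
    by (rule s_concave_line_sparse[OF prob sets sc s E12(2,1,5,7) that sp])
  have "isCont (\<lambda>l. pmean s l (measure M E2) 1) 0" using E12(7) by (intro isCont_pmean_weight) auto
  then have "((\<lambda>l. pmean s l (measure M E2) 1) \<longlongrightarrow> pmean s 0 (measure M E2) 1) (at 0)"
    by (simp only: isCont_def)
  then have "((\<lambda>l. pmean s l (measure M E2) 1) \<longlongrightarrow> pmean s 0 (measure M E2) 1) (at_right 0)"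
    by (rule tendsto_within_subset) simp
  then have lim: "((\<lambda>l. 1 - pmean s l (measure M E2) 1) \<longlongrightarrow> 1 - 1) (at_right 0)"
    using pmean_weight_zero[OF E12(7), of 1 s] by (intro tendsto_diff tendsto_const) simp
  have "measure M E1 \<le> 1 - 1"
  proof (rule tendsto_lowerbound[OF lim])
    show "\<forall>\<^sub>F l in at_right 0. measure M E1 \<le> 1 - pmean s l (measure M E2) 1"
      unfolding eventually_at_right_field using le by (intro exI[of _ 1]) auto
  qed simp
  then show False using E12(6) by simp
qed

section \<open>Passage from compact to Borel sets\<close>

lemma compact_inner_approx:
  fixes M :: "'a::euclidean_space measure"
  assumes "finite_measure M" and sets: "sets M = sets borel" and B: "B \<in> sets borel" and t: "t < measure M B"
  obtains K where "compact K" "K \<subseteq> B" "t < measure M K"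
proof -
  interpret finite_measure M by fact
  show thesis
  proof (cases "t < 0")
    case True
    then show ?thesis using that[of "{}"] by simp
  next
    case False
    then have "ennreal t < emeasure M B" using t by (simp add: emeasure_eq_measure ennreal_less_iff)
    also have "emeasure M B = (SUP K \<in> {K. K \<subseteq> B \<and> compact K}. emeasure M K)"
      using B by (intro inner_regular[OF sets]) auto
    finally obtain K where K: "K \<subseteq> B" "compact K" "ennreal t < emeasure M K"
      by (auto simp: less_SUP_iff)
    then have "t < measure M K" using False by (simp add: emeasure_eq_measure ennreal_less_iff)
    then show ?thesis using that K by blast
  qed
qed

text \<open>The complement of the dilation is measurable only for the completion, so its Borel main
  part \<open>B\<close> takes its place. Compact subsets of \<open>B \<inter> F\<close> are sparse
  around their own points on every line, hence null; so \<open>B - F\<close> still has full mass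
  \<open>\<theta>\<close>, and compact subsets of it are disjoint from those of
  \<open>F\<close>.\<close>

lemma s_concave_dilation_pmean:
  fixes M :: "(real ^ 'n) measure"
  assumes F: "F \<in> sets borel" and t: "1 < t" and s: "s \<le> 1"
    and prob: "prob_space M" and sets: "sets M = sets borel" and sc: "s_concave s M"
    and nd: "\<nexists>a. M = return borel a"
    and less: "measure (completion M) (dilation t F) < 1"
  shows "measure M F \<le> 1 - pmean s (2 / (t + 1)) (measure (completion M) (- dilation t F)) 1"
proof -
  interpret prob_space M by (rule prob)
  interpret c: prob_space "completion M"
    by (rule prob_spaceI) (simp add: emeasure_space_1)
  have space: "space M = UNIV" using sets_eq_imp_space_eq[OF sets] by simp
  define D where "D = dilation t F"
  define l where "l = 2 / (t + 1)"
  have l: "0 < l" "l < 1" using t by (auto simp: l_def)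
  have Dm: "D \<in> sets (completion M)"
    unfolding D_def by (rule dilation_measurable[OF finite_measure_axioms sets F])
  have cD: "- D \<in> sets (completion M)"
    using sets.compl_sets[OF Dm] by (simp add: space Compl_eq_Diff_UNIV)
  define \<theta> where "\<theta> = measure (completion M) (- D)"
  have "\<theta> = 1 - measure (completion M) D"
    using c.prob_compl[OF Dm] by (simp add: \<theta>_def space Compl_eq_Diff_UNIV)
  then have \<theta>: "0 < \<theta>" using less by (simp add: D_def)
  define B where "B = main_part M (- D)"
  have B: "B \<in> sets borel" "B \<subseteq> - D" "measure M B = \<theta>"
  proof -
    show "B \<in> sets borel" using main_part_sets[OF cD] by (simp add: B_def sets)
    show "B \<subseteq> - D" using main_part_null_part_Un[OF cD] by (auto simp: B_def)
    show "measure M B = \<theta>" using emeasure_completion[OF cD] by (simp add: B_def \<theta>_def measure_def)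
  qed
  have null: "measure M (B \<inter> F) = 0"
  proof (rule ccontr)
    assume "measure M (B \<inter> F) \<noteq> 0"
    then have "0 < measure M (B \<inter> F)" by (simp add: zero_less_measure_iff)
    then obtain E where E: "compact E" "E \<subseteq> B \<inter> F" "0 < measure M E"
      using compact_inner_approx[OF finite_measure_axioms sets, of "B \<inter> F" 0] B F by blast
    have "E \<inter> dilation t F = {}" using E B by (auto simp: D_def)
    then have sp: "line_sparse l F E" unfolding l_def by (rule not_dilation_line_sparse[OF F t])
    have "measure M E = 0"
    proof (rule s_concave_line_null[OF prob sets sc s nd E(1)])
      fix a v :: "real ^ 'n" assume v: "norm v = 1"
      have "closed {r. a + r *\<^sub>R v \<in> E}"
      proof -
        have "continuous_on UNIV (\<lambda>r::real. a + r *\<^sub>R v)" by (intro continuous_intros)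
        from closed_vimage[OF compact_imp_closed[OF E(1)] this] show ?thesis by (simp add: vimage_def)
      qed
      moreover have "bounded {r. a + r *\<^sub>R v \<in> E}"
      proof -
        obtain R where R: "\<And>x. x \<in> E \<Longrightarrow> norm x \<le> R" using compact_imp_bounded[OF E(1)] by (auto simp: bounded_iff)
        have "\<bar>r\<bar> \<le> R + norm a" if r: "a + r *\<^sub>R v \<in> E" for r
        proof -
          have "norm (r *\<^sub>R v) \<le> norm (a + r *\<^sub>R v) + norm a"
            using norm_triangle_ineq4[of "a + r *\<^sub>R v" a] by simp
          then show ?thesis using R[OF r] v by simp
        qed
        then show ?thesis by (auto simp: bounded_iff)
      qed
      ultimately have cE: "compact {r. a + r *\<^sub>R v \<in> E}" by (simp add: compact_eq_bounded_closed)
      have subE: "{r. a + r *\<^sub>R v \<in> E} \<subseteq> {r. a + r *\<^sub>R v \<in> F}"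
        using E(2) by auto
      have "sparse_near l {r. a + r *\<^sub>R v \<in> F} {r. a + r *\<^sub>R v \<in> E}"
        using sp v by (simp add: line_sparse_def)
      from this subE order_refl line_preimage_borel[OF F]
      have "sparse_near l {r. a + r *\<^sub>R v \<in> E} {r. a + r *\<^sub>R v \<in> E}"
        by (rule sparse_near_mono)
      then show "emeasure lborel {r. a + r *\<^sub>R v \<in> E} = 0"
        using l by (intro sparse_near_self_null[OF cE]) auto
    qed
    then show False using E(3) by simp
  qed
  have "measure M B = measure M (B \<inter> F) + measure M (B - F)"
    using finite_measure_Union[of "B \<inter> F" "B - F"] B F by (simp add: sets Int_Diff_disjoint Int_Diff_Un)
  then have BF: "measure M (B - F) = \<theta>" using null B(3) by simp
  have le: "measure M F - e \<le> 1 - pmean s l (\<theta> - e) 1" if e: "0 < e" "e < \<theta>" for e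
  proof -
    obtain C where C: "compact C" "C \<subseteq> B - F" "\<theta> - e < measure M C"
      using compact_inner_approx[OF finite_measure_axioms sets, of "B - F" "\<theta> - e"] B F BF e by auto
    obtain F' where F': "compact F'" "F' \<subseteq> F" "measure M F - e < measure M F'"
      using compact_inner_approx[OF finite_measure_axioms sets F, of "measure M F - e"] e by auto
    have "C \<inter> dilation t F = {}" using C B by (auto simp: D_def)
    then have sp: "line_sparse l F C" unfolding l_def by (rule not_dilation_line_sparse[OF F t])
    have sp': "line_sparse l F' C"
      unfolding line_sparse_def
    proof (intro allI impI)
      fix a v :: "real ^ 'n" assume "norm v = 1"
      then have "sparse_near l {r. a + r *\<^sub>R v \<in> F} {r. a + r *\<^sub>R v \<in> C}"
        using sp by (simp add: line_sparse_def)
      moreover have "{r. a + r *\<^sub>R v \<in> F'} \<subseteq> {r. a + r *\<^sub>R v \<in> F}"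
        using F'(2) by auto
      ultimately show "sparse_near l {r. a + r *\<^sub>R v \<in> F'} {r. a + r *\<^sub>R v \<in> C}"
        by (rule sparse_near_mono[OF _ _ order_refl line_preimage_borel[OF F]])
    qed
    have "measure M F' \<le> 1 - pmean s l (measure M C) 1"
      using C F' e l sp' by (intro s_concave_line_sparse[OF prob sets sc s]) auto
    also have "\<dots> \<le> 1 - pmean s l (\<theta> - e) 1"
      using C(3) e l by (simp add: pmean_mono)
    finally show ?thesis using F'(3) by simp
  qed
  have c: "isCont (\<lambda>x. pmean s l x 1) (\<theta> - 0)" using \<theta> l by (intro isCont_pmean_left) auto
  have 1: "((\<lambda>e. \<theta> - e) \<longlongrightarrow> \<theta> - 0) (at_right 0)" by (intro tendsto_intros)
  have 2: "((\<lambda>e. 1 - pmean s l (\<theta> - e) 1) \<longlongrightarrow> 1 - pmean s l (\<theta> - 0) 1) (at_right 0)"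
    by (intro tendsto_diff tendsto_const isCont_tendsto_compose[OF c 1])
  have 3: "((\<lambda>e. measure M F - e) \<longlongrightarrow> measure M F - 0) (at_right 0)" by (intro tendsto_intros)
  have "measure M F - 0 \<le> 1 - pmean s l (\<theta> - 0) 1"
  proof (rule tendsto_le[OF _ 2 3])
    show "\<forall>\<^sub>F e in at_right 0. measure M F - e \<le> 1 - pmean s l (\<theta> - e) 1"
      unfolding eventually_at_right_field using le \<theta> by (intro exI[of _ \<theta>]) auto
  qed simp
  then show ?thesis by (simp add: \<theta>_def l_def D_def)
qed

theorem theorem1:
  fixes M :: "(real ^ 'n) measure" and F :: "(real ^ 'n) set" and s t :: real
  assumes "F \<in> sets borel" and "t > 1" and "s \<le> 1"
    and "prob_space M" and "sets M = sets borel" and "s_concave s M"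
    and not_dirac: "\<nexists>a. M = return borel a"
    and "measure (completion M) (dilation t F) < 1"
  shows "measure M (- F) \<ge>
    (if s = 0 then measure (completion M) (- dilation t F) powr (2 / (t + 1))
     else (2 / (t + 1) * measure (completion M) (- dilation t F) powr s + (t - 1) / (t + 1))
            powr (1 / s))"
proof -
  interpret prob_space M by fact
  have space: "space M = UNIV" using sets_eq_imp_space_eq[OF \<open>sets M = sets borel\<close>] by simp
  have "measure M (- F) = 1 - measure M F"
    using prob_compl[of F] assms(1,5) by (simp add: space Compl_eq_Diff_UNIV)
  moreover have "1 - 2 / (t + 1) = (t - 1) / (t + 1)"
    using assms(2) by (simp add: field_simps)
  then have "pmean s (2 / (t + 1)) x 1 = (if s = 0 then x powr (2 / (t + 1))
      else (2 / (t + 1) * x powr s + (t - 1) / (t + 1)) powr (1 / s))" for x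
    by (simp add: pmean_def)
  ultimately show ?thesis
    using s_concave_dilation_pmean[OF assms(1-7) assms(8)] by (simp only:)
qed

end
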